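(* For any $\varepsilon,\eta>0$, $$\lim_{n\to\infty}P_n\!\left(\sup_{\mathbf{t}\in[\eta,\infty)^r}\left|s_n^r\,\varphi\!\left(s_n^{-1}\mathbf{t}\right)-f_r(\mathbf{t})\right|\le\varepsilon\right)=1.$$
   Context: Throughout $r\ge 2$ is a fixed integer and $\mathbb{N}=\{1,2,\dots\}$, $\mathbb{N}_0=\mathbb{N}\cup\{0\}$. For $\mathbf{y}\in\mathbb{R}^r_{\ge0}$ put $$a(\mathbf{y}):=\frac{1}{c_r}\prod_{1\le\ell\le j\le r}(y_\ell+\dots+y_j),\qquad c_r:=r!\,(r-1)!\cdots1!.$$ Finite-dimensional irreducible representations $\rho_{\mathbf{k}}$ of $\mathfrak{sl}_{r+1}(\mathbb{C})$ are indexed (up to isomorphism) by $\mathbf{k}\in\mathbb{N}^r$, with $\dim\rho_{\mathbf{k}}=a(\mathbf{k})$. A finite-dimensional representation $\rho$ (up to isomorphism) is $\rho=\bigoplus_{\mathbf{k}\in\mathbb{N}^r}\rho_{\mathbf{k}}^{X_{\mathbf{k}}(\rho)}$ with multiplicities $X_{\mathbf{k}}(\rho)\in\mathbb{N}_0$, all but finitely many zero, and $\dim\rho=\sum_{\mathbf{k}}a(\mathbf{k})X_{\mathbf{k}}(\rho)$. $P_n$ is the uniform probability measure on the (finite) set of $n$-dimensional representations up to isomorphism. The shape function is the random function $$\varphi(\mathbf{t}):=\sum_{\mathbf{k}\in\mathbb{N}^r,\ k_j\ge t_j\text{ for all }j}X_{\mathbf{k}},\qquad \mathbf{t}\in(0,\infty)^r,$$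 and $$f_r(\mathbf{t}):=\int_{\prod_{j=1}^r[t_j,\infty)}\frac{e^{-a(\mathbf{y})}}{1-e^{-a(\mathbf{y})}}\,dy_1\cdots dy_r,\qquad \mathbf{t}\in(0,\infty)^r.$$ For $n\in\mathbb{N}$, $q_n\in(0,1)$ is the unique solution $q$ of $\sum_{\mathbf{k}\in\mathbb{N}^r}\frac{a(\mathbf{k})q^{a(\mathbf{k})}}{1-q^{a(\mathbf{k})}}=n$, and $s_n>0$ is defined by $q_n=\exp\big(-s_n^{r(r+1)/2}\big)$. *)

theory Defs
  imports "HOL-Probability.Probability"
begin

text \<open>
  Points of \<open>\<real>\<^sup>r\<close> are functions on the index set \<open>{1..r}\<close>, extended by \<open>undefined\<close>
  (the carrier of the product measure \<open>\<Pi>\<^sub>M j\<in>{1..r}. lborel\<close>). Throughout, the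
  parameter \<open>r\<close> is the rank of \<open>sl\<^sub>r\<^sub>+\<^sub>1(\<complex>)\<close>.
\<close>

definition dim_poly :: "nat \<Rightarrow> (nat \<Rightarrow> real) \<Rightarrow> real" where
  "dim_poly r y = (\<Prod>l=1..r. \<Prod>j=l..r. \<Sum>i=l..j. y i) / (\<Prod>i=1..r. fact i)"

definition irrep_labels :: "nat \<Rightarrow> (nat \<Rightarrow> nat) set" where
  "irrep_labels r = ({1..r} \<rightarrow>\<^sub>E {1..})"

definition irrep_dim :: "nat \<Rightarrow> (nat \<Rightarrow> nat) \<Rightarrow> real" where
  "irrep_dim r k = dim_poly r (\<lambda>j. real (k j))"

text \<open>
  A finite-dimensional representation up to isomorphism is the multiset of the labels of its
  irreducible constituents, where \<open>dim_poly\<close> is the Weyl dimension formula; the multiplicity \<open>X\<^sub>k(\<rho>)\<close> is \<open>count \<rho> k\<close>.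
\<close>

definition rep_dim :: "nat \<Rightarrow> (nat \<Rightarrow> nat) multiset \<Rightarrow> real" where
  "rep_dim r \<rho> = (\<Sum>k\<in>set_mset \<rho>. irrep_dim r k * real (count \<rho> k))"

definition reps :: "nat \<Rightarrow> nat \<Rightarrow> (nat \<Rightarrow> nat) multiset set" where
  "reps r n = {\<rho>. set_mset \<rho> \<subseteq> irrep_labels r \<and> rep_dim r \<rho> = real n}"

definition rep_measure :: "nat \<Rightarrow> nat \<Rightarrow> (nat \<Rightarrow> nat) multiset measure" where
  "rep_measure r n = uniform_count_measure (reps r n)"

definition shape :: "nat \<Rightarrow> (nat \<Rightarrow> nat) multiset \<Rightarrow> (nat \<Rightarrow> real) \<Rightarrow> nat" where
  "shape r \<rho> t = (\<Sum>k | k \<in> set_mset \<rho> \<and> (\<forall>j\<in>{1..r}. t j \<le> real (k j)). count \<rho> k)"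

definition limit_shape :: "nat \<Rightarrow> (nat \<Rightarrow> real) \<Rightarrow> real" where
  "limit_shape r t =
     (LINT y:(\<Pi>\<^sub>E j\<in>{1..r}. {t j..})|(\<Pi>\<^sub>M j\<in>{1..r}. lborel).
        exp (- dim_poly r y) / (1 - exp (- dim_poly r y)))"

definition q_seq :: "nat \<Rightarrow> nat \<Rightarrow> real" where
  "q_seq r n = (THE x. x \<in> {0<..<1} \<and>
     ((\<lambda>k. irrep_dim r k * x powr irrep_dim r k / (1 - x powr irrep_dim r k))
        has_sum real n) (irrep_labels r))"

definition s_seq :: "nat \<Rightarrow> nat \<Rightarrow> real" where
  "s_seq r n = (THE x. x > 0 \<and> q_seq r n = exp (- (x ^ (r * (r + 1) div 2))))"

end

theory Submission
  imports Defs "HOL-Real_Asymp.Real_Asymp"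
begin

text \<open>
  Give a representation \<open>\<rho>\<close> the Boltzmann weight \<open>exp (- \<theta> dim \<rho>)\<close>. The multiplicities then become
  independent geometric variables, and the uniform law on \<open>n\<close>-dimensional representations is this
  law conditioned on the dimension being \<open>n\<close>. With \<open>\<theta> = s\<^sub>n ^ (r (r + 1) / 2)\<close> the mean dimension
  is \<open>n\<close>. Since \<open>dim_poly\<close> is homogeneous of degree \<open>r (r + 1) / 2\<close>, the expectation of the rescaled
  shape function at \<open>t\<close> is a Riemann sum of mesh \<open>s\<^sub>n\<close> for the integral that defines the limit shape.

  The shape function at \<open>t / s\<^sub>n\<close>, where all coordinates of \<open>t\<close> are at least \<open>\<eta>\<close>, counts a number of
  constituents of order \<open>s\<^sub>n ^ (- r)\<close>, and by exponential moments a deviation of this order from its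
  mean has probability at most
  \<open>exp (- \<kappa> s\<^sub>n ^ (- r))\<close> for some \<open>\<kappa> > 0\<close> (\<open>card_tilted_le\<close>, \<open>statistic_concentration\<close>). It therefore
  suffices that conditioning on the dimension costs at most a factor \<open>exp (\<delta> s\<^sub>n ^ (- r))\<close> for every
  \<open>\<delta> > 0\<close>, that is, that there are many \<open>n\<close>-dimensional representations (\<open>card_parts_ge\<close>). This is much
  weaker than a local limit theorem and has a soft proof. The trivial representation has dimension one,
  so adding copies of it shows that the number of \<open>m\<close>-dimensional representations is nondecreasing in
  \<open>m\<close>; hence the whole mass of the Boltzmann law in a window just below \<open>n\<close> can be charged to \<open>n\<close>
  (\<open>partition_function_le_window\<close>). The parameter is raised slightly, to put the mean in the middle of
  this window; by convexity of the logarithm of the partition function this does not decrease the bound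
  (\<open>partition_function_exponent_mono\<close>). A window whose width is a small multiple of \<open>s\<^sub>n ^ (- r) / \<theta>\<close>
  is cheap enough, and it captures most of the mass as soon as the variance of the dimension is
  \<open>o (s\<^sub>n ^ (- 2 r) / \<theta>\<^sup>2)\<close>.

  The variance is controlled by convergence of the Witten zeta function, the sum of
  \<open>dim \<rho>\<^sub>k ^ (- \<gamma>)\<close>, at some exponent \<open>\<gamma>\<close> below \<open>4 / (r + 1)\<close>. The choice \<open>\<gamma> = 3 / (r + 1)\<close> works
  by the elementary bound \<open>x\<^sub>l + ... + x\<^sub>j \<ge> sqrt (x\<^sub>l x\<^sub>j)\<close>, which gives
  \<open>dim \<rho>\<^sub>k \<ge> (k\<^sub>1 ... k\<^sub>r) ^ ((r + 1) / 2) / c\<^sub>r\<close> (\<open>dim_poly_sq_ge\<close>, \<open>witten_zeta_summable\<close>).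

  Uniformity in \<open>t\<close> comes from monotonicity: both functions decrease in every coordinate, and the limit
  shape is Lipschitz on the region considered and vanishes at infinity, so finitely many grid points control the supremum
  (\<open>grid_controls_sup\<close>).
\<close>

section \<open>Integrality of the Weyl dimension\<close>

text \<open>
  Induction on the degree: the forward difference has smaller degree and is integral at
  one initial value less.
\<close>

lemma poly_Ints_from_initial_values:
  fixes p :: "real poly"
  assumes "degree p \<le> d" and "\<And>i. i \<le> d \<Longrightarrow> poly p (real i) \<in> \<int>"
  shows "poly p (real m) \<in> \<int>"
  using assms
proof (induction d arbitrary: p m)
  case 0
  then obtain c where "p = [:c:]"
    by (auto elim: degree_eq_zeroE)
  with 0(2)[of 0] show ?case by simp
next
  case (Suc d)
  define q where "q = pcompose p [:1, 1:] - p"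
  have q: "poly q (real i) = poly p (real (Suc i)) - poly p (real i)" for i
    by (simp add: q_def poly_pcompose add.commute)
  have deg: "degree q \<le> d"
  proof (cases "degree p = Suc d")
    case True
    have "degree (pcompose p [:1, 1:]) = Suc d"
      by (simp add: degree_pcompose True)
    moreover have "lead_coeff (pcompose p [:1, 1:]) = lead_coeff p"
      by (subst lead_coeff_comp) auto
    ultimately have "coeff q (Suc d) = 0" and "degree q \<le> Suc d"
      using True by (auto simp: q_def intro: degree_diff_le)
    then show ?thesis
      using eq_zero_or_degree_less less_Suc_eq_le by fastforce
  next
    case False
    with Suc.prems(1) have "degree p \<le> d" by simp
    moreover have "degree (pcompose p [:1, 1:]) = degree p"
      by (simp add: degree_pcompose)
    ultimately show ?thesis
      unfolding q_def by (intro degree_diff_le) auto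
  qed
  have "poly q (real i) \<in> \<int>" if "i \<le> d" for i
    unfolding q using that by (intro Ints_diff Suc.prems(2)) auto
  then have q_int: "poly q (real i) \<in> \<int>" for i
    using Suc.IH deg by blast
  show ?case
  proof (induction m)
    case 0
    then show ?case using Suc.prems(2)[of 0] by simp
  next
    case (Suc m)
    have "poly p (real (Suc m)) = poly p (real m) + poly q (real m)"
      by (simp add: q)
    then show ?case using Suc.IH q_int by (metis Ints_add)
  qed
qed

definition index_pairs :: "nat \<Rightarrow> (nat \<times> nat) set" where
  "index_pairs r = {(i, j). i < j \<and> j \<le> r}"

definition vandermonde :: "nat \<Rightarrow> (nat \<Rightarrow> nat) \<Rightarrow> real" where
  "vandermonde r x = (\<Prod>(i, j)\<in>index_pairs r. real (x j) - real (x i))"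

lemma finite_index_pairs [simp]: "finite (index_pairs r)"
  by (rule finite_subset[of _ "{..r} \<times> {..r}"]) (auto simp: index_pairs_def)

lemma vandermonde_id_pos: "vandermonde r id > 0"
  unfolding vandermonde_def by (rule prod_pos) (auto simp: index_pairs_def)

text \<open>
  The square is a product over ordered pairs of distinct indices, on which any permutation of the
  indices acts.
\<close>

lemma vandermonde_sq:
  "(vandermonde r x)\<^sup>2 = (\<Prod>(i, j)\<in>{(i, j). i \<le> r \<and> j \<le> r \<and> i \<noteq> j}. \<bar>real (x j) - real (x i)\<bar>)"
proof -
  let ?P = "index_pairs r" and ?f = "\<lambda>(i, j). \<bar>real (x j) - real (x i)\<bar>"
  have split: "{(i, j). i \<le> r \<and> j \<le> r \<and> i \<noteq> j} = ?P \<union> prod.swap ` ?P"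
    by (force simp: index_pairs_def image_iff)
  have "prod ?f (?P \<union> prod.swap ` ?P) = prod ?f ?P * prod ?f (prod.swap ` ?P)"
    by (rule prod.union_disjoint) (simp, simp, auto simp: index_pairs_def)
  also have "prod ?f (prod.swap ` ?P) = prod ?f ?P"
    by (subst prod.reindex) (auto intro!: prod.cong simp: abs_minus_commute)
  also have "prod ?f ?P = \<bar>vandermonde r x\<bar>"
    unfolding vandermonde_def abs_prod by (intro prod.cong) auto
  finally show ?thesis
    by (simp add: split power2_eq_square)
qed

text \<open>
  If all entries lie in \<open>{0..r}\<close>, then either two of them coincide and the product vanishes, or they
  are a permutation of \<open>{0..r}\<close> and the quotient is \<open>1\<close> or \<open>-1\<close>.
\<close>

lemma vandermonde_grid:
  assumes "\<And>i. i \<le> r \<Longrightarrow> x i \<le> r"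
  shows "vandermonde r x / vandermonde r id \<in> \<int>"
proof (cases "inj_on x {..r}")
  case True
  let ?O = "{(i, j). i \<le> r \<and> j \<le> r \<and> i \<noteq> j}"
  have "x ` {..r} = {..r}"
    using assms True by (intro endo_inj_surj) auto
  then have bij: "bij_betw (map_prod x x) ?O ?O"
    using True unfolding bij_betw_def
    by (auto simp: inj_on_def image_iff set_eq_iff) (metis atMost_iff imageE)+
  have "(vandermonde r x)\<^sup>2 = (vandermonde r id)\<^sup>2"
    unfolding vandermonde_sq
    by (subst prod.reindex_bij_betw[OF bij, symmetric]) (simp add: case_prod_beta)
  then have "vandermonde r x = vandermonde r id \<or> vandermonde r x = - vandermonde r id"
    by (simp add: power2_eq_iff)
  then show ?thesis using vandermonde_id_pos[of r] by auto
next
  case False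
  then obtain i j where "i < j" "j \<le> r" "x i = x j"
    by (auto simp: inj_on_def) (metis linorder_neqE_nat)
  then have "vandermonde r x = 0"
    unfolding vandermonde_def
    by (intro prod_zero finite_index_pairs) (force simp: index_pairs_def)
  then show ?thesis by simp
qed

lemma vandermonde_polynomial_in_one_entry:
  assumes "n \<le> r"
  obtains p :: "real poly" where "degree p \<le> r"
    and "\<And>z. poly p (real z) = vandermonde r (x(n := z)) / vandermonde r id"
proof -
  define f where "f = (\<lambda>(i, j). if j = n then [:- real (x i), 1:]
      else if i = n then [:real (x j), -1:] else [:real (x j) - real (x i):])"
  let ?P = "index_pairs r" and ?Q = "{(i, j) \<in> index_pairs r. i = n \<or> j = n}"
  have "poly (prod f ?P) (real z) = vandermonde r (x(n := z))" for z
    unfolding poly_prod vandermonde_def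
    by (intro prod.cong) (auto simp: f_def index_pairs_def)
  then have ev: "poly (smult (1 / vandermonde r id) (prod f ?P)) (real z) =
      vandermonde r (x(n := z)) / vandermonde r id" for z
    by simp
  have "card ?Q = card ({..r} - {n})"
  proof (rule bij_betw_same_card)
    show "bij_betw (\<lambda>(i, j). if i = n then j else i) ?Q ({..r} - {n})"
      by (rule bij_betw_byWitness[where f' = "\<lambda>k. if k < n then (k, n) else (n, k)"])
        (use assms in \<open>auto simp: index_pairs_def split: if_splits\<close>)
  qed
  then have cardQ: "card ?Q = r"
    using assms by simp
  have "degree (prod f ?P) \<le> sum (degree \<circ> f) ?P"
    by (rule degree_prod_sum_le) simp
  also have "\<dots> \<le> (\<Sum>ij\<in>?P. if fst ij = n \<or> snd ij = n then 1 else 0)"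
    by (intro sum_mono) (auto simp: f_def)
  also have "\<dots> = card ?Q"
    by (simp add: sum.If_cases Int_def) (auto intro!: arg_cong[where f = card])
  finally have "degree (smult (1 / vandermonde r id) (prod f ?P)) \<le> r"
    using cardQ degree_smult_le le_trans by metis
  with ev that show thesis by blast
qed

text \<open>
  The quotient is a polynomial of degree at most \<open>r\<close> in each entry and it is integral on the grid
  \<open>{0..r} ^ (r + 1)\<close>. Freeing the entries one at a time extends integrality to all natural entries.
\<close>

lemma vandermonde_quotient_Ints: "vandermonde r x / vandermonde r id \<in> \<int>"
proof -
  have *: "vandermonde r x / vandermonde r id \<in> \<int>"
    if "n \<le> Suc r" "\<And>i. n \<le> i \<Longrightarrow> i \<le> r \<Longrightarrow> x i \<le> r" for n x
    using that
  proof (induction n arbitrary: x)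
    case 0
    then show ?case by (intro vandermonde_grid) auto
  next
    case (Suc n)
    obtain p :: "real poly" where p: "degree p \<le> r"
      "\<And>z. poly p (real z) = vandermonde r (x(n := z)) / vandermonde r id"
      using vandermonde_polynomial_in_one_entry[of n r x] Suc.prems(1) by auto
    have "poly p (real z) \<in> \<int>" if "z \<le> r" for z
      unfolding p using Suc.prems that by (intro Suc.IH) auto
    from poly_Ints_from_initial_values[OF p(1) this, of "x n"] show ?case
      by (simp only: p(2) fun_upd_triv)
  qed
  show ?thesis by (rule *[of "Suc r"]) auto
qed

text \<open>
  The sums over positive roots are the differences of the partial sums of \<open>k\<close>, so the numerator of
  Weyl's formula is a Vandermonde product.
\<close>

definition partial_sum :: "(nat \<Rightarrow> nat) \<Rightarrow> nat \<Rightarrow> nat" where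
  "partial_sum k j = (\<Sum>i=1..j. k i)"

lemma root_product_eq_vandermonde:
  "(\<Prod>l=1..r. \<Prod>j=l..r. \<Sum>i=l..j. real (k i)) = vandermonde r (partial_sum k)"
proof -
  have ps: "(\<Sum>i=l..j. real (k i)) = real (partial_sum k j) - real (partial_sum k (l - 1))"
    if "1 \<le> l" "l \<le> j" for l j
  proof -
    have "{1..j} = {1..l-1} \<union> {l..j}" using that by auto
    then have "partial_sum k j = partial_sum k (l - 1) + (\<Sum>i=l..j. k i)"
      unfolding partial_sum_def by (simp only:) (subst sum.union_disjoint, use that in auto)
    then show ?thesis by simp
  qed
  have "(\<Prod>l=1..r. \<Prod>j=l..r. \<Sum>i=l..j. real (k i)) =
      (\<Prod>(l, j)\<in>Sigma {1..r} (\<lambda>l. {l..r}). \<Sum>i=l..j. real (k i))"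
    by (rule prod.Sigma) auto
  also have "\<dots> = vandermonde r (partial_sum k)"
    unfolding vandermonde_def
    by (rule prod.reindex_bij_witness[where i = "\<lambda>(i, j). (Suc i, j)" and j = "\<lambda>(l, j). (l - 1, j)"])
      (auto simp: index_pairs_def ps)
  finally show ?thesis .
qed

lemma superfactorial_eq_vandermonde: "(\<Prod>i=1..r. fact i :: real) = vandermonde r id"
proof -
  have "vandermonde r id = vandermonde r (partial_sum (\<lambda>_. 1))"
    by (simp add: vandermonde_def partial_sum_def)
  also have "\<dots> = (\<Prod>l=1..r. \<Prod>j=l..r. real (Suc j - l))"
    by (simp flip: root_product_eq_vandermonde)
  also have "\<dots> = (\<Prod>l=1..r. fact (Suc r - l))"
  proof (rule prod.cong[OF refl])
    fix l assume l: "l \<in> {1..r}"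
    have "(\<Prod>j=l..r. real (Suc j - l)) = (\<Prod>m=1..Suc r - l. real m)"
      by (rule prod.reindex_bij_witness[where i = "\<lambda>m. m + l - 1" and j = "\<lambda>j. Suc j - l"])
        (use l in auto)
    then show "(\<Prod>j=l..r. real (Suc j - l)) = fact (Suc r - l)"
      by (simp add: fact_prod)
  qed
  also have "\<dots> = (\<Prod>i=1..r. fact i)"
    by (rule prod.reindex_bij_witness[where i = "\<lambda>i. Suc r - i" and j = "\<lambda>i. Suc r - i"]) auto
  finally show ?thesis by simp
qed

text \<open>
  Window counting sorts representations by their dimension, which must therefore be a natural number.
\<close>

lemma irrep_dim_Ints: "irrep_dim r k \<in> \<int>"
  unfolding irrep_dim_def dim_poly_def root_product_eq_vandermonde superfactorial_eq_vandermonde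
  by (rule vandermonde_quotient_Ints)

lemma irrep_dim_trivial: "irrep_dim r (\<lambda>j\<in>{1..r}. 1) = 1"
proof -
  have "irrep_dim r (\<lambda>j\<in>{1..r}. 1) = irrep_dim r (\<lambda>_. 1)"
    unfolding irrep_dim_def dim_poly_def by (auto intro!: prod.cong sum.cong)
  also have "\<dots> = vandermonde r (partial_sum (\<lambda>_. 1)) / vandermonde r id"
    unfolding irrep_dim_def dim_poly_def root_product_eq_vandermonde superfactorial_eq_vandermonde ..
  also have "vandermonde r (partial_sum (\<lambda>_. 1)) = vandermonde r id"
    by (simp add: vandermonde_def partial_sum_def)
  finally show ?thesis using vandermonde_id_pos[of r] by (simp only: divide_self_if) simp
qed

section \<open>The generating function of multisets\<close>

text \<open>
  A multiset over \<open>K\<close> is a choice of one multiplicity for each element of \<open>K\<close>, so the sum factors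
  into geometric series.
\<close>

lemma has_sum_prod_mset_geometric:
  fixes w :: "'k \<Rightarrow> real"
  assumes "finite K" and "\<And>k. k \<in> K \<Longrightarrow> 0 \<le> w k \<and> w k < 1"
  shows "((\<lambda>\<rho>. \<Prod>k\<in>#\<rho>. w k) has_sum (\<Prod>k\<in>K. 1 / (1 - w k))) {\<rho>. set_mset \<rho> \<subseteq> K}"
  using assms
proof (induction K rule: finite_induct)
  case empty
  have "{\<rho>. set_mset \<rho> \<subseteq> {}} = {{#} :: 'k multiset}" by auto
  then show ?case using has_sum_finite[of "{{#}}" "\<lambda>\<rho>. \<Prod>k\<in>#\<rho>. w k"] by simp
next
  case (insert k K)
  let ?M = "\<lambda>K. {\<rho> :: 'k multiset. set_mset \<rho> \<subseteq> K}"
  define Z where "Z = (\<Prod>k\<in>K. 1 / (1 - w k))"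
  have wk: "0 \<le> w k" "w k < 1" and w0: "\<And>j. j \<in> K \<Longrightarrow> 0 \<le> w j"
    using insert.prems by auto
  have IH: "((\<lambda>\<rho>. \<Prod>k\<in>#\<rho>. w k) has_sum Z) (?M K)"
    unfolding Z_def by (intro insert.IH) (use insert.prems in auto)
  have "(\<lambda>m. w k ^ m) sums (1 / (1 - w k))"
    using wk by (intro geometric_sums) auto
  then have geo: "((\<lambda>m. w k ^ m) has_sum (1 / (1 - w k))) UNIV"
    using wk by (intro sums_nonneg_imp_has_sum) auto
  let ?f = "\<lambda>(m, \<rho>). w k ^ m * (\<Prod>k\<in>#\<rho>. w k)"
  have inner: "((\<lambda>\<rho>. ?f (m, \<rho>)) has_sum (w k ^ m * Z)) (?M K)" for m
    using has_sum_cmult_right[OF IH] by simp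
  have outer: "((\<lambda>m. w k ^ m * Z) has_sum (1 / (1 - w k) * Z)) UNIV"
    by (rule has_sum_cmult_left[OF geo])
  have nonneg: "0 \<le> (\<Prod>k\<in>#\<rho>. w k)" if "set_mset \<rho> \<subseteq> K" for \<rho>
    unfolding image_prod_mset_multiplicity using that w0 by (intro prod_nonneg) auto
  define f where "f = ?f"
  have inner': "((\<lambda>\<rho>. f (m, \<rho>)) has_sum (w k ^ m * Z)) (?M K)" for m
    using inner by (simp add: f_def)
  have summable: "f summable_on (UNIV \<times> ?M K)"
  proof (rule summable_on_SigmaI)
    show "((\<lambda>\<rho>. f (m, \<rho>)) has_sum (w k ^ m * Z)) (?M K)" for m
      by (rule inner')
    show "(\<lambda>m. w k ^ m * Z) summable_on UNIV"
      using has_sum_imp_summable[OF outer] .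
    show "f (m, \<rho>) \<ge> 0" if "\<rho> \<in> ?M K" for m \<rho>
      using nonneg that wk by (simp add: f_def)
  qed
  have "(f has_sum (1 / (1 - w k) * Z)) (UNIV \<times> ?M K)"
    using inner' by (rule has_sum_SigmaI[OF _ outer summable])
  then have "(?f has_sum (1 / (1 - w k) * Z)) (UNIV \<times> ?M K)"
    by (simp only: f_def)
  also have "?this \<longleftrightarrow> ((\<lambda>\<rho>. \<Prod>k\<in>#\<rho>. w k) has_sum (1 / (1 - w k) * Z)) (?M (insert k K))"
  proof (rule has_sum_reindex_bij_witness[where
        j = "\<lambda>(m, \<rho>). \<rho> + replicate_mset m k" and
        i = "\<lambda>\<rho>. (count \<rho> k, filter_mset (\<lambda>j. j \<noteq> k) \<rho>)"], goal_cases)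
    case (1 a)
    obtain m \<rho> where a: "a = (m, \<rho>)" "set_mset \<rho> \<subseteq> K" using 1 by auto
    then have "k \<notin># \<rho>" using insert.hyps by auto
    then have c: "count \<rho> k = 0" by (simp add: not_in_iff)
    have "filter_mset (\<lambda>j. j \<noteq> k) (\<rho> + replicate_mset m k) = \<rho>"
      by (intro multiset_eqI) (simp add: c)
    then show ?case by (simp add: a c)
  next
    case (2 a)
    then show ?case by (auto split: if_splits)
  next
    case (3 \<rho>)
    show ?case by (rule multiset_eqI) simp
  next
    case (4 \<rho>)
    then show ?case by auto
  next
    case (5 a)
    then show ?case by (cases a) (simp add: mult.commute)
  qed simp
  finally show ?case
    using insert.hyps by (simp add: Z_def)
qed

section \<open>The Bose function\<close>

text \<open>
  The expectation of a geometric variable with ratio \<open>exp (- x)\<close>, known in physics as the Bose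
  occupation number.
\<close>

definition bose :: "real \<Rightarrow> real" where
  "bose x = 1 / (exp x - 1)"

lemma bose_pos: "x > 0 \<Longrightarrow> bose x > 0"
  by (simp add: bose_def)

lemma bose_antimono: "0 < x \<Longrightarrow> x \<le> y \<Longrightarrow> bose y \<le> bose x"
  by (auto simp: bose_def intro!: divide_left_mono mult_pos_pos)

lemma bose_altdef: "bose x = exp (- x) / (1 - exp (- x))"
proof (cases "x = 0")
  case False
  then have "exp x \<noteq> 1" "exp (- x) \<noteq> 1" by auto
  then show ?thesis by (simp add: bose_def field_simps flip: exp_add)
qed (simp add: bose_def)

text \<open>
  The small loss \<open>exp (- x / 4)\<close> makes the bound uniform in \<open>x\<close> and still leaves exponential decay in
  the estimates for \<open>bose\<close>, which is how sums over parts are later compared with the zeta function.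
\<close>

lemma one_minus_exp_ge:
  fixes x :: real
  assumes "x > 0"
  shows "x * exp (- x / 4) / 4 \<le> 1 - exp (- x)"
proof -
  have "1 + x \<le> 4 * exp (x / 4)"
    using exp_ge_add_one_self[of "x / 4"] assms by linarith
  then have "x * exp (- x / 4) / 4 \<le> x / (1 + x)"
    using mult_left_mono[of "1 + x" "4 * exp (x / 4)" x] assms
    by (simp add: field_simps exp_minus)
  also have "\<dots> = 1 - 1 / (1 + x)"
    using assms by (simp add: field_simps)
  also have "\<dots> \<le> 1 - exp (- x)"
    using exp_ge_add_one_self[of x] assms by (auto simp: exp_minus inverse_eq_divide intro!: frac_le)
  finally show ?thesis .
qed

lemma bose_le:
  assumes "x > 0"
  shows "bose x \<le> 4 * exp (- x / 4) / x"
proof -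
  have "bose x \<le> exp (- x) / (x * exp (- x / 4) / 4)"
    unfolding bose_altdef using one_minus_exp_ge[OF assms] assms
    by (intro divide_left_mono mult_pos_pos) auto
  also have "\<dots> = 4 * exp (- 3 * x / 4) / x"
    using assms by (simp add: field_simps flip: exp_add)
  also have "\<dots> \<le> 4 * exp (- x / 4) / x"
    using assms by (intro divide_right_mono) auto
  finally show ?thesis .
qed

lemma bose_deriv_le:
  fixes x y :: real
  assumes "0 < y" "y \<le> x"
  shows "exp x / (exp x - 1)\<^sup>2 \<le> 16 * exp (- y / 2) / y\<^sup>2"
proof -
  have x: "x > 0" using assms by linarith
  have "exp x / (exp x - 1)\<^sup>2 = exp (- x) / (1 - exp (- x))\<^sup>2"
    using x by (simp add: field_simps power2_eq_square exp_minus)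
  also have "\<dots> \<le> exp (- x) / (x * exp (- x / 4) / 4)\<^sup>2"
    using one_minus_exp_ge[OF x] x
    by (intro divide_left_mono power_mono mult_pos_pos) (auto simp: zero_less_power)
  also have "\<dots> = 16 * exp (- x / 2) / x\<^sup>2"
    using x by (simp add: field_simps power2_eq_square flip: exp_add)
  also have "\<dots> \<le> 16 * exp (- y / 2) / y\<^sup>2"
    using assms by (intro frac_le power_mono) auto
  finally show ?thesis .
qed

lemma has_real_derivative_bose:
  assumes "x > 0"
  shows "(bose has_real_derivative - exp x / (exp x - 1)\<^sup>2) (at x)"
  unfolding bose_def using assms
  by (auto intro!: derivative_eq_intros simp: power2_eq_square)

lemma bose_diff_le:
  assumes "0 < x" "x \<le> y"
  shows "bose x - bose y \<le> (y - x) * (16 * exp (- x / 2) / x\<^sup>2)"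
proof (cases "x < y")
  case True
  obtain z where z: "x < z" "z < y" "bose y - bose x = (y - x) * (- exp z / (exp z - 1)\<^sup>2)"
    using MVT2[OF True, of bose "\<lambda>z. - exp z / (exp z - 1)\<^sup>2"] has_real_derivative_bose assms by auto
  have "bose x - bose y = (y - x) * (exp z / (exp z - 1)\<^sup>2)"
    using z(3) by (simp add: algebra_simps)
  also have "\<dots> \<le> (y - x) * (16 * exp (- x / 2) / x\<^sup>2)"
    using z assms bose_deriv_le[of x z] by (intro mult_left_mono) auto
  finally show ?thesis .
qed (use assms in auto)

text \<open>
  Second-order expansion of \<open>- ln (1 - exp (- x))\<close>, the logarithm of one factor of the partition
  function; its first derivative is \<open>- bose\<close> and its second derivative is positive.
\<close>

lemma free_energy_Taylor:
  fixes x u :: real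
  assumes "0 < x" "u < x"
  obtains z where "min x (x - u) \<le> z"
    "- ln (1 - exp (- (x - u))) = - ln (1 - exp (- x)) + u * bose x + u\<^sup>2 / 2 * (exp z / (exp z - 1)\<^sup>2)"
proof (cases "u = 0")
  case True
  then show ?thesis by (intro that[of x]) auto
next
  case False
  define diff :: "nat \<Rightarrow> real \<Rightarrow> real" where
    "diff m = (if m = 0 then (\<lambda>x. - ln (1 - exp (- x))) else
       if m = 1 then (\<lambda>x. - bose x) else (\<lambda>x. exp x / (exp x - 1)\<^sup>2))" for m
  have d0: "((\<lambda>x. - ln (1 - exp (- x))) has_real_derivative - bose t) (at t)" if "t > 0" for t
    using that by (auto intro!: derivative_eq_intros simp: bose_altdef)
  have d1: "((\<lambda>x. - bose x) has_real_derivative exp t / (exp t - 1)\<^sup>2) (at t)" if "t > 0" for t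
    using DERIV_minus[OF has_real_derivative_bose[OF that]] by simp
  let ?lo = "min x (x - u)" and ?hi = "max x (x - u)"
  have "\<exists>t. (if x - u < x then x - u < t \<and> t < x else x < t \<and> t < x - u) \<and>
      - ln (1 - exp (- (x - u))) = (\<Sum>m<2. diff m x / fact m * (x - u - x) ^ m)
        + diff 2 t / fact 2 * (x - u - x) ^ 2"
  proof (rule Taylor[where a = ?lo and b = ?hi])
    show "\<forall>m t. m < 2 \<and> ?lo \<le> t \<and> t \<le> ?hi \<longrightarrow> (diff m has_real_derivative diff (Suc m) t) (at t)"
    proof (intro allI impI)
      fix m t assume mt: "m < (2::nat) \<and> ?lo \<le> t \<and> t \<le> ?hi"
      then have "t > 0" using assms by linarith
      moreover have "m = 0 \<or> m = 1" using mt by auto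
      ultimately show "(diff m has_real_derivative diff (Suc m) t) (at t)"
        using d0 d1 by (auto simp: diff_def)
    qed
  qed (use False in \<open>auto simp: diff_def\<close>)
  then obtain t where t: "if x - u < x then x - u < t \<and> t < x else x < t \<and> t < x - u"
    "- ln (1 - exp (- (x - u))) = (\<Sum>m<2. diff m x / fact m * (x - u - x) ^ m)
        + diff 2 t / fact 2 * (x - u - x) ^ 2"
    by blast
  have sum2: "(\<Sum>m<2. diff m x / fact m * (x - u - x) ^ m) = - ln (1 - exp (- x)) + u * bose x"
    by (simp add: numeral_2_eq_2 diff_def)
  have "diff 2 t / fact 2 * (x - u - x) ^ 2 = u\<^sup>2 / 2 * (exp t / (exp t - 1)\<^sup>2)"
    by (simp add: diff_def mult.commute)
  with t(2) sum2 have "- ln (1 - exp (- (x - u))) =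
      - ln (1 - exp (- x)) + u * bose x + u\<^sup>2 / 2 * (exp t / (exp t - 1)\<^sup>2)"
    by (simp only:)
  moreover have "?lo \<le> t" using t(1) by (auto split: if_splits)
  ultimately show ?thesis by (intro that)
qed

lemma inverse_one_minus_exp:
  fixes x :: real
  assumes "x > 0"
  shows "1 / (1 - exp (- x)) = exp (- ln (1 - exp (- x)))"
  using assms by (simp add: exp_minus inverse_eq_divide)

text \<open>
  Convexity of \<open>- ln (1 - exp (- x))\<close>.
\<close>

lemma geometric_factor_tilt_ge:
  fixes x u :: real
  assumes "0 < x" "u < x"
  shows "1 / (1 - exp (- x)) * exp (u * bose x) \<le> 1 / (1 - exp (- (x - u)))"
proof -
  obtain z where z: "- ln (1 - exp (- (x - u))) =
      - ln (1 - exp (- x)) + u * bose x + u\<^sup>2 / 2 * (exp z / (exp z - 1)\<^sup>2)"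
    using free_energy_Taylor[OF assms] by metis
  have "0 \<le> u\<^sup>2 / 2 * (exp z / (exp z - 1)\<^sup>2)" by simp
  with z have "- ln (1 - exp (- x)) + u * bose x \<le> - ln (1 - exp (- (x - u)))"
    by linarith
  then have "exp (- ln (1 - exp (- x))) * exp (u * bose x) \<le> exp (- ln (1 - exp (- (x - u))))"
    by (simp flip: exp_add)
  then show ?thesis
    using inverse_one_minus_exp[of x] inverse_one_minus_exp[of "x - u"] assms by simp
qed

text \<open>
  The moment generating function of one centred geometric variable is sub-Gaussian, uniformly for
  tilts up to half the exponent.
\<close>

lemma geometric_factor_tilt_le:
  fixes x u :: real
  assumes "0 < x" "\<bar>u\<bar> \<le> x / 2"
  shows "1 / (1 - exp (- (x - u))) \<le>
    1 / (1 - exp (- x)) * exp (u * bose x + 32 * (u / x)\<^sup>2 * exp (- x / 4))"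
proof -
  have u: "u < x" using assms by linarith
  obtain z where z: "min x (x - u) \<le> z" "- ln (1 - exp (- (x - u))) =
      - ln (1 - exp (- x)) + u * bose x + u\<^sup>2 / 2 * (exp z / (exp z - 1)\<^sup>2)"
    using free_energy_Taylor[OF assms(1) u] by metis
  have "x / 2 \<le> z" using z(1) assms by linarith
  then have "u\<^sup>2 / 2 * (exp z / (exp z - 1)\<^sup>2) \<le> u\<^sup>2 / 2 * (16 * exp (- (x / 2) / 2) / (x / 2)\<^sup>2)"
    using assms by (intro mult_left_mono bose_deriv_le) auto
  also have "\<dots> = 32 * (u / x)\<^sup>2 * exp (- x / 4)"
    by (simp add: power_divide)
  finally have "- ln (1 - exp (- (x - u))) \<le>
      - ln (1 - exp (- x)) + (u * bose x + 32 * (u / x)\<^sup>2 * exp (- x / 4))"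
    using z(2) by linarith
  then have "exp (- ln (1 - exp (- (x - u)))) \<le>
      exp (- ln (1 - exp (- x))) * exp (u * bose x + 32 * (u / x)\<^sup>2 * exp (- x / 4))"
    by (simp flip: exp_add)
  then show ?thesis
    using inverse_one_minus_exp[of x] inverse_one_minus_exp[of "x - u"] assms u by simp
qed

section \<open>Partition functions and tilting\<close>

lemma prod_mset_exp: "(\<Prod>k\<in>#\<rho>. exp (f k)) = exp (\<Sum>k\<in>#\<rho>. f k :: real)"
  by (induction \<rho>) (auto simp: exp_add)

lemma has_sum_exp_multiset:
  fixes x :: "'k \<Rightarrow> real"
  assumes "finite K" and "\<And>k. k \<in> K \<Longrightarrow> x k > 0"
  shows "((\<lambda>\<rho>. exp (- (\<Sum>k\<in>#\<rho>. x k))) has_sum (\<Prod>k\<in>K. 1 / (1 - exp (- x k)))) {\<rho>. set_mset \<rho> \<subseteq> K}"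
proof -
  have "(\<Sum>k\<in>#\<rho>. - x k) = - (\<Sum>k\<in>#\<rho>. x k)" for \<rho>
    by (induction \<rho>) auto
  then show ?thesis
    using has_sum_prod_mset_geometric[of K "\<lambda>k. exp (- x k)"] assms
    by (simp add: prod_mset_exp)
qed

lemma partition_function_tilt_le:
  fixes x u :: "'k \<Rightarrow> real"
  assumes "finite K" and "\<And>k. k \<in> K \<Longrightarrow> x k > 0 \<and> \<bar>u k\<bar> \<le> x k / 2"
  shows "(\<Prod>k\<in>K. 1 / (1 - exp (- (x k - u k)))) \<le> (\<Prod>k\<in>K. 1 / (1 - exp (- x k))) *
    exp ((\<Sum>k\<in>K. u k * bose (x k)) + (\<Sum>k\<in>K. 32 * (u k / x k)\<^sup>2 * exp (- x k / 4)))"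
proof -
  have "(\<Prod>k\<in>K. 1 / (1 - exp (- (x k - u k)))) \<le> (\<Prod>k\<in>K. 1 / (1 - exp (- x k)) *
      exp (u k * bose (x k) + 32 * (u k / x k)\<^sup>2 * exp (- x k / 4)))"
  proof (intro prod_mono conjI)
    fix k assume k: "k \<in> K"
    with assms(2) have "x k - u k > 0" by fastforce
    then show "0 \<le> 1 / (1 - exp (- (x k - u k)))" by simp
    show "1 / (1 - exp (- (x k - u k))) \<le> 1 / (1 - exp (- x k)) *
      exp (u k * bose (x k) + 32 * (u k / x k)\<^sup>2 * exp (- x k / 4))"
      using assms(2) k by (intro geometric_factor_tilt_le) auto
  qed
  also have "\<dots> = (\<Prod>k\<in>K. 1 / (1 - exp (- x k))) *
    exp ((\<Sum>k\<in>K. u k * bose (x k)) + (\<Sum>k\<in>K. 32 * (u k / x k)\<^sup>2 * exp (- x k / 4)))"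
    using assms(1) by (simp only: prod.distrib exp_sum flip: sum.distrib)
  finally show ?thesis .
qed

lemma partition_function_tilt_ge:
  fixes x u :: "'k \<Rightarrow> real"
  assumes "finite K" and "\<And>k. k \<in> K \<Longrightarrow> x k > 0 \<and> u k < x k"
  shows "(\<Prod>k\<in>K. 1 / (1 - exp (- x k))) * exp (\<Sum>k\<in>K. u k * bose (x k)) \<le>
    (\<Prod>k\<in>K. 1 / (1 - exp (- (x k - u k))))"
proof -
  have "(\<Prod>k\<in>K. 1 / (1 - exp (- x k))) * exp (\<Sum>k\<in>K. u k * bose (x k)) =
      (\<Prod>k\<in>K. 1 / (1 - exp (- x k)) * exp (u k * bose (x k)))"
    using assms(1) by (simp only: prod.distrib exp_sum)
  also have "\<dots> \<le> (\<Prod>k\<in>K. 1 / (1 - exp (- (x k - u k))))"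
    using assms(2)
    by (intro prod_mono conjI geometric_factor_tilt_ge mult_nonneg_nonneg) (auto intro: less_imp_le)
  finally show ?thesis .
qed

lemma sum_mset_filter_eq_size:
  "(\<Sum>k\<in>#\<rho>. if k \<in> S then u else (0 :: real)) = u * real (size (filter_mset (\<lambda>k. k \<in> S) \<rho>))"
  by (induction \<rho>) (auto simp: algebra_simps)

lemma le_mult_exp_cancel:
  fixes X Y R A B C :: real
  assumes "X * exp Y \<le> R * exp A * exp B" and "A + B - Y = C"
  shows "X \<le> R * exp C"
proof -
  have "X \<le> R * exp A * exp B / exp Y" using assms(1) by (simp add: pos_le_divide_eq)
  also have "\<dots> = R * exp C" unfolding assms(2)[symmetric] by (simp add: exp_add exp_diff)
  finally show ?thesis .
qed

text \<open>
  For exponents at most one this holds without a constant because \<open>z powr \<gamma> \<le> 1 + z\<close> then.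
\<close>

lemma exp_minus_le_powr:
  fixes z \<gamma> :: real
  assumes "z > 0" "0 < \<gamma>" "\<gamma> \<le> 1"
  shows "exp (- z) \<le> z powr - \<gamma>"
proof -
  have "z powr \<gamma> \<le> exp z"
  proof (cases "z \<le> 1")
    case True
    then have "z powr \<gamma> \<le> 1" using assms by (simp add: powr_le1)
    also have "1 \<le> exp z" using assms by simp
    finally show ?thesis .
  next
    case False
    then have "z powr \<gamma> \<le> z powr 1" using assms by (intro powr_mono) auto
    also have "\<dots> \<le> exp z" using exp_ge_add_one_self[of z] assms by (simp del: exp_ge_add_one_self)
    finally show ?thesis .
  qed
  then show ?thesis
    using assms by (simp add: exp_minus powr_minus le_imp_inverse_le)
qed

section \<open>The Boltzmann law on weighted partitions\<close>

text \<open>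
  Partitions into parts from a set \<open>L\<close> where the part \<open>k\<close> has size \<open>a k\<close>. There is a part \<open>e\<close> of
  size one, the zeta function of the sizes converges at \<open>\<gamma>\<close>, and at least \<open>c X powr \<alpha>\<close> parts have size
  at most \<open>X\<close>. With \<open>\<theta>\<close> as inverse temperature, \<open>\<theta> powr - \<alpha>\<close> is the scale on which exponents are
  measured; \<open>\<gamma> < 2 \<alpha>\<close> says that the fluctuations of the total size are negligible on it.
\<close>

locale weighted_parts =
  fixes L :: "'k set" and a :: "'k \<Rightarrow> real" and e :: 'k and \<alpha> \<gamma> c :: real
  assumes a_Ints: "k \<in> L \<Longrightarrow> a k \<in> \<int>"
    and a_ge_1: "k \<in> L \<Longrightarrow> a k \<ge> 1"
    and e_in [simp]: "e \<in> L" and a_e [simp]: "a e = 1"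
    and gamma: "0 < \<gamma>" "\<gamma> \<le> 1" "\<gamma> < 2 * \<alpha>"
    and zeta_summable: "(\<lambda>k. a k powr - \<gamma>) summable_on L"
    and c_pos: "c > 0"
    and count_ge: "X \<ge> 1 \<Longrightarrow> c * X powr \<alpha> \<le> real (card {k \<in> L. a k \<le> X})"
begin

definition weight :: "'k multiset \<Rightarrow> real" where
  "weight \<rho> = (\<Sum>k\<in>#\<rho>. a k)"

definition parts :: "nat \<Rightarrow> 'k multiset set" where
  "parts n = {\<rho>. set_mset \<rho> \<subseteq> L \<and> weight \<rho> = real n}"

text \<open>
  The expected total size under the Boltzmann law with parameter \<open>\<theta>\<close>.
\<close>

definition mean :: "real \<Rightarrow> real" where
  "mean \<theta> = (\<Sum>\<^sub>\<infinity>k\<in>L. a k * bose (\<theta> * a k))"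

definition partition_function :: "'k set \<Rightarrow> real \<Rightarrow> real" where
  "partition_function K \<theta> = (\<Prod>k\<in>K. 1 / (1 - exp (- (\<theta> * a k))))"

definition zeta_const :: real where
  "zeta_const = 4 powr \<gamma> * (\<Sum>\<^sub>\<infinity>k\<in>L. a k powr - \<gamma>)"

lemma alpha_pos: "\<alpha> > 0"
  using gamma by linarith

lemma a_pos: "k \<in> L \<Longrightarrow> a k > 0"
  using a_ge_1 by force

text \<open>
  This is the only way in which the zeta function enters the estimates.
\<close>

lemma exp_le_zeta_term:
  assumes "\<theta> > 0" "k \<in> L"
  shows "exp (- (\<theta> * a k) / 4) \<le> (4 powr \<gamma> * \<theta> powr - \<gamma>) * a k powr - \<gamma>"
proof -
  have "exp (- (\<theta> * a k / 4)) \<le> (\<theta> * a k / 4) powr - \<gamma>"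
    using assms a_pos[of k] gamma by (intro exp_minus_le_powr) auto
  also have "\<dots> = (4 powr \<gamma> * \<theta> powr - \<gamma>) * a k powr - \<gamma>"
    using assms a_pos[of k] by (simp add: powr_divide powr_mult powr_minus field_simps)
  finally show ?thesis by simp
qed

lemma exp_summable:
  assumes "\<theta> > 0"
  shows "(\<lambda>k. exp (- (\<theta> * a k) / 4)) summable_on L"
  by (rule summable_on_comparison_test[OF
        summable_on_cmult_right[OF zeta_summable, of "4 powr \<gamma> * \<theta> powr - \<gamma>"]])
     (use assms exp_le_zeta_term in auto)

lemma exp_infsum_le:
  assumes "\<theta> > 0"
  shows "(\<Sum>\<^sub>\<infinity>k\<in>L. exp (- (\<theta> * a k) / 4)) \<le> zeta_const * \<theta> powr - \<gamma>"
proof -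
  have "(\<Sum>\<^sub>\<infinity>k\<in>L. exp (- (\<theta> * a k) / 4)) \<le> (\<Sum>\<^sub>\<infinity>k\<in>L. (4 powr \<gamma> * \<theta> powr - \<gamma>) * a k powr - \<gamma>)"
    using assms exp_le_zeta_term
    by (intro infsum_mono exp_summable summable_on_cmult_right zeta_summable)
  also have "\<dots> = zeta_const * \<theta> powr - \<gamma>"
    unfolding zeta_const_def infsum_cmult_right' by (simp add: mult_ac)
  finally show ?thesis .
qed

lemma exp_sum_le:
  assumes "\<theta> > 0" "finite K" "K \<subseteq> L"
  shows "(\<Sum>k\<in>K. exp (- (\<theta> * a k) / 4)) \<le> zeta_const * \<theta> powr - \<gamma>"
  using finite_sum_le_infsum[OF exp_summable[OF assms(1)] assms(2,3)] exp_infsum_le[OF assms(1)]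
  by simp

lemma zeta_const_pos: "zeta_const > 0"
proof -
  have "1 = (\<Sum>k\<in>{e}. a k powr - \<gamma>)" by simp
  also have "\<dots> \<le> (\<Sum>\<^sub>\<infinity>k\<in>L. a k powr - \<gamma>)"
    by (intro finite_sum_le_infsum zeta_summable) auto
  finally show ?thesis by (simp add: zeta_const_def)
qed

lemma mean_term_le:
  assumes "\<theta> > 0" "k \<in> L"
  shows "a k * bose (\<theta> * a k) \<le> 4 / \<theta> * exp (- (\<theta> * a k) / 4)"
  using mult_left_mono[OF bose_le[of "\<theta> * a k"], of "a k"] assms a_pos[of k] by simp

lemma mean_term_nonneg:
  assumes "\<theta> > 0" "k \<in> L"
  shows "0 \<le> a k * bose (\<theta> * a k)"
  using assms a_pos[of k] bose_pos[of "\<theta> * a k"] by simp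

lemma mean_summable:
  assumes "\<theta> > 0"
  shows "(\<lambda>k. a k * bose (\<theta> * a k)) summable_on L"
  by (rule summable_on_comparison_test[OF
        summable_on_cmult_right[OF exp_summable[OF assms], of "4 / \<theta>"]])
     (use assms mean_term_le mean_term_nonneg in auto)

lemma mean_le:
  assumes "\<theta> > 0"
  shows "mean \<theta> \<le> 4 * zeta_const * \<theta> powr - (\<gamma> + 1)"
proof -
  have "mean \<theta> \<le> (\<Sum>\<^sub>\<infinity>k\<in>L. 4 / \<theta> * exp (- (\<theta> * a k) / 4))"
    unfolding mean_def using assms mean_term_le
    by (intro infsum_mono mean_summable summable_on_cmult_right exp_summable)
  also have "\<dots> = 4 / \<theta> * (\<Sum>\<^sub>\<infinity>k\<in>L. exp (- (\<theta> * a k) / 4))"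
    by (rule infsum_cmult_right')
  also have "\<dots> \<le> 4 / \<theta> * (zeta_const * \<theta> powr - \<gamma>)"
    using assms by (intro mult_left_mono exp_infsum_le) auto
  also have "\<dots> = 4 * zeta_const * \<theta> powr - (\<gamma> + 1)"
    using assms by (simp add: powr_diff powr_minus field_simps powr_add)
  finally show ?thesis .
qed

lemma mean_diff_has_sum:
  assumes "0 < \<theta>" "0 < \<theta>'"
  shows "((\<lambda>k. a k * bose (\<theta> * a k) - a k * bose (\<theta>' * a k)) has_sum (mean \<theta> - mean \<theta>')) L"
  using has_sum_add[OF has_sum_infsum[OF mean_summable[OF assms(1)]]
      has_sum_uminusI[OF has_sum_infsum[OF mean_summable[OF assms(2)]]]]
  by (simp add: mean_def)

lemma mean_diff_ge:
  assumes "0 < \<theta>" "\<theta> \<le> \<theta>'" "finite K" "K \<subseteq> L"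
  shows "(\<Sum>k\<in>K. a k * (bose (\<theta> * a k) - bose (\<theta>' * a k))) \<le> mean \<theta> - mean \<theta>'"
proof -
  let ?d = "\<lambda>k. a k * bose (\<theta> * a k) - a k * bose (\<theta>' * a k)"
  have "(\<Sum>k\<in>K. ?d k) \<le> mean \<theta> - mean \<theta>'"
  proof (rule finite_sum_le_has_sum[OF mean_diff_has_sum assms(3,4)])
    fix k assume "k \<in> L - K"
    then show "0 \<le> ?d k"
      using assms a_pos[of k] by (auto intro!: mult_left_mono bose_antimono)
  qed (use assms in auto)
  then show ?thesis by (simp add: right_diff_distrib)
qed

lemma mean_strict_antimono:
  assumes "0 < \<theta>" "\<theta> < \<theta>'"
  shows "mean \<theta>' < mean \<theta>"
proof -
  have "bose \<theta>' < bose \<theta>"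
    using assms by (auto simp: bose_def intro!: divide_strict_left_mono mult_pos_pos)
  with mean_diff_ge[of \<theta> \<theta>' "{e}"] assms show ?thesis by simp
qed

text \<open>
  The derivative of the mean is minus the variance, and the variance of one part of size \<open>a k\<close> is at
  most \<open>16 exp (- \<theta> a k / 2) / \<theta>\<^sup>2\<close>.
\<close>

lemma mean_diff_le:
  assumes "0 < \<theta>" "\<theta> \<le> \<theta>'"
  shows "mean \<theta> - mean \<theta>' \<le> (\<theta>' - \<theta>) * (16 / \<theta>\<^sup>2 * (zeta_const * \<theta> powr - \<gamma>))"
proof -
  have bound: "a k * bose (\<theta> * a k) - a k * bose (\<theta>' * a k) \<le>
      (\<theta>' - \<theta>) * (16 / \<theta>\<^sup>2) * exp (- (\<theta> * a k) / 4)" if "k \<in> L" for k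
  proof -
    have ak: "a k > 0" using that a_pos by simp
    have "bose (\<theta> * a k) - bose (\<theta>' * a k) \<le>
        (\<theta>' * a k - \<theta> * a k) * (16 * exp (- (\<theta> * a k) / 2) / (\<theta> * a k)\<^sup>2)"
      using assms ak by (intro bose_diff_le) auto
    also have "\<dots> \<le> (\<theta>' * a k - \<theta> * a k) * (16 * exp (- (\<theta> * a k) / 4) / (\<theta> * a k)\<^sup>2)"
      using assms ak by (intro mult_left_mono divide_right_mono) auto
    finally have "a k * (bose (\<theta> * a k) - bose (\<theta>' * a k)) \<le>
        a k * ((\<theta>' * a k - \<theta> * a k) * (16 * exp (- (\<theta> * a k) / 4) / (\<theta> * a k)\<^sup>2))"
      using ak by (intro mult_left_mono) auto
    also have "\<dots> = (\<theta>' - \<theta>) * (16 / \<theta>\<^sup>2) * exp (- (\<theta> * a k) / 4)"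
      using assms ak by (simp add: field_simps power2_eq_square)
    finally show ?thesis by (simp add: right_diff_distrib)
  qed
  have "mean \<theta> - mean \<theta>' \<le> (\<Sum>\<^sub>\<infinity>k\<in>L. (\<theta>' - \<theta>) * (16 / \<theta>\<^sup>2) * exp (- (\<theta> * a k) / 4))"
    using assms bound
    by (intro has_sum_mono[OF mean_diff_has_sum has_sum_infsum]
        summable_on_cmult_right exp_summable) auto
  also have "\<dots> = (\<theta>' - \<theta>) * (16 / \<theta>\<^sup>2) * (\<Sum>\<^sub>\<infinity>k\<in>L. exp (- (\<theta> * a k) / 4))"
    by (rule infsum_cmult_right')
  also have "\<dots> \<le> (\<theta>' - \<theta>) * (16 / \<theta>\<^sup>2) * (zeta_const * \<theta> powr - \<gamma>)"
    using assms by (intro mult_left_mono exp_infsum_le) auto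
  finally show ?thesis by (simp only: mult.assoc)
qed

lemma mean_antimono: "0 < \<theta> \<Longrightarrow> \<theta> \<le> \<theta>' \<Longrightarrow> mean \<theta>' \<le> mean \<theta>"
  using mean_strict_antimono[of \<theta> \<theta>'] by (cases "\<theta> = \<theta>'") auto

lemma mean_continuous:
  assumes "0 < \<theta>1"
  shows "continuous_on {\<theta>1..} mean"
proof -
  define C where "C = 16 / \<theta>1\<^sup>2 * (zeta_const * \<theta>1 powr - \<gamma>)"
  have C0: "0 \<le> C" using zeta_const_pos by (simp add: C_def)
  have bound: "mean x - mean y \<le> C * (y - x)" if "\<theta>1 \<le> x" "x \<le> y" for x y
  proof -
    have "mean x - mean y \<le> (y - x) * (16 / x\<^sup>2 * (zeta_const * x powr - \<gamma>))"
      using that assms by (intro mean_diff_le) auto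
    also have "\<dots> \<le> (y - x) * C"
      unfolding C_def using that assms zeta_const_pos gamma
      by (intro mult_left_mono mult_mono frac_le power_mono powr_mono2') auto
    finally show ?thesis by (simp add: mult.commute)
  qed
  have "C-lipschitz_on {\<theta>1..} mean"
  proof (rule lipschitz_onI[OF _ C0])
    fix x y assume xy: "x \<in> {\<theta>1..}" "y \<in> {\<theta>1..}"
    show "dist (mean x) (mean y) \<le> C * dist x y"
      using bound[of x y] bound[of y x] mean_antimono[of x y] mean_antimono[of y x] xy assms
      by (cases "x \<le> y") (auto simp: dist_real_def abs_real_def)
  qed
  then show ?thesis by (rule lipschitz_on_continuous_on)
qed

lemma mean_exists_unique:
  assumes "y > 0"
  shows "\<exists>!\<theta>. \<theta> > 0 \<and> mean \<theta> = y"
proof -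
  (* At \<theta>1 the part e alone already contributes y to the mean. At \<theta>2 below, the bound mean_le
     equals y, or is smaller. *)
  define \<theta>1 where "\<theta>1 = min 1 (ln (1 + 1 / y))"
  have "ln (1 + 1 / y) > 0" using assms by (intro ln_gt_zero) simp
  then have th1: "0 < \<theta>1" "\<theta>1 \<le> 1" by (auto simp: \<theta>1_def)
  have "exp \<theta>1 \<le> exp (ln (1 + 1 / y))" by (simp add: \<theta>1_def)
  also have "\<dots> = 1 + 1 / y" using assms by (subst exp_ln) (auto simp: add_pos_pos)
  finally have "y \<le> bose \<theta>1"
    using assms th1 by (simp add: bose_def field_simps)
  also have "bose \<theta>1 = (\<Sum>k\<in>{e}. a k * bose (\<theta>1 * a k))" by simp
  also have "\<dots> \<le> mean \<theta>1"
    unfolding mean_def using th1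
    by (intro finite_sum_le_infsum mean_summable) (auto intro!: mean_term_nonneg)
  finally have lo: "y \<le> mean \<theta>1" .
  define \<theta>2 where "\<theta>2 = max 1 ((4 * zeta_const / y) powr (1 / (\<gamma> + 1)))"
  have th2: "1 \<le> \<theta>2" by (simp add: \<theta>2_def)
  have "4 * zeta_const / y = ((4 * zeta_const / y) powr (1 / (\<gamma> + 1))) powr (\<gamma> + 1)"
    using gamma assms zeta_const_pos by (simp add: powr_powr)
  also have "\<dots> \<le> \<theta>2 powr (\<gamma> + 1)"
    using gamma by (intro powr_mono2) (auto simp: \<theta>2_def)
  finally have "4 * zeta_const * \<theta>2 powr - (\<gamma> + 1) \<le> y"
    unfolding powr_minus_divide using assms th2 by (simp add: field_simps)
  with mean_le[of \<theta>2] th2 have hi: "mean \<theta>2 \<le> y" by simp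
  have "continuous_on {\<theta>1..\<theta>2} mean"
    using mean_continuous[OF th1(1)] by (rule continuous_on_subset) auto
  then obtain \<theta> where "\<theta>1 \<le> \<theta>" "mean \<theta> = y"
    using IVT2'[of mean \<theta>2 y \<theta>1] lo hi th1 th2 by auto
  then have "\<theta> > 0 \<and> mean \<theta> = y" using th1 by auto
  moreover have "\<theta>' = \<theta>''" if "\<theta>' > 0 \<and> mean \<theta>' = y" "\<theta>'' > 0 \<and> mean \<theta>'' = y" for \<theta>' \<theta>''
    using mean_strict_antimono[of \<theta>' \<theta>''] mean_strict_antimono[of \<theta>'' \<theta>'] that
    by (cases \<theta>' \<theta>'' rule: linorder_cases) auto
  ultimately show ?thesis by blast
qed


section \<open>Lower bounds for the number of partitions\<close>

lemma finite_bounded: "finite {k \<in> L. a k \<le> X}"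
proof -
  have "0 < c * max 1 X powr \<alpha>" using c_pos by simp
  also have "\<dots> \<le> real (card {k \<in> L. a k \<le> max 1 X})" by (rule count_ge) simp
  finally have "finite {k \<in> L. a k \<le> max 1 X}" by (intro card_ge_0_finite) simp
  then show ?thesis by (rule rev_finite_subset) auto
qed

lemma weight_add_mset [simp]: "weight (add_mset k \<rho>) = a k + weight \<rho>"
  by (simp add: weight_def)

lemma weight_nat:
  assumes "set_mset \<rho> \<subseteq> L"
  obtains m where "weight \<rho> = real m"
proof -
  have "weight \<rho> \<in> \<int> \<and> weight \<rho> \<ge> 0"
    using assms
  proof (induction \<rho>)
    case (add k \<rho>)
    then show ?case using a_Ints a_pos[of k] by auto
  qed (simp add: weight_def)
  then show thesis using that by (metis Ints_cases nonneg_int_cases of_int_0_le_iff of_int_of_nat_eq)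
qed

lemma member_le_weight:
  assumes "set_mset \<rho> \<subseteq> L" "k \<in># \<rho>"
  shows "a k \<le> weight \<rho>"
proof -
  obtain \<rho>' where \<rho>': "\<rho> = add_mset k \<rho>'" using assms(2) by (metis multi_member_split)
  then obtain m where "weight \<rho>' = real m" using weight_nat[of \<rho>'] assms(1) by auto
  then show ?thesis by (simp add: \<rho>')
qed

lemma size_le_weight:
  assumes "set_mset \<rho> \<subseteq> L"
  shows "real (size \<rho>) \<le> weight \<rho>"
  using assms
proof (induction \<rho>)
  case (add k \<rho>)
  then show ?case using a_ge_1[of k] by simp
qed (simp add: weight_def)

lemma finite_parts: "finite (parts n)"
proof (rule finite_subset)
  let ?A = "{k \<in> L. a k \<le> real n}"
  show "parts n \<subseteq> mset ` {xs. set xs \<subseteq> ?A \<and> length xs \<le> n}"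
  proof
    fix \<rho> assume \<rho>: "\<rho> \<in> parts n"
    obtain xs where xs: "mset xs = \<rho>" using ex_mset by blast
    have "set xs \<subseteq> ?A" using \<rho> member_le_weight[of \<rho>] unfolding xs[symmetric] parts_def by auto
    moreover have "length xs \<le> n"
      using \<rho> size_le_weight[of \<rho>] unfolding xs[symmetric] parts_def by auto
    ultimately show "\<rho> \<in> mset ` {xs. set xs \<subseteq> ?A \<and> length xs \<le> n}" using xs by blast
  qed
qed (intro finite_imageI finite_lists_length_le finite_bounded)

text \<open>
  Adding the part of size one is injective.
\<close>

lemma card_parts_mono:
  assumes "m \<le> n"
  shows "card (parts m) \<le> card (parts n)"
proof (rule lift_Suc_mono_le[OF _ assms])
  fix n
  show "card (parts n) \<le> card (parts (Suc n))"
    by (rule card_inj_on_le[where f = "add_mset e", OF _ _ finite_parts])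
      (auto simp: parts_def inj_on_def)
qed

lemma partition_function_has_sum:
  assumes "finite K" "K \<subseteq> L" "\<theta> > 0"
  shows "((\<lambda>\<rho>. exp (- (\<theta> * weight \<rho>))) has_sum partition_function K \<theta>) {\<rho>. set_mset \<rho> \<subseteq> K}"
  unfolding weight_def partition_function_def sum_mset_distrib_left
  using assms a_pos by (intro has_sum_exp_multiset) auto

lemma partition_function_pos:
  assumes "K \<subseteq> L" "\<theta> > 0"
  shows "partition_function K \<theta> > 0"
  unfolding partition_function_def using assms a_pos by (intro prod_pos) auto

text \<open>
  The Chernoff estimate for the total size: the partition functions of nearby parameters differ, beyond
  first order, by a factor that is controlled by the zeta function.
\<close>

lemma partition_function_tilt:
  assumes "finite K" "K \<subseteq> L" "\<theta> > 0" "\<bar>\<tau>\<bar> \<le> 1 / 2"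
  shows "partition_function K (\<theta> - \<tau> * \<theta>) \<le> partition_function K \<theta> *
    exp (\<tau> * \<theta> * (\<Sum>k\<in>K. a k * bose (\<theta> * a k)) + 32 * \<tau>\<^sup>2 * (zeta_const * \<theta> powr - \<gamma>))"
proof -
  have "partition_function K (\<theta> - \<tau> * \<theta>) = (\<Prod>k\<in>K. 1 / (1 - exp (- (\<theta> * a k - \<tau> * \<theta> * a k))))"
    by (simp add: partition_function_def left_diff_distrib)
  also have "\<dots> \<le> partition_function K \<theta> *
      exp ((\<Sum>k\<in>K. (\<tau> * \<theta> * a k) * bose (\<theta> * a k)) +
        (\<Sum>k\<in>K. 32 * ((\<tau> * \<theta> * a k) / (\<theta> * a k))\<^sup>2 * exp (- (\<theta> * a k) / 4)))"
    unfolding partition_function_def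
  proof (intro partition_function_tilt_le assms conjI)
    fix k assume "k \<in> K"
    then have p: "\<theta> * a k > 0" using assms a_pos by auto
    then show "\<theta> * a k > 0" .
    have "\<bar>\<tau>\<bar> * (\<theta> * a k) \<le> 1 / 2 * (\<theta> * a k)" using p assms(4) by (intro mult_right_mono) auto
    moreover have "\<bar>\<tau> * \<theta> * a k\<bar> = \<bar>\<tau>\<bar> * (\<theta> * a k)"
      using p by (simp only: mult.assoc abs_mult[of \<tau>] abs_of_pos)
    ultimately show "\<bar>\<tau> * \<theta> * a k\<bar> \<le> \<theta> * a k / 2" by simp
  qed
  also have "(\<Sum>k\<in>K. 32 * ((\<tau> * \<theta> * a k) / (\<theta> * a k))\<^sup>2 * exp (- (\<theta> * a k) / 4)) =
      32 * \<tau>\<^sup>2 * (\<Sum>k\<in>K. exp (- (\<theta> * a k) / 4))"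
    unfolding sum_distrib_left using assms a_pos by (intro sum.cong) (auto simp: less_imp_neq[symmetric] subset_iff)
  also have "(\<Sum>k\<in>K. (\<tau> * \<theta> * a k) * bose (\<theta> * a k)) = \<tau> * \<theta> * (\<Sum>k\<in>K. a k * bose (\<theta> * a k))"
    by (simp add: sum_distrib_left mult.assoc)
  also have "partition_function K \<theta> * exp (\<tau> * \<theta> * (\<Sum>k\<in>K. a k * bose (\<theta> * a k)) +
        32 * \<tau>\<^sup>2 * (\<Sum>k\<in>K. exp (- (\<theta> * a k) / 4))) \<le> partition_function K \<theta> *
    exp (\<tau> * \<theta> * (\<Sum>k\<in>K. a k * bose (\<theta> * a k)) + 32 * \<tau>\<^sup>2 * (zeta_const * \<theta> powr - \<gamma>))"
    using assms exp_sum_le[of \<theta> K] partition_function_pos[of K \<theta>]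
    by (intro mult_left_mono) (auto intro!: mult_left_mono)
  finally show ?thesis .
qed

text \<open>
  Under the Boltzmann law on partitions into parts from \<open>K\<close>, whose mean is about \<open>n - D\<close>, the total
  size falls into \<open>[n - 2 D, n]\<close> with probability at least one half, by Chernoff bounds on both sides.
  Every size in this window has at most as many partitions as \<open>n\<close>. A finite \<open>K\<close> avoids infinite products.
\<close>

lemma partition_function_le_window:
  fixes n :: nat
  assumes K: "finite K" "K \<subseteq> L" and \<theta>: "\<theta> > 0" and \<tau>: "0 < \<tau>" "\<tau> \<le> 1 / 2"
    and mean_K: "real n - 3 / 2 * D \<le> (\<Sum>k\<in>K. a k * bose (\<theta> * a k))"
      "(\<Sum>k\<in>K. a k * bose (\<theta> * a k)) \<le> real n - D" and D: "D > 0"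
    and small: "32 * \<tau>\<^sup>2 * (zeta_const * \<theta> powr - \<gamma>) - \<tau> * \<theta> * D / 2 \<le> - ln 4"
  shows "partition_function K \<theta> \<le> 2 * (real n + 1) * real (card (parts n)) * exp (- \<theta> * (real n - 2 * D))"
proof -
  let ?U = "{\<rho>. set_mset \<rho> \<subseteq> K}" and ?Z = "partition_function K \<theta>"
  let ?M = "\<Sum>k\<in>K. a k * bose (\<theta> * a k)" and ?V = "32 * \<tau>\<^sup>2 * (zeta_const * \<theta> powr - \<gamma>)"
  let ?f = "\<lambda>\<rho>. exp (- (\<theta> * weight \<rho>))"
  define W where "W = {\<rho> \<in> ?U. real n - 2 * D \<le> weight \<rho> \<and> weight \<rho> \<le> real n}"
  have Z0: "0 < ?Z" using K \<theta> by (intro partition_function_pos)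
  have W_sub: "W \<subseteq> (\<Union>m\<in>{..n}. parts m)"
  proof
    fix \<rho> assume \<rho>: "\<rho> \<in> W"
    then obtain m where m: "weight \<rho> = real m" using weight_nat[of \<rho>] K by (auto simp: W_def)
    then show "\<rho> \<in> (\<Union>m\<in>{..n}. parts m)" using \<rho> K by (auto simp: W_def parts_def)
  qed
  then have finW: "finite W" using finite_parts by (meson finite_UN_I finite_atMost finite_subset)
  have "card W \<le> card (\<Union>m\<in>{..n}. parts m)" using W_sub finite_parts by (intro card_mono) auto
  also have "\<dots> \<le> (\<Sum>m\<in>{..n}. card (parts m))" by (rule card_UN_le) simp
  also have "\<dots> \<le> (\<Sum>m\<in>{..n}. card (parts n))" by (intro sum_mono card_parts_mono) auto
  finally have cardW: "real (card W) \<le> (real n + 1) * real (card (parts n))"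
    by (simp flip: of_nat_mult of_nat_add of_nat_Suc add: add.commute)
  have sumW: "(\<Sum>\<rho>\<in>W. ?f \<rho>) \<le> real (card W) * exp (- \<theta> * (real n - 2 * D))"
    using \<theta> by (intro sum_bounded_above) (auto simp: W_def)
  (* g1 and g2 dominate the Boltzmann weight above and below the window, respectively, and their
     sums are tilted partition functions. *)
  define g1 where "g1 \<rho> = exp (- (\<tau> * \<theta> * real n)) * exp (- ((\<theta> - \<tau> * \<theta>) * weight \<rho>))" for \<rho>
  define g2 where "g2 \<rho> = exp (\<tau> * \<theta> * (real n - 2 * D)) * exp (- ((\<theta> - (- \<tau>) * \<theta>) * weight \<rho>))" for \<rho>
  have pos1: "\<theta> - \<tau> * \<theta> > 0" using \<tau> \<theta> by simp
  have pos2: "\<theta> - (- \<tau>) * \<theta> > 0" using \<tau> \<theta> by (simp add: add_pos_pos)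
  have s1: "(g1 has_sum (exp (- (\<tau> * \<theta> * real n)) * partition_function K (\<theta> - \<tau> * \<theta>))) ?U"
    unfolding g1_def by (intro has_sum_cmult_right partition_function_has_sum K pos1)
  have s2: "(g2 has_sum (exp (\<tau> * \<theta> * (real n - 2 * D)) * partition_function K (\<theta> - (- \<tau>) * \<theta>))) ?U"
    unfolding g2_def by (intro has_sum_cmult_right partition_function_has_sum K pos2)
  have s3: "((\<lambda>\<rho>. if \<rho> \<in> W then ?f \<rho> else 0) has_sum (\<Sum>\<rho>\<in>W. ?f \<rho>)) ?U"
  proof -
    have "(?f has_sum (\<Sum>\<rho>\<in>W. ?f \<rho>)) W" by (rule has_sum_finite[OF finW])
    also have "?this \<longleftrightarrow> ?thesis" by (rule has_sum_cong_neutral) (auto simp: W_def)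
    finally show ?thesis .
  qed
  have "?Z \<le> (\<Sum>\<rho>\<in>W. ?f \<rho>) + exp (- (\<tau> * \<theta> * real n)) * partition_function K (\<theta> - \<tau> * \<theta>)
      + exp (\<tau> * \<theta> * (real n - 2 * D)) * partition_function K (\<theta> - (- \<tau>) * \<theta>)"
  proof (rule has_sum_mono[OF partition_function_has_sum[OF K \<theta>] has_sum_add[OF has_sum_add[OF s3 s1] s2]])
    fix \<rho> assume \<rho>: "\<rho> \<in> ?U"
    have g1: "g1 \<rho> = ?f \<rho> * exp (\<tau> * \<theta> * (weight \<rho> - real n))"
      unfolding g1_def by (simp add: algebra_simps flip: exp_add)
    have g2: "g2 \<rho> = ?f \<rho> * exp (\<tau> * \<theta> * (real n - 2 * D - weight \<rho>))"
      unfolding g2_def by (simp add: algebra_simps flip: exp_add)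
    have nonneg: "0 \<le> g1 \<rho>" "0 \<le> g2 \<rho>" by (simp_all add: g1_def g2_def)
    consider "\<rho> \<in> W" | "weight \<rho> > real n" | "weight \<rho> < real n - 2 * D"
      using \<rho> by (fastforce simp: W_def)
    then show "?f \<rho> \<le> (if \<rho> \<in> W then ?f \<rho> else 0) + g1 \<rho> + g2 \<rho>"
    proof cases
      case 1
      then show ?thesis using nonneg by simp
    next
      case 2
      then have "?f \<rho> \<le> g1 \<rho>" using \<tau> \<theta> by (simp add: g1)
      then show ?thesis using 2 nonneg by (simp add: W_def)
    next
      case 3
      then have "?f \<rho> \<le> g2 \<rho>" using \<tau> \<theta> by (simp add: g2)
      then show ?thesis using 3 nonneg by (simp add: W_def)
    qed
  qed
  also have "exp (- (\<tau> * \<theta> * real n)) * partition_function K (\<theta> - \<tau> * \<theta>) \<le> ?Z / 4"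
  proof -
    have "exp (- (\<tau> * \<theta> * real n)) * partition_function K (\<theta> - \<tau> * \<theta>) \<le>
        exp (- (\<tau> * \<theta> * real n)) * (?Z * exp (\<tau> * \<theta> * ?M + ?V))"
      using \<tau> by (intro mult_left_mono partition_function_tilt K \<theta>) auto
    also have "\<dots> = ?Z * exp (?V - \<tau> * \<theta> * (real n - ?M))"
      by (simp add: algebra_simps flip: exp_add)
    also have "\<dots> \<le> ?Z * exp (- ln 4)"
    proof -
      have "\<tau> * \<theta> * (D / 2) \<le> \<tau> * \<theta> * (real n - ?M)"
        using \<tau> \<theta> mean_K D by (intro mult_left_mono) auto
      with small show ?thesis using Z0 by (intro mult_left_mono) auto
    qed
    finally show ?thesis by (simp add: exp_minus)
  qed
  also have "exp (\<tau> * \<theta> * (real n - 2 * D)) * partition_function K (\<theta> - (- \<tau>) * \<theta>) \<le> ?Z / 4"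
  proof -
    have "exp (\<tau> * \<theta> * (real n - 2 * D)) * partition_function K (\<theta> - (- \<tau>) * \<theta>) \<le>
        exp (\<tau> * \<theta> * (real n - 2 * D)) * (?Z * exp ((- \<tau>) * \<theta> * ?M + 32 * (- \<tau>)\<^sup>2 * (zeta_const * \<theta> powr - \<gamma>)))"
      using \<tau> by (intro mult_left_mono partition_function_tilt K \<theta>) auto
    also have "\<dots> = ?Z * exp (?V - \<tau> * \<theta> * (?M - (real n - 2 * D)))"
      by (simp add: algebra_simps flip: exp_add)
    also have "\<dots> \<le> ?Z * exp (- ln 4)"
    proof -
      have "\<tau> * \<theta> * (D / 2) \<le> \<tau> * \<theta> * (?M - (real n - 2 * D))"
        using \<tau> \<theta> mean_K D by (intro mult_left_mono) auto
      with small show ?thesis using Z0 by (intro mult_left_mono) auto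
    qed
    finally show ?thesis by (simp add: exp_minus)
  qed
  finally have "?Z \<le> 2 * (\<Sum>\<rho>\<in>W. ?f \<rho>)" by simp
  also have "\<dots> \<le> 2 * (((real n + 1) * real (card (parts n))) * exp (- \<theta> * (real n - 2 * D)))"
    using order_trans[OF sumW mult_right_mono[OF cardW, of "exp (- \<theta> * (real n - 2 * D))"]]
    by (intro mult_left_mono) auto
  finally show ?thesis by (simp only: mult.assoc)
qed

text \<open>
  As a function of \<open>\<theta>\<close>, the logarithm of the left-hand side is convex, and its derivative at \<open>\<theta>\<close> is
  \<open>y\<close> minus the mean over \<open>K\<close>, which is nonnegative by hypothesis.
\<close>

lemma partition_function_exponent_mono:
  assumes "finite K" "K \<subseteq> L" "0 < \<theta>" "\<theta> \<le> \<theta>'" "(\<Sum>k\<in>K. a k * bose (\<theta> * a k)) \<le> y"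
  shows "partition_function K \<theta> * exp (\<theta> * y) \<le> partition_function K \<theta>' * exp (\<theta>' * y)"
proof -
  let ?M = "\<Sum>k\<in>K. a k * bose (\<theta> * a k)"
  have "- (\<theta>' - \<theta>) * y \<le> - (\<theta>' - \<theta>) * ?M"
    using mult_left_mono[OF assms(5), of "\<theta>' - \<theta>"] assms(4)
    by (simp only: mult_minus_left neg_le_iff_le diff_ge_0_iff_ge)
  then have "partition_function K \<theta> * exp (- (\<theta>' - \<theta>) * y) \<le> partition_function K \<theta> * exp (- (\<theta>' - \<theta>) * ?M)"
    using partition_function_pos[of K \<theta>] assms(2,3) by (intro mult_left_mono) auto
  also have "- (\<theta>' - \<theta>) * ?M = (\<Sum>k\<in>K. (- (\<theta>' - \<theta>) * a k) * bose (\<theta> * a k))"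
    by (simp only: sum_distrib_left mult.assoc)
  also have "partition_function K \<theta> * exp \<dots> \<le>
      (\<Prod>k\<in>K. 1 / (1 - exp (- (\<theta> * a k - (- (\<theta>' - \<theta>) * a k)))))"
    unfolding partition_function_def
  proof (intro partition_function_tilt_ge assms conjI)
    fix k assume "k \<in> K"
    then have "a k > 0" using assms a_pos by auto
    then show "\<theta> * a k > 0" using assms by simp
    moreover have "- (\<theta>' - \<theta>) * a k \<le> 0" using \<open>a k > 0\<close> assms by (simp add: mult_nonpos_nonneg)
    ultimately show "- (\<theta>' - \<theta>) * a k < \<theta> * a k" by linarith
  qed
  also have "\<dots> = partition_function K \<theta>'"
    by (simp add: partition_function_def left_diff_distrib)
  finally have "partition_function K \<theta> * exp (- (\<theta>' - \<theta>) * y) * exp (\<theta>' * y) \<le>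
      partition_function K \<theta>' * exp (\<theta>' * y)"
    by (rule mult_right_mono) simp
  then show ?thesis by (simp add: mult.assoc algebra_simps flip: exp_add)
qed

text \<open>
  Each of the at least \<open>c (1 / \<theta>) powr \<alpha>\<close> parts of size at most \<open>1 / \<theta>\<close> loses a fixed multiple of
  \<open>1 / \<theta>\<close> when the parameter is doubled. Hence a mean slightly below \<open>mean \<theta>\<close> is attained at a
  parameter below \<open>2 \<theta>\<close>.
\<close>

lemma mean_drop:
  assumes "0 < \<theta>" "\<theta> \<le> 1"
  shows "c * exp (- 1) / 2 * \<theta> powr - \<alpha> / \<theta> \<le> mean \<theta> - mean (2 * \<theta>)"
proof -
  let ?K = "{k \<in> L. a k \<le> 1 / \<theta>}"
  have bound: "exp (- 1) / (2 * \<theta>) \<le> a k * (bose (\<theta> * a k) - bose (2 * \<theta> * a k))" if "k \<in> ?K" for k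
  proof -
    let ?x = "\<theta> * a k"
    have x: "0 < ?x" "?x \<le> 1" using that assms a_pos[of k] by (auto simp: field_simps)
    have "bose ?x - bose (2 * ?x) = exp (- ?x) / (1 - exp (- (2 * ?x)))"
    proof -
      have "1 / (E - 1) - 1 / (E * E - 1) = (1 / E) / (1 - 1 / (E * E))" if "E > 1" for E :: real
      proof -
        have "E * E - 1 = (E - 1) * (E + 1)" by (simp add: algebra_simps)
        moreover have "E - 1 \<noteq> 0" "E + 1 \<noteq> 0" "E \<noteq> 0" using that by auto
        ultimately show ?thesis by (simp add: divide_simps)
      qed
      moreover have "exp (2 * ?x) = exp ?x * exp ?x" by (simp flip: exp_add)
      ultimately show ?thesis
        using x by (simp add: bose_def exp_minus inverse_eq_divide)
    qed
    also have "\<dots> \<ge> exp (- 1) / (2 * ?x)"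
    proof (rule frac_le)
      show "1 - exp (- (2 * ?x)) \<le> 2 * ?x" using exp_ge_add_one_self[of "- (2 * ?x)"] by simp
    qed (use x in auto)
    finally have "a k * (exp (- 1) / (2 * ?x)) \<le> a k * (bose ?x - bose (2 * ?x))"
      using a_pos[of k] that by (intro mult_left_mono) auto
    then show ?thesis using assms a_pos[of k] that by (simp add: mult.assoc)
  qed
  have "c * exp (- 1) / 2 * \<theta> powr - \<alpha> / \<theta> = (c * (1 / \<theta>) powr \<alpha>) * (exp (- 1) / (2 * \<theta>))"
    using assms by (simp add: powr_minus powr_divide field_simps)
  also have "\<dots> \<le> real (card ?K) * (exp (- 1) / (2 * \<theta>))"
    using assms by (intro mult_right_mono count_ge) auto
  also have "\<dots> \<le> (\<Sum>k\<in>?K. a k * (bose (\<theta> * a k) - bose (2 * \<theta> * a k)))"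
    using bound by (intro sum_bounded_below) auto
  also have "\<dots> \<le> mean \<theta> - mean (2 * \<theta>)"
    using assms by (intro mean_diff_ge finite_bounded) auto
  finally show ?thesis .
qed

text \<open>
  For every \<open>\<theta>\<close>, the number of partitions of \<open>n\<close> is at most \<open>exp (\<theta> n)\<close> times the partition function
  of any finite \<open>K\<close> that contains all parts of size at most \<open>n\<close>. At the parameter whose mean is \<open>n\<close>
  this trivial bound is sharp up to a factor that is subexponential on the scale \<open>\<theta> powr - \<alpha>\<close>.
\<close>

theorem card_parts_ge:
  assumes "\<delta> > 0"
  shows "\<forall>\<^sub>F \<theta> in at_right 0. \<forall>n. mean \<theta> = real n \<longrightarrow>
    (\<forall>\<^sub>F K in finite_subsets_at_top L.
      exp (\<theta> * real n - \<delta> * \<theta> powr - \<alpha>) * partition_function K \<theta> \<le> real (card (parts n)))"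
proof -
  (* The window has width 2 D with D = \<delta>1 \<theta> powr - \<alpha> / \<theta>. The first bound keeps the loss
     exp (2 D \<theta>') small, the second makes n - D a value of the mean on [\<theta>, 2 \<theta>]. *)
  define \<delta>1 where "\<delta>1 = min (\<delta> / 8) (c * exp (- 1) / 2)"
  have d1: "\<delta>1 > 0" "\<delta>1 \<le> \<delta> / 8" "\<delta>1 \<le> c * exp (- 1) / 2"
    using assms c_pos by (auto simp: \<delta>1_def)
  let ?B = zeta_const
  have B: "?B > 0" by (rule zeta_const_pos)
  have "\<gamma> / 2 - \<alpha> < 0" using gamma by simp
  then have "\<forall>\<^sub>F \<theta> in at_right 0. C \<le> \<delta>1 * \<theta> powr (\<gamma> / 2 - \<alpha>) / 2" for C
    using d1(1) by real_asymp
  then have E1: "\<forall>\<^sub>F \<theta> in at_right 0. 32 * ?B + ln 4 \<le> \<delta>1 * \<theta> powr (\<gamma> / 2 - \<alpha>) / 2" .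
  have E2: "\<forall>\<^sub>F \<theta> in at_right 0. \<theta> powr (\<gamma> / 2) \<le> 1 / 2"
    using gamma(1) by real_asymp
  have "\<forall>\<^sub>F \<theta> in at_right 0. 2 * (4 * C * \<theta> powr - (\<gamma> + 1) + 1) \<le> exp (\<delta> / 2 * \<theta> powr - \<alpha>)"
    if "C > 0" for C
    using alpha_pos gamma(1) assms that by real_asymp
  from this[OF B] have E3: "\<forall>\<^sub>F \<theta> in at_right 0.
      2 * (4 * ?B * \<theta> powr - (\<gamma> + 1) + 1) \<le> exp (\<delta> / 2 * \<theta> powr - \<alpha>)" .
  have E4: "\<forall>\<^sub>F \<theta> in at_right 0. (0::real) < \<theta> \<and> \<theta> \<le> 1"
    using eventually_at_right_real[of 0 1] by (auto elim: eventually_mono)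
  from E1 E2 E3 E4 show ?thesis
  proof eventually_elim
    case (elim \<theta>)
    show ?case
    proof (intro allI impI)
      fix n assume n: "mean \<theta> = real n"
      define D where "D = \<delta>1 * \<theta> powr - \<alpha> / \<theta>"
      (* The relative tilt \<tau> is small enough that the quadratic Chernoff term stays bounded, and
         \<tau> \<theta> D still tends to infinity because \<gamma> < 2 \<alpha>. *)
      define \<tau> where "\<tau> = \<theta> powr (\<gamma> / 2)"
      have \<theta>: "0 < \<theta>" "\<theta> \<le> 1" using elim by auto
      have D: "D > 0" using d1 \<theta> by (simp add: D_def)
      have \<tau>: "0 < \<tau>" "\<tau> \<le> 1 / 2" "\<tau>\<^sup>2 = \<theta> powr \<gamma>"
        using elim(2) \<theta> by (auto simp: \<tau>_def power2_eq_square simp flip: powr_add)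
      have "D \<le> c * exp (- 1) / 2 * \<theta> powr - \<alpha> / \<theta>"
        unfolding D_def using d1 \<theta> by (intro divide_right_mono mult_right_mono) auto
      then have "mean (2 * \<theta>) \<le> real n - D" using mean_drop[OF \<theta>] n by linarith
      moreover have "continuous_on {\<theta>..2 * \<theta>} mean"
        using mean_continuous[OF \<theta>(1)] by (rule continuous_on_subset) auto
      ultimately obtain \<theta>' where \<theta>': "\<theta> \<le> \<theta>'" "\<theta>' \<le> 2 * \<theta>" "mean \<theta>' = real n - D"
        using IVT2'[of mean "2 * \<theta>" "real n - D" \<theta>] n D \<theta> by auto
      have \<theta>'0: "\<theta>' > 0" using \<theta>' \<theta> by linarith
      have small: "32 * \<tau>\<^sup>2 * (?B * \<theta>' powr - \<gamma>) - \<tau> * \<theta>' * D / 2 \<le> - ln 4"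
      proof -
        have "\<theta>' powr - \<gamma> \<le> \<theta> powr - \<gamma>" using \<theta> \<theta>' gamma by (intro powr_mono2') auto
        then have "32 * \<tau>\<^sup>2 * (?B * \<theta>' powr - \<gamma>) \<le> 32 * \<tau>\<^sup>2 * (?B * \<theta> powr - \<gamma>)"
          using B by (intro mult_left_mono) auto
        also have "\<dots> = 32 * ?B * (\<theta> powr \<gamma> * \<theta> powr - \<gamma>)" by (simp add: \<tau>)
        also have "\<theta> powr \<gamma> * \<theta> powr - \<gamma> = 1" using \<theta> by (simp flip: powr_add)
        finally have 1: "32 * \<tau>\<^sup>2 * (?B * \<theta>' powr - \<gamma>) \<le> 32 * ?B" by simp
        have "\<delta>1 * \<theta> powr (\<gamma> / 2 - \<alpha>) = \<tau> * (\<theta> * D)"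
          using \<theta> powr_add[of \<theta> "\<gamma> / 2" "- \<alpha>"] by (simp add: \<tau>_def D_def)
        also have "\<dots> \<le> \<tau> * (\<theta>' * D)" using \<theta>' D \<tau> by (intro mult_left_mono mult_right_mono) auto
        finally show ?thesis using 1 elim(1) by (simp add: mult.assoc)
      qed
      have "\<forall>\<^sub>F K in finite_subsets_at_top L.
          dist (\<Sum>k\<in>K. a k * bose (\<theta>' * a k)) (mean \<theta>') < D / 2"
        using has_sum_infsum[OF mean_summable[OF \<theta>'0]] D
        unfolding has_sum_def mean_def by (intro tendstoD) auto
      moreover have "\<forall>\<^sub>F K in finite_subsets_at_top L. finite K \<and> K \<subseteq> L"
        by (rule eventually_finite_subsets_at_top_weakI) simp
      ultimately show "\<forall>\<^sub>F K in finite_subsets_at_top L.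
          exp (\<theta> * real n - \<delta> * \<theta> powr - \<alpha>) * partition_function K \<theta> \<le> real (card (parts n))"
      proof eventually_elim
        case (elim K)
        then have K: "finite K" "K \<subseteq> L" by auto
        have le_mean: "(\<Sum>k\<in>K. a k * bose (t * a k)) \<le> mean t" if "t > 0" for t
          unfolding mean_def using that K mean_term_nonneg
          by (intro finite_sum_le_infsum mean_summable) auto
        let ?r = "real (card (parts n))"
        have "partition_function K \<theta> * exp (\<theta> * real n) \<le> partition_function K \<theta>' * exp (\<theta>' * real n)"
          using le_mean[OF \<theta>(1)] n by (intro partition_function_exponent_mono K \<theta> \<theta>') simp
        also have "\<dots> \<le> 2 * (real n + 1) * ?r * exp (- \<theta>' * (real n - 2 * D)) * exp (\<theta>' * real n)"
        proof (rule mult_right_mono)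
          show "partition_function K \<theta>' \<le> 2 * (real n + 1) * ?r * exp (- \<theta>' * (real n - 2 * D))"
            using le_mean[OF \<theta>'0] elim(1) \<theta>'(3) D
            by (intro partition_function_le_window[OF K \<theta>'0 \<tau>(1,2) _ _ D small])
               (auto simp: dist_real_def abs_real_def split: if_splits)
        qed simp
        also have "\<dots> = 2 * (real n + 1) * ?r * exp (2 * \<theta>' * D)"
        proof -
          have "exp (- \<theta>' * (real n - 2 * D)) * exp (\<theta>' * real n) = exp (2 * \<theta>' * D)"
            by (simp add: algebra_simps flip: exp_add)
          then show ?thesis by (simp only: mult.assoc)
        qed
        also have "\<dots> \<le> exp (\<delta> / 2 * \<theta> powr - \<alpha>) * ?r * exp (\<delta> / 2 * \<theta> powr - \<alpha>)"
        proof (intro mult_mono)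
          have "real n + 1 \<le> 4 * ?B * \<theta> powr - (\<gamma> + 1) + 1"
            using mean_le[OF \<theta>(1)] n by simp
          then have "2 * (real n + 1) \<le> 2 * (4 * ?B * \<theta> powr - (\<gamma> + 1) + 1)"
            by (intro mult_left_mono) auto
          also note \<open>2 * (4 * ?B * \<theta> powr - (\<gamma> + 1) + 1) \<le> _\<close>
          finally show "2 * (real n + 1) \<le> exp (\<delta> / 2 * \<theta> powr - \<alpha>)" .
          have "2 * \<theta>' * D \<le> 2 * (2 * \<theta>) * D" using \<theta>' D by simp
          also have "\<dots> = 4 * \<delta>1 * \<theta> powr - \<alpha>" using \<theta> by (simp add: D_def)
          also have "\<dots> \<le> \<delta> / 2 * \<theta> powr - \<alpha>" using d1 by (intro mult_right_mono) auto
          finally show "exp (2 * \<theta>' * D) \<le> exp (\<delta> / 2 * \<theta> powr - \<alpha>)" by simp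
        qed auto
        also have "\<dots> = ?r * (exp (\<delta> / 2 * \<theta> powr - \<alpha>) * exp (\<delta> / 2 * \<theta> powr - \<alpha>))"
          by simp
        also have "exp (\<delta> / 2 * \<theta> powr - \<alpha>) * exp (\<delta> / 2 * \<theta> powr - \<alpha>) = exp (\<delta> * \<theta> powr - \<alpha>)"
          unfolding exp_add[symmetric] by simp
        finally show ?case by (simp add: exp_diff pos_divide_le_eq mult.commute)
      qed
    qed
  qed
qed

section \<open>Concentration of linear statistics\<close>

text \<open>
  The exponential Markov inequality for the number of parts in \<open>S\<close>, with the total size fixed at \<open>n\<close>:
  each partition in \<open>A\<close> contributes at least \<open>exp (y - \<theta> n)\<close> to the partition function in which the
  parts from \<open>S\<close> are tilted by \<open>u\<close>.
\<close>

lemma card_tilted_le: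
  assumes K: "finite K" "K \<subseteq> L" and \<theta>: "\<theta> > 0"
    and b: "b > 0" "\<And>k. k \<in> K \<inter> S \<Longrightarrow> b \<le> \<theta> * a k" and u: "\<bar>u\<bar> \<le> b / 2"
    and A: "A \<subseteq> parts n" "\<And>\<rho>. \<rho> \<in> A \<Longrightarrow> set_mset \<rho> \<subseteq> K"
      "\<And>\<rho>. \<rho> \<in> A \<Longrightarrow> y \<le> u * real (size (filter_mset (\<lambda>k. k \<in> S) \<rho>))"
  shows "real (card A) * exp y \<le> exp (\<theta> * real n) * (partition_function K \<theta> *
    exp (u * (\<Sum>k\<in>K \<inter> S. bose (\<theta> * a k)) + 32 * (u / b)\<^sup>2 * (\<Sum>k\<in>K \<inter> S. exp (- (\<theta> * a k) / 4))))"
proof -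
  let ?u = "\<lambda>k. if k \<in> S then u else 0"
  let ?x = "\<lambda>k. \<theta> * a k"
  have finA: "finite A" using A(1) finite_parts by (rule finite_subset)
  have xu: "?x k > 0 \<and> \<bar>?u k\<bar> \<le> ?x k / 2" if "k \<in> K" for k
    using that a_pos[of k] K \<theta> b(2)[of k] u by auto
  have "real (card A) * exp (y - \<theta> * real n) \<le> (\<Sum>\<rho>\<in>A. exp (- (\<Sum>k\<in>#\<rho>. ?x k - ?u k)))"
  proof (intro sum_bounded_below)
    fix \<rho> assume \<rho>: "\<rho> \<in> A"
    have "(\<Sum>k\<in>#\<rho>. ?x k - ?u k) = \<theta> * weight \<rho> - u * real (size (filter_mset (\<lambda>k. k \<in> S) \<rho>))"
      unfolding sum_mset_filter_eq_size[symmetric] weight_def sum_mset_distrib_left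
      by (induction \<rho>) auto
    also have "weight \<rho> = real n" using \<rho> A(1) by (auto simp: parts_def)
    finally show "exp (y - \<theta> * real n) \<le> exp (- (\<Sum>k\<in>#\<rho>. ?x k - ?u k))"
      using A(3)[OF \<rho>] by simp
  qed
  also have "\<dots> \<le> (\<Prod>k\<in>K. 1 / (1 - exp (- (?x k - ?u k))))"
  proof (rule finite_sum_le_has_sum[OF has_sum_exp_multiset finA])
    show "?x k - ?u k > 0" if "k \<in> K" for k using xu[OF that] by linarith
  qed (use A(2) K in auto)
  also have "\<dots> \<le> partition_function K \<theta> * exp ((\<Sum>k\<in>K. ?u k * bose (?x k)) +
      (\<Sum>k\<in>K. 32 * (?u k / ?x k)\<^sup>2 * exp (- ?x k / 4)))"
    unfolding partition_function_def using xu by (intro partition_function_tilt_le K)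
  also have "(\<Sum>k\<in>K. ?u k * bose (?x k)) = u * (\<Sum>k\<in>K \<inter> S. bose (\<theta> * a k))"
    unfolding sum.inter_restrict[OF K(1)] sum_distrib_left by (intro sum.cong) auto
  also have "(\<Sum>k\<in>K. 32 * (?u k / ?x k)\<^sup>2 * exp (- ?x k / 4)) =
      (\<Sum>k\<in>K \<inter> S. 32 * (u / ?x k)\<^sup>2 * exp (- ?x k / 4))"
    unfolding sum.inter_restrict[OF K(1)] by (intro sum.cong) auto
  also have "partition_function K \<theta> * exp (u * (\<Sum>k\<in>K \<inter> S. bose (\<theta> * a k)) +
      (\<Sum>k\<in>K \<inter> S. 32 * (u / ?x k)\<^sup>2 * exp (- ?x k / 4))) \<le>
      partition_function K \<theta> * exp (u * (\<Sum>k\<in>K \<inter> S. bose (\<theta> * a k)) +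
      32 * (u / b)\<^sup>2 * (\<Sum>k\<in>K \<inter> S. exp (- (\<theta> * a k) / 4)))"
  proof -
    have "(\<Sum>k\<in>K \<inter> S. 32 * (u / ?x k)\<^sup>2 * exp (- ?x k / 4)) \<le>
        (\<Sum>k\<in>K \<inter> S. 32 * (u / b)\<^sup>2 * exp (- ?x k / 4))"
    proof (intro sum_mono mult_right_mono mult_left_mono)
      fix k assume "k \<in> K \<inter> S"
      then have "\<bar>u / ?x k\<bar> \<le> \<bar>u / b\<bar>"
        using b(1) b(2)[of k] \<theta> a_pos[of k] K(2)
        by (auto simp: abs_divide intro!: divide_left_mono mult_pos_pos)
      then show "(u / ?x k)\<^sup>2 \<le> (u / b)\<^sup>2" by (simp only: abs_le_square_iff)
    qed auto
    then show ?thesis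
      using partition_function_pos[OF K(2) \<theta>] by (intro mult_left_mono) (auto simp: sum_distrib_left)
  qed
  finally have "real (card A) * exp (y - \<theta> * real n) * exp (\<theta> * real n) \<le>
      partition_function K \<theta> * exp (u * (\<Sum>k\<in>K \<inter> S. bose (\<theta> * a k)) +
      32 * (u / b)\<^sup>2 * (\<Sum>k\<in>K \<inter> S. exp (- (\<theta> * a k) / 4))) * exp (\<theta> * real n)"
    by (rule mult_right_mono) simp
  then show ?thesis by (simp add: mult_ac exp_diff)
qed

text \<open>
  Exponential concentration, under the uniform law on the partitions of \<open>n\<close>, of the number of parts
  in a set \<open>S\<close> that stays away from the small parts: the bound \<open>b\<close> leaves room for a tilt of fixed size,
  and the exponent gained by this tilt beats the subexponential loss in \<open>card_parts_ge\<close>.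
\<close>

theorem statistic_concentration:
  assumes "b > 0" "T > 0" "\<epsilon> > 0"
  obtains \<kappa> where "\<kappa> > 0" "\<forall>\<^sub>F \<theta> in at_right 0. \<forall>n S. mean \<theta> = real n \<longrightarrow> S \<subseteq> L \<longrightarrow>
      (\<forall>k\<in>S. b \<le> \<theta> * a k) \<longrightarrow> (\<Sum>\<^sub>\<infinity>k\<in>S. exp (- (\<theta> * a k) / 4)) \<le> T * \<theta> powr - \<alpha> \<longrightarrow>
      real (card {\<rho> \<in> parts n. \<epsilon> * \<theta> powr - \<alpha> \<le>
        \<bar>real (size (filter_mset (\<lambda>k. k \<in> S) \<rho>)) - (\<Sum>\<^sub>\<infinity>k\<in>S. bose (\<theta> * a k))\<bar>})
      \<le> exp (- (\<kappa> * \<theta> powr - \<alpha>)) * real (card (parts n))"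
proof -
  (* The tilt v is at most b / 2, and so small that the quadratic term costs at most a quarter
     of the gain v \<epsilon> \<theta> powr - \<alpha>. Another quarter, \<delta>, goes to the lower bound on the number of
     partitions. *)
  define v where "v = min (b / 2) (\<epsilon> * b\<^sup>2 / (128 * T))"
  have v: "v > 0" "v \<le> b / 2" "v \<le> \<epsilon> * b\<^sup>2 / (128 * T)"
    using assms by (auto simp: v_def)
  have v2: "32 * (v / b)\<^sup>2 * T \<le> v * \<epsilon> / 4"
  proof -
    have "v * (128 * T) \<le> \<epsilon> * b\<^sup>2" using v(3) assms by (simp add: field_simps)
    then have "v * (v * (128 * T)) \<le> v * (\<epsilon> * b\<^sup>2)" using v(1) by (intro mult_left_mono) auto
    then show ?thesis using assms by (simp add: field_simps power2_eq_square)
  qed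
  define \<delta> where "\<delta> = v * \<epsilon> / 4"
  define \<kappa> where "\<kappa> = v * \<epsilon> / 8"
  have pos: "\<delta> > 0" "\<kappa> > 0" using v assms by (auto simp: \<delta>_def \<kappa>_def)
  have E1: "\<forall>\<^sub>F \<theta> in at_right 0. ln 2 + v \<le> \<kappa> * \<theta> powr - \<alpha>"
    using pos(2) alpha_pos by real_asymp
  have E2: "\<forall>\<^sub>F \<theta> in at_right 0. (0::real) < \<theta>"
    by (rule eventually_at_right_less)
  have "\<forall>\<^sub>F \<theta> in at_right 0. \<forall>n S. mean \<theta> = real n \<longrightarrow> S \<subseteq> L \<longrightarrow>
      (\<forall>k\<in>S. b \<le> \<theta> * a k) \<longrightarrow> (\<Sum>\<^sub>\<infinity>k\<in>S. exp (- (\<theta> * a k) / 4)) \<le> T * \<theta> powr - \<alpha> \<longrightarrow>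
      real (card {\<rho> \<in> parts n. \<epsilon> * \<theta> powr - \<alpha> \<le>
        \<bar>real (size (filter_mset (\<lambda>k. k \<in> S) \<rho>)) - (\<Sum>\<^sub>\<infinity>k\<in>S. bose (\<theta> * a k))\<bar>})
      \<le> exp (- (\<kappa> * \<theta> powr - \<alpha>)) * real (card (parts n))"
    using card_parts_ge[OF pos(1)] E1 E2
  proof eventually_elim
    case (elim \<theta>)
    show ?case
    proof (intro allI impI)
      fix n S
      assume n: "mean \<theta> = real n" and S: "S \<subseteq> L" "\<forall>k\<in>S. b \<le> \<theta> * a k"
        and T: "(\<Sum>\<^sub>\<infinity>k\<in>S. exp (- (\<theta> * a k) / 4)) \<le> T * \<theta> powr - \<alpha>"
      let ?N = "\<theta> powr - \<alpha>" and ?\<mu> = "\<Sum>\<^sub>\<infinity>k\<in>S. bose (\<theta> * a k)" and ?r = "real (card (parts n))"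
      let ?\<phi> = "\<lambda>\<rho>. real (size (filter_mset (\<lambda>k. k \<in> S) \<rho>))"
      have bose_le_term: "0 \<le> bose (\<theta> * a k)" "bose (\<theta> * a k) \<le> a k * bose (\<theta> * a k)" if "k \<in> L" for k
        using that elim(3) a_ge_1[OF that] bose_pos[of "\<theta> * a k"]
          mult_right_mono[of 1 "a k" "bose (\<theta> * a k)"] by auto
      have "(\<lambda>k. bose (\<theta> * a k)) summable_on L"
        by (rule summable_on_comparison_test[OF mean_summable[OF elim(3)]]) (use bose_le_term in auto)
      then have "(\<lambda>k. bose (\<theta> * a k)) summable_on S" using S(1) by (rule summable_on_subset_banach)
      then have "((\<lambda>k. bose (\<theta> * a k)) has_sum ?\<mu>) S" by (rule has_sum_infsum)
      also have "?this \<longleftrightarrow> ((\<lambda>k. if k \<in> S then bose (\<theta> * a k) else 0) has_sum ?\<mu>) L"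
        using S(1) by (intro has_sum_cong_neutral) auto
      finally have "\<forall>\<^sub>F K in finite_subsets_at_top L.
          dist (\<Sum>k\<in>K. if k \<in> S then bose (\<theta> * a k) else 0) ?\<mu> < 1"
        unfolding has_sum_def by (rule tendstoD) simp
      moreover have "\<forall>\<^sub>F K in finite_subsets_at_top L. finite K \<and> {k \<in> L. a k \<le> real n} \<subseteq> K \<and> K \<subseteq> L"
        unfolding eventually_finite_subsets_at_top using finite_bounded by blast
      moreover have "\<forall>\<^sub>F K in finite_subsets_at_top L.
          exp (\<theta> * real n - \<delta> * ?N) * partition_function K \<theta> \<le> ?r"
        using elim(1) n by blast
      ultimately have "\<forall>\<^sub>F K in finite_subsets_at_top L.
          \<bar>(\<Sum>k\<in>K \<inter> S. bose (\<theta> * a k)) - ?\<mu>\<bar> < 1 \<and>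
          (finite K \<and> {k \<in> L. a k \<le> real n} \<subseteq> K \<and> K \<subseteq> L) \<and>
          exp (\<theta> * real n - \<delta> * ?N) * partition_function K \<theta> \<le> ?r"
        by eventually_elim (simp add: sum.inter_restrict dist_real_def)
      from eventually_happens'[OF finite_subsets_at_top_neq_bot this]
      obtain K where K: "finite K" "{k \<in> L. a k \<le> real n} \<subseteq> K" "K \<subseteq> L"
        and Z: "exp (\<theta> * real n - \<delta> * ?N) * partition_function K \<theta> \<le> ?r"
        and K_mean: "\<bar>(\<Sum>k\<in>K \<inter> S. bose (\<theta> * a k)) - ?\<mu>\<bar> < 1"
        by (elim exE conjE)
      have KS: "(\<Sum>k\<in>K \<inter> S. exp (- (\<theta> * a k) / 4)) \<le> T * ?N"
      proof -
        have "(\<lambda>k. exp (- (\<theta> * a k) / 4)) summable_on S"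
          using exp_summable[OF elim(3)] S(1) by (rule summable_on_subset_banach)
        then have "(\<Sum>k\<in>K \<inter> S. exp (- (\<theta> * a k) / 4)) \<le> (\<Sum>\<^sub>\<infinity>k\<in>S. exp (- (\<theta> * a k) / 4))"
          using K(1) by (intro finite_sum_le_infsum) auto
        with T show ?thesis by simp
      qed
      have Zr: "exp (\<theta> * real n) * partition_function K \<theta> \<le> ?r * exp (\<delta> * ?N)"
        using mult_right_mono[OF Z, of "exp (\<delta> * ?N)"] by (simp add: exp_diff)
      have tail: "real (card {\<rho> \<in> parts n. u * ?\<mu> + v * \<epsilon> * ?N \<le> u * ?\<phi> \<rho>}) \<le> ?r * exp (v - 4 * \<kappa> * ?N)"
        if u: "\<bar>u\<bar> = v" for u
      proof -
        let ?A = "{\<rho> \<in> parts n. u * ?\<mu> + v * \<epsilon> * ?N \<le> u * ?\<phi> \<rho>}"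
        have "u * ((\<Sum>k\<in>K \<inter> S. bose (\<theta> * a k)) - ?\<mu>) \<le> \<bar>u\<bar> * \<bar>(\<Sum>k\<in>K \<inter> S. bose (\<theta> * a k)) - ?\<mu>\<bar>"
          unfolding abs_mult[symmetric] by (rule abs_ge_self)
        also have "\<dots> \<le> v * 1" unfolding u using K_mean v by (intro mult_left_mono) auto
        finally have e1: "u * (\<Sum>k\<in>K \<inter> S. bose (\<theta> * a k)) \<le> u * ?\<mu> + v" by (simp add: right_diff_distrib)
        have "u\<^sup>2 = v\<^sup>2" using u by (metis power2_abs)
        then have "32 * (u / b)\<^sup>2 * (\<Sum>k\<in>K \<inter> S. exp (- (\<theta> * a k) / 4)) \<le> 32 * (v / b)\<^sup>2 * (T * ?N)"
          unfolding power_divide using KS by (intro mult_mono sum_nonneg) auto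
        also have "\<dots> \<le> v * \<epsilon> / 4 * ?N"
          using mult_right_mono[OF v2, of ?N] by (simp add: mult.assoc)
        finally have e2: "32 * (u / b)\<^sup>2 * (\<Sum>k\<in>K \<inter> S. exp (- (\<theta> * a k) / 4)) \<le> v * \<epsilon> / 4 * ?N" .
        have "real (card ?A) * exp (u * ?\<mu> + v * \<epsilon> * ?N) \<le> exp (\<theta> * real n) * (partition_function K \<theta> *
            exp (u * (\<Sum>k\<in>K \<inter> S. bose (\<theta> * a k)) + 32 * (u / b)\<^sup>2 * (\<Sum>k\<in>K \<inter> S. exp (- (\<theta> * a k) / 4))))"
        proof (rule card_tilted_le[OF K(1,3) elim(3) assms(1)])
          show "b \<le> \<theta> * a k" if "k \<in> K \<inter> S" for k using S(2) that by auto
          show "set_mset \<rho> \<subseteq> K" if "\<rho> \<in> ?A" for \<rho>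
            using that member_le_weight[of \<rho>] K(2) by (auto simp: parts_def subset_iff)
        qed (use u v in auto)
        also have "\<dots> = exp (\<theta> * real n) * partition_function K \<theta> *
            exp (u * (\<Sum>k\<in>K \<inter> S. bose (\<theta> * a k)) + 32 * (u / b)\<^sup>2 * (\<Sum>k\<in>K \<inter> S. exp (- (\<theta> * a k) / 4)))"
          by (simp only: mult.assoc)
        also have "\<dots> \<le> ?r * exp (\<delta> * ?N) * exp ((u * ?\<mu> + v) + v * \<epsilon> / 4 * ?N)"
          by (intro mult_mono Zr exp_le_cancel_iff[THEN iffD2] add_mono[OF e1 e2]) auto
        finally show ?thesis
          by (rule le_mult_exp_cancel) (simp add: \<delta>_def \<kappa>_def algebra_simps)
      qed
      let ?A = "{\<rho> \<in> parts n. \<epsilon> * ?N \<le> \<bar>?\<phi> \<rho> - ?\<mu>\<bar>}"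
      have "?A \<subseteq> {\<rho> \<in> parts n. v * ?\<mu> + v * \<epsilon> * ?N \<le> v * ?\<phi> \<rho>} \<union>
          {\<rho> \<in> parts n. - v * ?\<mu> + v * \<epsilon> * ?N \<le> - v * ?\<phi> \<rho>}"
      proof
        fix \<rho> assume \<rho>: "\<rho> \<in> ?A"
        then consider "\<epsilon> * ?N \<le> ?\<phi> \<rho> - ?\<mu>" | "\<epsilon> * ?N \<le> ?\<mu> - ?\<phi> \<rho>" by force
        then show "\<rho> \<in> {\<rho> \<in> parts n. v * ?\<mu> + v * \<epsilon> * ?N \<le> v * ?\<phi> \<rho>} \<union>
          {\<rho> \<in> parts n. - v * ?\<mu> + v * \<epsilon> * ?N \<le> - v * ?\<phi> \<rho>}"
        proof cases
          case 1
          then have "v * (\<epsilon> * ?N) \<le> v * (?\<phi> \<rho> - ?\<mu>)" using v by (intro mult_left_mono) auto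
          then show ?thesis using \<rho> by (simp add: algebra_simps)
        next
          case 2
          then have "v * (\<epsilon> * ?N) \<le> v * (?\<mu> - ?\<phi> \<rho>)" using v by (intro mult_left_mono) auto
          then show ?thesis using \<rho> by (simp add: algebra_simps)
        qed
      qed
      then have "card ?A \<le> card ({\<rho> \<in> parts n. v * ?\<mu> + v * \<epsilon> * ?N \<le> v * ?\<phi> \<rho>} \<union>
          {\<rho> \<in> parts n. - v * ?\<mu> + v * \<epsilon> * ?N \<le> - v * ?\<phi> \<rho>})"
        using finite_parts by (intro card_mono) auto
      also have "\<dots> \<le> card {\<rho> \<in> parts n. v * ?\<mu> + v * \<epsilon> * ?N \<le> v * ?\<phi> \<rho>} +
          card {\<rho> \<in> parts n. - v * ?\<mu> + v * \<epsilon> * ?N \<le> - v * ?\<phi> \<rho>}"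
        by (rule card_Un_le)
      finally have "real (card ?A) \<le> ?r * exp (v - 4 * \<kappa> * ?N) + ?r * exp (v - 4 * \<kappa> * ?N)"
        using tail[of v] tail[of "- v"] v(1) by linarith
      also have "\<dots> = ?r * exp (ln 2 + v - 4 * \<kappa> * ?N)" by (simp add: exp_add exp_diff)
      also have "\<dots> \<le> ?r * exp (- (\<kappa> * ?N))"
      proof -
        have "0 \<le> \<kappa> * ?N" using pos by simp
        with elim(2) show ?thesis by (intro mult_left_mono) auto
      qed
      finally show "real (card ?A) \<le> exp (- (\<kappa> * ?N)) * ?r" by (simp add: mult.commute)
    qed
  qed
  with pos(2) show thesis by (rule that)
qed

end

section \<open>Growth of the dimension polynomial\<close>

definition num_roots :: "nat \<Rightarrow> nat" where
  "num_roots r = r * (r + 1) div 2"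

lemma num_roots_pos: "r \<ge> 1 \<Longrightarrow> num_roots r > 0"
  by (cases r) (auto simp: num_roots_def)

lemma two_num_roots: "2 * real (num_roots r) = real r * (real r + 1)"
proof -
  have "even (r * (r + 1))" by simp
  then have "2 * num_roots r = r * (r + 1)" unfolding num_roots_def by (rule dvd_mult_div_cancel)
  then show ?thesis by (metis of_nat_mult of_nat_numeral of_nat_add of_nat_1)
qed

definition superfact :: "nat \<Rightarrow> real" where
  "superfact r = (\<Prod>i=1..r. fact i)"

lemma superfact_pos: "superfact r > 0"
  unfolding superfact_def by (rule prod_pos) auto

lemma root_sum_mono:
  fixes y z :: "nat \<Rightarrow> real"
  assumes "\<And>j. j \<in> {1..r} \<Longrightarrow> y j \<le> z j" "l \<in> {1..r}" "j \<in> {l..r}"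
  shows "(\<Sum>i=l..j. y i) \<le> (\<Sum>i=l..j. z i)"
  using assms by (intro sum_mono) auto

lemma root_sum_nonneg:
  fixes y :: "nat \<Rightarrow> real"
  assumes "\<And>j. j \<in> {1..r} \<Longrightarrow> 0 \<le> y j" "l \<in> {1..r}" "j \<in> {l..r}"
  shows "0 \<le> (\<Sum>i=l..j. y i)"
  using assms by (intro sum_nonneg) auto

lemma dim_poly_mono:
  assumes "\<And>j. j \<in> {1..r} \<Longrightarrow> 0 \<le> y j" "\<And>j. j \<in> {1..r} \<Longrightarrow> y j \<le> z j"
  shows "dim_poly r y \<le> dim_poly r z"
  unfolding dim_poly_def superfact_def[symmetric]
  using superfact_pos[of r] assms
  by (intro divide_right_mono prod_mono conjI prod_nonneg root_sum_mono[of r] root_sum_nonneg[of r]) auto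

lemma dim_poly_cong:
  assumes "\<And>j. j \<in> {1..r} \<Longrightarrow> y j = z j"
  shows "dim_poly r y = dim_poly r z"
  unfolding dim_poly_def
  by (intro arg_cong2[where f = "(/)"] prod.cong sum.cong refl assms) auto

lemma sum_row_lengths: "(\<Sum>l=1..r. Suc r - l) = num_roots r"
proof -
  have "(\<Sum>l=1..r. Suc r - l) = (\<Sum>i=1..r. i)"
    by (rule sum.reindex_bij_witness[where i = "\<lambda>i. Suc r - i" and j = "\<lambda>i. Suc r - i"]) auto
  also have "\<dots> = num_roots r"
    using gauss_sum_from_Suc_0[where ?'a = nat] by (simp add: num_roots_def)
  finally show ?thesis .
qed

lemma dim_poly_scale: "dim_poly r (\<lambda>j. s * y j) = s ^ num_roots r * dim_poly r y"
proof -
  have "(\<Prod>l=1..r. \<Prod>j=l..r. \<Sum>i=l..j. s * y i) = (\<Prod>l=1..r. s ^ (Suc r - l) * (\<Prod>j=l..r. \<Sum>i=l..j. y i))"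
    by (intro prod.cong refl) (simp add: prod.distrib flip: sum_distrib_left)
  also have "\<dots> = s ^ num_roots r * (\<Prod>l=1..r. \<Prod>j=l..r. \<Sum>i=l..j. y i)"
    by (simp only: prod.distrib power_sum[symmetric] sum_row_lengths)
  finally show ?thesis by (simp add: dim_poly_def)
qed

lemma dim_poly_one: "dim_poly r (\<lambda>_. 1) = 1"
proof -
  have "dim_poly r (\<lambda>_. 1) = irrep_dim r (\<lambda>j\<in>{1..r}. 1)"
    unfolding irrep_dim_def by (intro dim_poly_cong) simp
  then show ?thesis using irrep_dim_trivial[of r] by (simp only:)
qed

lemma dim_poly_const: "dim_poly r (\<lambda>_. s) = s ^ num_roots r"
  using dim_poly_scale[of r s "\<lambda>_. 1"] dim_poly_one by simp

text \<open>
  Each factor satisfies \<open>(y\<^sub>l + ... + y\<^sub>j)\<^sup>2 \<ge> y\<^sub>l y\<^sub>j\<close>. In the product of the right-hand sides the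
  variable \<open>y\<^sub>i\<close> occurs \<open>r + 1 - i\<close> times as a left end and \<open>i\<close> times as a right end of an interval.
\<close>

lemma dim_poly_sq_ge:
  assumes "\<And>j. j \<in> {1..r} \<Longrightarrow> 0 \<le> y j"
  shows "(\<Prod>j=1..r. y j) ^ (r + 1) \<le> (superfact r * dim_poly r y)\<^sup>2"
proof -
  have "(\<Prod>j=1..r. y j) ^ (r + 1) = (\<Prod>l=1..r. y l ^ (Suc r - l)) * (\<Prod>j=1..r. y j ^ j)"
    unfolding prod_power_distrib prod.distrib[symmetric] by (intro prod.cong) (simp_all flip: power_add power_Suc)
  also have "(\<Prod>l=1..r. y l ^ (Suc r - l)) = (\<Prod>l=1..r. \<Prod>j=l..r. y l)" by simp
  also have "(\<Prod>j=1..r. y j ^ j) = (\<Prod>j=1..r. \<Prod>l\<in>{l \<in> {1..r}. l \<le> j}. y j)"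
  proof (intro prod.cong refl)
    fix j assume "j \<in> {1..r}"
    then have "{l \<in> {1..r}. l \<le> j} = {1..j}" by auto
    then show "y j ^ j = (\<Prod>l\<in>{l \<in> {1..r}. l \<le> j}. y j)" by simp
  qed
  also have "\<dots> = (\<Prod>l=1..r. \<Prod>j\<in>{j \<in> {1..r}. l \<le> j}. y j)"
    by (rule prod.swap_restrict) auto
  also have "\<dots> = (\<Prod>l=1..r. \<Prod>j=l..r. y j)"
    by (intro prod.cong) auto
  also have "(\<Prod>l=1..r. \<Prod>j=l..r. y l) * (\<Prod>l=1..r. \<Prod>j=l..r. y j) = (\<Prod>l=1..r. \<Prod>j=l..r. y l * y j)"
    by (simp only: prod.distrib)
  also have "\<dots> \<le> (\<Prod>l=1..r. \<Prod>j=l..r. (\<Sum>i=l..j. y i)\<^sup>2)"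
  proof (intro prod_mono conjI prod_nonneg)
    fix l j assume lj: "l \<in> {1..r}" "j \<in> {l..r}"
    then show "0 \<le> y l * y j" using assms by auto
    have "y l \<le> (\<Sum>i=l..j. y i)" "y j \<le> (\<Sum>i=l..j. y i)"
      using lj assms by (auto intro!: member_le_sum)
    then show "y l * y j \<le> (\<Sum>i=l..j. y i)\<^sup>2"
      unfolding power2_eq_square using assms lj by (intro mult_mono root_sum_nonneg[of r]) auto
  qed (use assms in auto)
  also have "\<dots> = (superfact r * dim_poly r y)\<^sup>2"
    unfolding dim_poly_def superfact_def[symmetric]
    using superfact_pos[of r] by (simp add: prod_power_distrib)
  finally show ?thesis .
qed

text \<open>
  Only the factor of the highest root, the sum of all coordinates, is kept; every other factor is at
  least \<open>\<eta>\<close>.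
\<close>

lemma dim_poly_ge_sum:
  assumes "r \<ge> 1" "\<eta> > 0" "\<And>j. j \<in> {1..r} \<Longrightarrow> \<eta> \<le> y j"
  shows "\<eta> ^ (num_roots r - 1) / superfact r * (\<Sum>j=1..r. y j) \<le> dim_poly r y"
proof -
  let ?P = "Sigma {1..r} (\<lambda>l. {l..r})" and ?F = "\<lambda>(l, j). \<Sum>i=l..j. y i"
  have y0: "0 \<le> y j" if "j \<in> {1..r}" for j using assms(2) assms(3)[OF that] by simp
  have P: "finite ?P" "(1, r) \<in> ?P" using assms(1) by auto
  have "card ?P = num_roots r" unfolding sum_row_lengths[symmetric] by (subst card_SigmaI) auto
  then have cardP: "card (?P - {(1, r)}) = num_roots r - 1" using P by simp
  have "\<eta> ^ (num_roots r - 1) = (\<Prod>lj\<in>?P - {(1, r)}. \<eta>)" using cardP by simp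
  also have "\<dots> \<le> (\<Prod>lj\<in>?P - {(1, r)}. ?F lj)"
  proof (intro prod_mono conjI)
    fix lj assume "lj \<in> ?P - {(1, r)}"
    then obtain l j where lj: "lj = (l, j)" "l \<in> {1..r}" "j \<in> {l..r}" by auto
    have "y l \<le> (\<Sum>i=l..j. y i)" using lj y0 by (auto intro!: member_le_sum)
    then show "\<eta> \<le> ?F lj" using assms(3)[of l] lj by simp
  qed (use assms in auto)
  finally have "?F (1, r) * \<eta> ^ (num_roots r - 1) \<le> ?F (1, r) * (\<Prod>lj\<in>?P - {(1, r)}. ?F lj)"
    using y0 by (intro mult_left_mono) (auto intro!: sum_nonneg)
  also have "\<dots> = (\<Prod>lj\<in>?P. ?F lj)" using prod.remove[OF P, of ?F] by simp
  also have "\<dots> = (\<Prod>l=1..r. \<Prod>j=l..r. \<Sum>i=l..j. y i)"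
    by (rule prod.Sigma[symmetric]) auto
  finally have "?F (1, r) * \<eta> ^ (num_roots r - 1) / superfact r \<le> dim_poly r y"
    unfolding dim_poly_def superfact_def[symmetric]
    using superfact_pos[of r] by (intro divide_right_mono) auto
  then show ?thesis by (simp add: mult.commute)
qed

lemma irrep_labelsD: "k \<in> irrep_labels r \<Longrightarrow> j \<in> {1..r} \<Longrightarrow> 1 \<le> k j"
  by (auto simp: irrep_labels_def PiE_iff)

lemma irrep_dim_ge_1:
  assumes "k \<in> irrep_labels r"
  shows "irrep_dim r k \<ge> 1"
proof -
  have "dim_poly r (\<lambda>_. 1) \<le> irrep_dim r k"
    unfolding irrep_dim_def using irrep_labelsD[OF assms] by (intro dim_poly_mono) auto
  then show ?thesis by (simp only: dim_poly_one)
qed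

lemma finite_irrep_dim_le:
  assumes "r \<ge> 1"
  shows "finite {k \<in> irrep_labels r. irrep_dim r k \<le> X}"
proof (rule finite_subset)
  let ?M = "nat \<lfloor>superfact r * X\<rfloor>"
  show "{k \<in> irrep_labels r. irrep_dim r k \<le> X} \<subseteq> {1..r} \<rightarrow>\<^sub>E {..?M}"
  proof
    fix k assume k: "k \<in> {k \<in> irrep_labels r. irrep_dim r k \<le> X}"
    have "k j \<le> ?M" if j: "j \<in> {1..r}" for j
    proof -
      have "real (k j) \<le> (\<Sum>j=1..r. real (k j))" using j by (intro member_le_sum) auto
      also have "\<dots> \<le> superfact r * irrep_dim r k"
        using dim_poly_ge_sum[OF assms, of 1 "\<lambda>j. real (k j)"] irrep_labelsD[of k r] k superfact_pos[of r]
        by (simp add: irrep_dim_def field_simps Suc_le_eq)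
      also have "\<dots> \<le> superfact r * X" using k superfact_pos[of r] by (intro mult_left_mono) auto
      finally show ?thesis by (simp add: le_nat_floor)
    qed
    then show "k \<in> {1..r} \<rightarrow>\<^sub>E {..?M}" using k by (auto simp: irrep_labels_def PiE_iff)
  qed
qed (intro finite_PiE finite_atLeastAtMost finite_atMost)

text \<open>
  All labels in a cube of side \<open>X powr (1 / num_roots r)\<close> have dimension at most \<open>X\<close>, by homogeneity.
\<close>

lemma card_irrep_dim_le_ge:
  assumes "r \<ge> 1" "X \<ge> 1"
  shows "1 / 2 ^ r * X powr (2 / (real r + 1)) \<le> real (card {k \<in> irrep_labels r. irrep_dim r k \<le> X})"
proof -
  have R: "num_roots r > 0" by (rule num_roots_pos[OF assms(1)])
  define x where "x = X powr (1 / real (num_roots r))"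
  define M where "M = nat \<lfloor>x\<rfloor>"
  have x: "x \<ge> 1" "x ^ num_roots r = X"
    using assms R by (auto simp: x_def ge_one_powr_ge_zero powr_powr simp flip: powr_realpow)
  have M: "real M \<le> x" "x / 2 \<le> real M"
  proof -
    have "real M = of_int \<lfloor>x\<rfloor>" "1 \<le> \<lfloor>x\<rfloor>" using x by (auto simp: M_def)
    then show "real M \<le> x" "x / 2 \<le> real M" by linarith+
  qed
  have "X powr (2 / (real r + 1)) = x ^ r"
  proof -
    have "2 / (real r + 1) = 1 / real (num_roots r) * real r"
      using R two_num_roots[of r] by (simp add: field_simps)
    then have "X powr (2 / (real r + 1)) = x powr real r" unfolding x_def powr_powr by simp
    also have "\<dots> = x ^ r" using x by (intro powr_realpow) simp
    finally show ?thesis .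
  qed
  then have "1 / 2 ^ r * X powr (2 / (real r + 1)) = (x / 2) ^ r" by (simp add: power_divide)
  also have "\<dots> \<le> real M ^ r" using M x by (intro power_mono) auto
  also have "\<dots> = real (card ({1..r} \<rightarrow>\<^sub>E {1..M}))" by (simp add: card_PiE)
  also have "\<dots> \<le> real (card {k \<in> irrep_labels r. irrep_dim r k \<le> X})"
  proof (intro of_nat_mono card_mono finite_irrep_dim_le assms subsetI)
    fix k assume k: "k \<in> {1..r} \<rightarrow>\<^sub>E {1..M}"
    have "irrep_dim r k \<le> dim_poly r (\<lambda>_. real M)"
      unfolding irrep_dim_def using k by (intro dim_poly_mono) (auto simp: PiE_iff)
    also have "\<dots> \<le> X" unfolding dim_poly_const using M x(2) power_mono[of "real M" x "num_roots r"] by simp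
    finally show "k \<in> {k \<in> irrep_labels r. irrep_dim r k \<le> X}"
      using k by (auto simp: irrep_labels_def PiE_iff)
  qed
  finally show ?thesis .
qed

text \<open>
  The bound \<open>dim_poly_sq_ge\<close> dominates the series by the \<open>r\<close>-th power of the Riemann zeta function
  at \<open>3 / 2\<close>.
\<close>

lemma witten_zeta_summable:
  "(\<lambda>k. irrep_dim r k powr - (3 / (real r + 1))) summable_on irrep_labels r"
proof -
  have "(\<lambda>n. real n powr - (3 / 2)) summable_on UNIV"
    by (intro summable_nonneg_imp_summable_on) (simp_all add: summable_real_powr_iff)
  then have "(\<lambda>n. real n powr - (3 / 2)) summable_on {1..}"
    by (rule summable_on_subset_banach) simp
  then have "Infinite_Set_Sum.abs_summable_on (\<lambda>n. real n powr - (3 / 2)) {1..}"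
    by (simp flip: abs_summable_equivalent)
  then have "Infinite_Set_Sum.abs_summable_on
      (\<lambda>k. \<Prod>j\<in>{1..r}. real (k j) powr - (3 / 2)) ({1..r} \<rightarrow>\<^sub>E {1..})"
    by (intro abs_summable_on_prod_PiE) auto
  then have "(\<lambda>k. norm (\<Prod>j\<in>{1..r}. real (k j) powr - (3 / 2))) summable_on irrep_labels r"
    unfolding irrep_labels_def by (simp flip: abs_summable_equivalent)
  then have sum: "(\<lambda>k. superfact r powr (3 / (real r + 1)) *
      (\<Prod>j\<in>{1..r}. real (k j) powr - (3 / 2))) summable_on irrep_labels r"
    by (intro summable_on_cmult_right) (simp add: abs_prod)
  show ?thesis
  proof (rule summable_on_comparison_test[OF sum])
    fix k assume k: "k \<in> irrep_labels r"
    let ?p = "\<Prod>j\<in>{1..r}. real (k j)" and ?a = "irrep_dim r k"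
    have a: "?a > 0" using irrep_dim_ge_1[OF k] by simp
    have p: "?p > 0" using irrep_labelsD[OF k] by (intro prod_pos) (auto simp: Suc_le_eq)
    have "?p ^ (r + 1) \<le> (superfact r * ?a)\<^sup>2"
      unfolding irrep_dim_def by (rule dim_poly_sq_ge) simp
    then have "((superfact r * ?a)\<^sup>2) powr - (3 / 2 / (real r + 1)) \<le> (?p ^ (r + 1)) powr - (3 / 2 / (real r + 1))"
      using p by (intro powr_mono2') auto
    also have "(?p ^ (r + 1)) powr - (3 / 2 / (real r + 1)) = ?p powr - (3 / 2)"
    proof -
      have "real (r + 1) * - (3 / 2 / (real r + 1)) = - (3 / 2)" by (simp add: divide_simps)
      then show ?thesis unfolding powr_realpow[OF p, symmetric] powr_powr by (simp only:)
    qed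
    also have "?p powr - (3 / 2) = (\<Prod>j\<in>{1..r}. real (k j) powr - (3 / 2))"
      by (rule prod_powr_distrib)
    also have "((superfact r * ?a)\<^sup>2) powr - (3 / 2 / (real r + 1)) = (superfact r * ?a) powr - (3 / (real r + 1))"
    proof -
      have "superfact r * ?a > 0" using a superfact_pos by simp
      then have "((superfact r * ?a)\<^sup>2) powr - (3 / 2 / (real r + 1)) =
          (superfact r * ?a) powr (2 * - (3 / 2 / (real r + 1)))"
        by (simp only: powr_powr flip: powr_numeral)
      moreover have "2 * - (3 / 2 / x) = - (3 / x)" for x :: real by simp
      ultimately show ?thesis by metis
    qed
    also have "\<dots> = ?a powr - (3 / (real r + 1)) / superfact r powr (3 / (real r + 1))"
      by (simp only: powr_mult powr_minus_divide[of "superfact r"]) simp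
    finally show "?a powr - (3 / (real r + 1)) \<le> superfact r powr (3 / (real r + 1)) *
        (\<Prod>j\<in>{1..r}. real (k j) powr - (3 / 2))"
      using superfact_pos[of r] by (simp only: pos_divide_le_eq powr_gt_zero) (simp add: mult.commute)
  qed simp
qed

section \<open>Regularity of the limit shape\<close>

abbreviation lebesgue_product :: "nat \<Rightarrow> (nat \<Rightarrow> real) measure" where
  "lebesgue_product r \<equiv> \<Pi>\<^sub>M j\<in>{1..r}. lborel"

definition corner :: "nat \<Rightarrow> (nat \<Rightarrow> real) \<Rightarrow> (nat \<Rightarrow> real) set" where
  "corner r t = (\<Pi>\<^sub>E j\<in>{1..r}. {t j..})"

definition occupation :: "nat \<Rightarrow> (nat \<Rightarrow> real) \<Rightarrow> real" where
  "occupation r y = bose (dim_poly r y)"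

text \<open>
  The integral that defines \<open>limit_shape\<close>, with values in the extended nonnegative reals so that
  regions can be split and compared before integrability is known.
\<close>

definition corner_mass :: "nat \<Rightarrow> (nat \<Rightarrow> real) \<Rightarrow> ennreal" where
  "corner_mass r t = (\<integral>\<^sup>+y. ennreal (occupation r y) * indicator (corner r t) y \<partial>lebesgue_product r)"

lemma dim_poly_measurable [measurable]: "dim_poly r \<in> borel_measurable (lebesgue_product r)"
proof -
  have coord: "(\<lambda>y. y i) \<in> borel_measurable (lebesgue_product r)" if "i \<in> {1..r}" for i
    using measurable_component_singleton[OF that, of "\<lambda>_. lborel :: real measure"] by simp
  have "(\<lambda>y. \<Sum>i=l..j. y i) \<in> borel_measurable (lebesgue_product r)"
    if "l \<in> {1..r}" "j \<in> {l..r}" for l j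
    using that by (intro borel_measurable_sum coord) simp
  then have "(\<lambda>y. \<Prod>l=1..r. \<Prod>j=l..r. \<Sum>i=l..j. y i) \<in> borel_measurable (lebesgue_product r)"
    by (intro borel_measurable_prod)
  then show ?thesis
    unfolding dim_poly_def by (intro borel_measurable_divide borel_measurable_const)
qed

lemma occupation_measurable [measurable]: "occupation r \<in> borel_measurable (lebesgue_product r)"
proof -
  have "bose \<in> borel_measurable borel" unfolding bose_def by measurable
  from measurable_compose[OF dim_poly_measurable this] show ?thesis
    by (simp add: occupation_def[abs_def])
qed

lemma corner_sets [measurable]: "corner r t \<in> sets (lebesgue_product r)"
  unfolding corner_def by (intro sets_PiM_I_finite) auto

lemma dim_poly_pos:
  assumes "\<And>j. j \<in> {1..r} \<Longrightarrow> 0 < y j"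
  shows "0 < dim_poly r y"
  unfolding dim_poly_def superfact_def[symmetric] using superfact_pos[of r] assms
  by (intro divide_pos_pos prod_pos) (auto intro!: sum_pos)

lemma occupation_antimono:
  assumes "\<And>j. j \<in> {1..r} \<Longrightarrow> 0 < y j" "\<And>j. j \<in> {1..r} \<Longrightarrow> y j \<le> z j"
  shows "occupation r z \<le> occupation r y"
  unfolding occupation_def using assms
  by (intro bose_antimono dim_poly_pos dim_poly_mono) (auto intro: less_imp_le)

definition decay_rate :: "nat \<Rightarrow> real \<Rightarrow> real" where
  "decay_rate r \<eta> = \<eta> ^ (num_roots r - 1) / superfact r"

definition decay_const :: "nat \<Rightarrow> real \<Rightarrow> real" where
  "decay_const r \<eta> = 1 / (1 - exp (- (\<eta> ^ num_roots r)))"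

lemma decay_rate_pos: "\<eta> > 0 \<Longrightarrow> decay_rate r \<eta> > 0"
  using superfact_pos[of r] by (simp add: decay_rate_def)

lemma decay_const_pos: "\<eta> > 0 \<Longrightarrow> decay_const r \<eta> > 0"
  by (simp add: decay_const_def)

lemma occupation_nonneg:
  assumes "\<And>j. j \<in> {1..r} \<Longrightarrow> 0 < y j"
  shows "0 \<le> occupation r y"
  unfolding occupation_def using assms by (intro less_imp_le bose_pos dim_poly_pos)

text \<open>
  Away from the coordinate hyperplanes \<open>occupation\<close> is dominated by a product of exponentials, so
  integrals over slabs split into one-dimensional ones.
\<close>

lemma occupation_decay:
  assumes "r \<ge> 1" "\<eta> > 0" "\<And>j. j \<in> {1..r} \<Longrightarrow> \<eta> \<le> y j"
  shows "occupation r y \<le> decay_const r \<eta> * (\<Prod>j\<in>{1..r}. exp (- decay_rate r \<eta> * y j))"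
proof -
  let ?a = "dim_poly r y"
  have b: "\<eta> ^ num_roots r \<le> ?a"
    unfolding dim_poly_const[symmetric] using assms by (intro dim_poly_mono) auto
  have b0: "0 < \<eta> ^ num_roots r" using assms by simp
  have "occupation r y = exp (- ?a) / (1 - exp (- ?a))" by (simp add: occupation_def bose_altdef)
  also have "\<dots> \<le> exp (- ?a) / (1 - exp (- (\<eta> ^ num_roots r)))"
    using b b0 by (intro divide_left_mono mult_pos_pos) auto
  also have "\<dots> = decay_const r \<eta> * exp (- ?a)" by (simp add: decay_const_def)
  also have "\<dots> \<le> decay_const r \<eta> * exp (- decay_rate r \<eta> * (\<Sum>j=1..r. y j))"
    using dim_poly_ge_sum[OF assms] decay_const_pos[of \<eta> r] assms
    by (intro mult_left_mono) (auto simp: decay_rate_def)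
  also have "exp (- decay_rate r \<eta> * (\<Sum>j=1..r. y j)) = (\<Prod>j\<in>{1..r}. exp (- decay_rate r \<eta> * y j))"
    by (simp only: sum_distrib_left exp_sum finite_atLeastAtMost)
  finally show ?thesis .
qed

lemma nn_integral_exp_atLeast:
  assumes "\<kappa> > 0"
  shows "(\<integral>\<^sup>+x. ennreal (exp (- \<kappa> * x)) * indicator {t..} x \<partial>lborel) = ennreal (exp (- \<kappa> * t) / \<kappa>)"
proof -
  have "(\<integral>\<^sup>+x. ennreal (exp (- \<kappa> * x)) * indicator {t..} x \<partial>lborel) = ennreal (0 - (- exp (- \<kappa> * t) / \<kappa>))"
  proof (rule nn_integral_FTC_atLeast)
    show "((\<lambda>x. - exp (- \<kappa> * x) / \<kappa>) has_real_derivative exp (- \<kappa> * x)) (at x)" for x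
      using assms by (auto intro!: derivative_eq_intros)
    show "((\<lambda>x. - exp (- \<kappa> * x) / \<kappa>) \<longlongrightarrow> 0) at_top"
      using assms by real_asymp
  qed auto
  then show ?thesis by simp
qed

text \<open>
  The coordinates other than \<open>j0\<close> are integrated out, each contributing at most \<open>1 / decay_rate r \<eta>\<close>.
\<close>

lemma slab_mass_le:
  assumes "r \<ge> 1" "\<eta> > 0" "j0 \<in> {1..r}" and [measurable]: "B \<in> sets borel"
  shows "(\<integral>\<^sup>+y. ennreal (occupation r y) * (indicator (corner r (\<lambda>_. \<eta>)) y * indicator B (y j0)) \<partial>lebesgue_product r)
    \<le> ennreal (decay_const r \<eta> * (1 / decay_rate r \<eta>) ^ (r - 1)) *
       (\<integral>\<^sup>+x. ennreal (exp (- decay_rate r \<eta> * x)) * (indicator {\<eta>..} x * indicator B x) \<partial>lborel)"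
proof -
  interpret product_sigma_finite "\<lambda>_. lborel :: real measure" ..
  let ?\<kappa> = "decay_rate r \<eta>" and ?C = "decay_const r \<eta>"
  have \<kappa>: "?\<kappa> > 0" and C: "?C > 0" using assms decay_rate_pos decay_const_pos by auto
  define g :: "nat \<Rightarrow> real \<Rightarrow> ennreal" where
    "g j x = ennreal (exp (- ?\<kappa> * x)) * (indicator {\<eta>..} x * (if j = j0 then indicator B x else 1))" for j x
  have g_meas [measurable]: "g j \<in> borel_measurable lborel" for j
    unfolding g_def by (cases "j = j0") auto
  have "(\<integral>\<^sup>+y. ennreal (occupation r y) * (indicator (corner r (\<lambda>_. \<eta>)) y * indicator B (y j0)) \<partial>lebesgue_product r)
      \<le> (\<integral>\<^sup>+y. ennreal ?C * (\<Prod>j\<in>{1..r}. g j (y j)) \<partial>lebesgue_product r)"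
  proof (intro nn_integral_mono)
    fix y
    show "ennreal (occupation r y) * (indicator (corner r (\<lambda>_. \<eta>)) y * indicator B (y j0)) \<le>
        ennreal ?C * (\<Prod>j\<in>{1..r}. g j (y j))"
    proof (cases "y \<in> corner r (\<lambda>_. \<eta>) \<and> y j0 \<in> B")
      case True
      then have y: "\<eta> \<le> y j" if "j \<in> {1..r}" for j using that by (auto simp: corner_def PiE_iff)
      have "(\<Prod>j\<in>{1..r}. g j (y j)) = (\<Prod>j\<in>{1..r}. ennreal (exp (- ?\<kappa> * y j)))"
        using True y by (intro prod.cong) (auto simp: g_def)
      also have "\<dots> = ennreal (\<Prod>j\<in>{1..r}. exp (- ?\<kappa> * y j))" by (rule prod_ennreal) simp
      finally show ?thesis
        using True occupation_decay[OF assms(1,2) y] C by (simp add: ennreal_mult'[symmetric] ennreal_leI)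
    qed auto
  qed
  also have "\<dots> = ennreal ?C * (\<integral>\<^sup>+y. (\<Prod>j\<in>{1..r}. g j (y j)) \<partial>lebesgue_product r)"
    by (rule nn_integral_cmult) measurable
  also have "(\<integral>\<^sup>+y. (\<Prod>j\<in>{1..r}. g j (y j)) \<partial>lebesgue_product r) = (\<Prod>j\<in>{1..r}. \<integral>\<^sup>+x. g j x \<partial>lborel)"
    by (rule product_nn_integral_prod) auto
  also have "\<dots> = (\<integral>\<^sup>+x. g j0 x \<partial>lborel) * (\<Prod>j\<in>{1..r} - {j0}. \<integral>\<^sup>+x. g j x \<partial>lborel)"
    using assms(3) by (intro prod.remove) auto
  also have "(\<Prod>j\<in>{1..r} - {j0}. \<integral>\<^sup>+x. g j x \<partial>lborel) = (\<Prod>j\<in>{1..r} - {j0}. ennreal (exp (- ?\<kappa> * \<eta>) / ?\<kappa>))"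
    unfolding g_def using nn_integral_exp_atLeast[OF \<kappa>, of \<eta>] by (intro prod.cong) auto
  also have "\<dots> = ennreal ((exp (- ?\<kappa> * \<eta>) / ?\<kappa>) ^ (r - 1))"
    using assms(3) \<kappa> by (simp add: ennreal_power)
  also have "\<dots> \<le> ennreal ((1 / ?\<kappa>) ^ (r - 1))"
    using \<kappa> assms(2) by (intro ennreal_leI power_mono divide_right_mono) auto
  also have "ennreal ?C * ((\<integral>\<^sup>+x. g j0 x \<partial>lborel) * ennreal ((1 / ?\<kappa>) ^ (r - 1))) =
      ennreal (?C * (1 / ?\<kappa>) ^ (r - 1)) * (\<integral>\<^sup>+x. g j0 x \<partial>lborel)"
    using C \<kappa> by (subst ennreal_mult) (auto simp: mult_ac)
  finally show ?thesis by (simp add: g_def mult_left_mono)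
qed

lemma corner_memD: "y \<in> corner r t \<Longrightarrow> j \<in> {1..r} \<Longrightarrow> t j \<le> y j"
  by (auto simp: corner_def PiE_iff)

lemma corner_antimono:
  assumes "\<And>j. j \<in> {1..r} \<Longrightarrow> t j \<le> t' j"
  shows "corner r t' \<subseteq> corner r t"
  unfolding corner_def using assms by (intro PiE_mono) auto

lemma corner_mass_antimono:
  assumes "\<And>j. j \<in> {1..r} \<Longrightarrow> t j \<le> t' j"
  shows "corner_mass r t' \<le> corner_mass r t"
  unfolding corner_mass_def using corner_antimono[of r t t'] assms
  by (intro nn_integral_mono mult_left_mono) (auto simp: indicator_def)

lemma corner_mass_finite:
  assumes "r \<ge> 1" "\<eta> > 0" "\<And>j. j \<in> {1..r} \<Longrightarrow> \<eta> \<le> t j"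
  shows "corner_mass r t < \<infinity>"
proof -
  have "corner_mass r t \<le> corner_mass r (\<lambda>_. \<eta>)"
    using assms by (intro corner_mass_antimono)
  also have "\<dots> \<le> ennreal (decay_const r \<eta> * (1 / decay_rate r \<eta>) ^ (r - 1)) *
       (\<integral>\<^sup>+x. ennreal (exp (- decay_rate r \<eta> * x)) * indicator {\<eta>..} x \<partial>lborel)"
    using slab_mass_le[OF assms(1,2), of 1 UNIV] assms(1) by (simp add: corner_mass_def)
  also have "\<dots> < \<infinity>"
    using decay_rate_pos[OF assms(2)] by (subst nn_integral_exp_atLeast) (auto simp: ennreal_mult_less_top)
  finally show ?thesis .
qed

lemma corner_mass_eq_limit_shape:
  assumes "r \<ge> 1" "\<eta> > 0" "\<And>j. j \<in> {1..r} \<Longrightarrow> \<eta> \<le> t j"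
  shows "corner_mass r t = ennreal (limit_shape r t)"
proof -
  have dens: "0 \<le> occupation r y" if "y \<in> corner r t" for y
    using assms corner_memD[OF that] by (intro occupation_nonneg) fastforce
  have "limit_shape r t = (\<integral>y. indicator (corner r t) y * occupation r y \<partial>lebesgue_product r)"
    by (simp add: limit_shape_def set_lebesgue_integral_def corner_def occupation_def bose_altdef)
  also have "\<dots> = enn2real (\<integral>\<^sup>+y. ennreal (indicator (corner r t) y * occupation r y) \<partial>lebesgue_product r)"
  proof (rule integral_eq_nn_integral)
    show "(\<lambda>y. indicator (corner r t) y * occupation r y) \<in> borel_measurable (lebesgue_product r)"
      by measurable
  qed (use dens in \<open>auto intro!: AE_I2 simp: indicator_def\<close>)
  also have "(\<integral>\<^sup>+y. ennreal (indicator (corner r t) y * occupation r y) \<partial>lebesgue_product r) = corner_mass r t"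
    unfolding corner_mass_def by (intro nn_integral_cong) (auto simp: indicator_def)
  finally show ?thesis using corner_mass_finite[OF assms] by simp
qed

lemma limit_shape_nonneg:
  assumes "r \<ge> 1" "\<eta> > 0" "\<And>j. j \<in> {1..r} \<Longrightarrow> \<eta> \<le> t j"
  shows "limit_shape r t \<ge> 0"
proof -
  have "0 \<le> occupation r y" if "y \<in> corner r t" for y
    using assms corner_memD[OF that] by (intro occupation_nonneg) fastforce
  moreover have "limit_shape r t = (\<integral>y. indicator (corner r t) y * occupation r y \<partial>lebesgue_product r)"
    by (simp add: limit_shape_def set_lebesgue_integral_def corner_def occupation_def bose_altdef)
  ultimately show ?thesis by (auto intro!: integral_nonneg_AE AE_I2 simp: indicator_def)
qed

definition slab_const :: "nat \<Rightarrow> real \<Rightarrow> real" where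
  "slab_const r \<eta> = decay_const r \<eta> * (1 / decay_rate r \<eta>) ^ (r - 1)"

lemma slab_const_pos: "\<eta> > 0 \<Longrightarrow> slab_const r \<eta> > 0"
  using decay_rate_pos[of \<eta> r] decay_const_pos[of \<eta> r] by (simp add: slab_const_def)

lemma slab_tail_le:
  assumes "r \<ge> 1" "\<eta> > 0" "j0 \<in> {1..r}" "B \<in> sets borel" "B \<subseteq> {T..}"
    and h: "exp (- decay_rate r \<eta> * T) / decay_rate r \<eta> \<le> h"
  shows "(\<integral>\<^sup>+y. ennreal (occupation r y) * (indicator (corner r (\<lambda>_. \<eta>)) y * indicator B (y j0)) \<partial>lebesgue_product r)
    \<le> ennreal (slab_const r \<eta> * h)"
proof -
  let ?\<kappa> = "decay_rate r \<eta>"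
  have \<kappa>: "?\<kappa> > 0" using decay_rate_pos assms(2) by simp
  have h0: "0 \<le> h" using h \<kappa> by (meson divide_nonneg_pos exp_ge_zero order_trans)
  have "(\<integral>\<^sup>+x. ennreal (exp (- ?\<kappa> * x)) * (indicator {\<eta>..} x * indicator B x) \<partial>lborel) \<le>
      (\<integral>\<^sup>+x. ennreal (exp (- ?\<kappa> * x)) * indicator {T..} x \<partial>lborel)"
    using assms(5) by (intro nn_integral_mono mult_left_mono) (auto simp: indicator_def)
  also have "\<dots> \<le> ennreal h" unfolding nn_integral_exp_atLeast[OF \<kappa>] using h by (intro ennreal_leI)
  finally have "ennreal (slab_const r \<eta>) *
      (\<integral>\<^sup>+x. ennreal (exp (- ?\<kappa> * x)) * (indicator {\<eta>..} x * indicator B x) \<partial>lborel)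
    \<le> ennreal (slab_const r \<eta>) * ennreal h" by (rule mult_left_mono) simp
  also have "\<dots> = ennreal (slab_const r \<eta> * h)"
    using ennreal_mult[OF less_imp_le[OF slab_const_pos[OF assms(2)]] h0] by simp
  finally show ?thesis
    by (rule order_trans[OF slab_mass_le[OF assms(1-4), folded slab_const_def]])
qed

lemma slab_width_le:
  assumes "r \<ge> 1" "\<eta> > 0" "j0 \<in> {1..r}" "v - u \<le> h" "0 \<le> h"
  shows "(\<integral>\<^sup>+y. ennreal (occupation r y) * (indicator (corner r (\<lambda>_. \<eta>)) y * indicator {u..<v} (y j0)) \<partial>lebesgue_product r)
    \<le> ennreal (slab_const r \<eta> * h)"
proof -
  let ?\<kappa> = "decay_rate r \<eta>"
  have \<kappa>: "?\<kappa> > 0" using decay_rate_pos assms(2) by simp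
  have "(\<integral>\<^sup>+x. ennreal (exp (- ?\<kappa> * x)) * (indicator {\<eta>..} x * indicator {u..<v} x) \<partial>lborel) \<le>
      (\<integral>\<^sup>+x. indicator {u..<v} x \<partial>lborel)"
    using \<kappa> assms(2) by (intro nn_integral_mono) (auto simp: indicator_def ennreal_le_1)
  also have "\<dots> \<le> ennreal h" using assms(4,5) by (cases "u \<le> v") (auto intro: ennreal_leI)
  finally have "ennreal (slab_const r \<eta>) *
      (\<integral>\<^sup>+x. ennreal (exp (- ?\<kappa> * x)) * (indicator {\<eta>..} x * indicator {u..<v} x) \<partial>lborel)
    \<le> ennreal (slab_const r \<eta>) * ennreal h" by (rule mult_left_mono) simp
  also have "\<dots> = ennreal (slab_const r \<eta> * h)"
    using ennreal_mult[OF less_imp_le[OF slab_const_pos[OF assms(2)]] assms(5)] by simp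
  finally show ?thesis
    by (rule order_trans[OF slab_mass_le[OF assms(1-3), folded slab_const_def], rotated]) simp
qed

lemma limit_shape_tail_le:
  assumes "r \<ge> 1" "\<eta> > 0" "\<And>j. j \<in> {1..r} \<Longrightarrow> \<eta> \<le> t j"
    and "j0 \<in> {1..r}" "T \<le> t j0" "exp (- decay_rate r \<eta> * T) / decay_rate r \<eta> \<le> h"
  shows "limit_shape r t \<le> slab_const r \<eta> * h"
proof -
  have h0: "0 \<le> h" using assms(6) decay_rate_pos[OF assms(2), of r]
    by (meson divide_nonneg_pos exp_ge_zero order_trans)
  have "ennreal (limit_shape r t) = corner_mass r t"
    by (rule corner_mass_eq_limit_shape[OF assms(1-3), symmetric])
  also have "\<dots> \<le> (\<integral>\<^sup>+y. ennreal (occupation r y) * (indicator (corner r (\<lambda>_. \<eta>)) y * indicator {T..} (y j0)) \<partial>lebesgue_product r)"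
    unfolding corner_mass_def
  proof (intro nn_integral_mono mult_left_mono)
    fix y
    show "indicator (corner r t) y \<le> (indicator (corner r (\<lambda>_. \<eta>)) y * indicator {T..} (y j0) :: ennreal)"
      using corner_antimono[of r "\<lambda>_. \<eta>" t] assms(3-5) corner_memD[of y r t j0]
      by (auto simp: indicator_def)
  qed auto
  also have "\<dots> \<le> ennreal (slab_const r \<eta> * h)"
    by (rule slab_tail_le[OF assms(1,2,4) _ _ assms(6)]) auto
  finally show ?thesis using h0 slab_const_pos[OF assms(2), of r] by (simp add: ennreal_le_iff)
qed

text \<open>
  Two corners differ by \<open>r\<close> slabs, one for each coordinate. A slab is negligible if it is thin or if it
  lies far out; the second alternative is for points beyond the range of a finite grid.
\<close>

lemma limit_shape_diff_le:
  assumes "r \<ge> 1" "\<eta> > 0" "\<And>j. j \<in> {1..r} \<Longrightarrow> \<eta> \<le> t j" "\<And>j. j \<in> {1..r} \<Longrightarrow> t j \<le> t' j"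
    and "exp (- decay_rate r \<eta> * T) / decay_rate r \<eta> \<le> h"
    and "\<And>j. j \<in> {1..r} \<Longrightarrow> t' j - t j \<le> h \<or> T \<le> t j"
  shows "limit_shape r t \<le> limit_shape r t' + real r * (slab_const r \<eta> * h)"
proof -
  have h0: "0 \<le> h" using assms(5) decay_rate_pos[OF assms(2), of r]
    by (meson divide_nonneg_pos exp_ge_zero order_trans)
  have c0: "0 \<le> slab_const r \<eta> * h" using h0 slab_const_pos[OF assms(2), of r] by simp
  have t': "\<eta> \<le> t' j" if "j \<in> {1..r}" for j using assms(3,4)[OF that] by simp
  have [measurable]: "(\<lambda>y. indicator {t j..<t' j} (y j) :: ennreal) \<in> borel_measurable (lebesgue_product r)"
    if "j \<in> {1..r}" for j
  proof -
    have "(\<lambda>y. y j) \<in> measurable (lebesgue_product r) lborel"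
      using that by (rule measurable_component_singleton)
    then have "(\<lambda>y. y j) \<in> borel_measurable (lebesgue_product r)" by simp
    then show ?thesis by (rule measurable_compose) simp
  qed
  let ?slab = "\<lambda>j y. ennreal (occupation r y) * (indicator (corner r (\<lambda>_. \<eta>)) y * indicator {t j..<t' j} (y j))"
  have slab_meas: "?slab j \<in> borel_measurable (lebesgue_product r)" if "j \<in> {1..r}" for j
    using that by measurable
  have m1: "(\<lambda>y. ennreal (occupation r y) * indicator (corner r t') y) \<in> borel_measurable (lebesgue_product r)"
    by measurable
  have m2: "(\<lambda>y. \<Sum>j\<in>{1..r}. ?slab j y) \<in> borel_measurable (lebesgue_product r)"
    by (intro borel_measurable_sum slab_meas)
  have "ennreal (limit_shape r t) = corner_mass r t"
    by (rule corner_mass_eq_limit_shape[OF assms(1-3), symmetric])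
  also have "\<dots> \<le> (\<integral>\<^sup>+y. (ennreal (occupation r y) * indicator (corner r t') y + (\<Sum>j\<in>{1..r}. ?slab j y)) \<partial>lebesgue_product r)"
    unfolding corner_mass_def
  proof (intro nn_integral_mono)
    fix y
    show "ennreal (occupation r y) * indicator (corner r t) y \<le>
        ennreal (occupation r y) * indicator (corner r t') y + (\<Sum>j\<in>{1..r}. ?slab j y)"
    proof (cases "y \<in> corner r t \<and> y \<notin> corner r t'")
      case True
      then obtain j where j: "j \<in> {1..r}" "y j < t' j"
        by (auto simp: corner_def PiE_iff not_le)
      have "y \<in> corner r (\<lambda>_. \<eta>)" using True corner_antimono[of r "\<lambda>_. \<eta>" t] assms(3) by auto
      then have "ennreal (occupation r y) = ?slab j y"
        using j True corner_memD[of y r t j] by (auto simp: indicator_def)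
      also have "\<dots> \<le> (\<Sum>j\<in>{1..r}. ?slab j y)"
        using j by (intro member_le_sum) auto
      finally show ?thesis using True by simp
    qed (auto simp: indicator_def)
  qed
  also have "\<dots> = corner_mass r t' + (\<Sum>j\<in>{1..r}. \<integral>\<^sup>+y. ?slab j y \<partial>lebesgue_product r)"
    unfolding corner_mass_def
    unfolding nn_integral_add[OF m1 m2] by (subst nn_integral_sum[OF slab_meas]) auto
  also have "\<dots> \<le> ennreal (limit_shape r t') + ennreal (real r * (slab_const r \<eta> * h))"
  proof (rule add_mono)
    show "corner_mass r t' \<le> ennreal (limit_shape r t')"
      using corner_mass_eq_limit_shape[OF assms(1,2) t'] by simp
    have "(\<Sum>j\<in>{1..r}. \<integral>\<^sup>+y. ?slab j y \<partial>lebesgue_product r) \<le> (\<Sum>j\<in>{1..r}. ennreal (slab_const r \<eta> * h))"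
    proof (rule sum_mono)
      fix j assume j: "j \<in> {1..r}"
      show "(\<integral>\<^sup>+y. ?slab j y \<partial>lebesgue_product r) \<le> ennreal (slab_const r \<eta> * h)"
        using assms(6)[OF j]
      proof
        assume "t' j - t j \<le> h"
        then show ?thesis by (rule slab_width_le[OF assms(1,2) j _ h0])
      next
        assume "T \<le> t j"
        then show ?thesis by (intro slab_tail_le[OF assms(1,2) j _ _ assms(5)]) auto
      qed
    qed
    also have "\<dots> = ennreal (real r * (slab_const r \<eta> * h))"
      using c0 by (subst sum_ennreal) auto
    finally show "(\<Sum>j\<in>{1..r}. \<integral>\<^sup>+y. ?slab j y \<partial>lebesgue_product r) \<le>
        ennreal (real r * (slab_const r \<eta> * h))" .
  qed
  also have "\<dots> = ennreal (limit_shape r t' + real r * (slab_const r \<eta> * h))"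
    using c0 limit_shape_nonneg[OF assms(1,2) t'] by (intro ennreal_plus[symmetric]) auto
  finally show ?thesis
    using c0 limit_shape_nonneg[OF assms(1,2) t'] by (subst (asm) ennreal_le_iff) auto
qed

section \<open>Riemann sums\<close>

definition cell :: "nat \<Rightarrow> real \<Rightarrow> (nat \<Rightarrow> real) \<Rightarrow> (nat \<Rightarrow> real) set" where
  "cell r s x = (\<Pi>\<^sub>E j\<in>{1..r}. {x j..<x j + s})"

lemma cell_sets [measurable]: "cell r s x \<in> sets (lebesgue_product r)"
  unfolding cell_def by (intro sets_PiM_I_finite) auto

lemma emeasure_cell:
  assumes "s \<ge> 0"
  shows "emeasure (lebesgue_product r) (cell r s x) = ennreal (s ^ r)"
proof -
  interpret product_sigma_finite "\<lambda>_. lborel :: real measure" ..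
  have "emeasure (lebesgue_product r) (cell r s x) = (\<Prod>j\<in>{1..r}. emeasure lborel {x j..<x j + s})"
    unfolding cell_def by (rule emeasure_PiM) auto
  also have "\<dots> = ennreal (s ^ r)" using assms by (simp add: ennreal_power)
  finally show ?thesis .
qed

lemma nn_integral_step_function:
  assumes "countable S" "\<And>k. k \<in> S \<Longrightarrow> 0 \<le> d k" "d summable_on S" "s \<ge> 0"
  shows "(\<integral>\<^sup>+y. (\<integral>\<^sup>+k. ennreal (d k) * indicator (cell r s (x k)) y \<partial>count_space S) \<partial>lebesgue_product r) =
    ennreal (s ^ r * infsum d S)"
proof -
  have abs: "Infinite_Set_Sum.abs_summable_on d S"
    using assms(2,3) by (simp flip: abs_summable_equivalent cong: summable_on_cong)
  have "(\<integral>\<^sup>+y. (\<integral>\<^sup>+k. ennreal (d k) * indicator (cell r s (x k)) y \<partial>count_space S) \<partial>lebesgue_product r) =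
      (\<integral>\<^sup>+k. (\<integral>\<^sup>+y. ennreal (d k) * indicator (cell r s (x k)) y \<partial>lebesgue_product r) \<partial>count_space S)"
    by (rule nn_integral_count_space_nn_integral[OF assms(1)]) measurable
  also have "\<dots> = (\<integral>\<^sup>+k. ennreal (d k) * ennreal (s ^ r) \<partial>count_space S)"
    by (intro nn_integral_cong) (simp only: nn_integral_cmult_indicator[OF cell_sets] emeasure_cell[OF assms(4)])
  also have "\<dots> = (\<integral>\<^sup>+k. ennreal (d k) \<partial>count_space S) * ennreal (s ^ r)"
    by (rule nn_integral_multc) simp
  also have "(\<integral>\<^sup>+k. ennreal (d k) \<partial>count_space S) = ennreal (infsum d S)"
    using nn_integral_conv_infsetsum[OF abs assms(2)] infsetsum_infsum[OF abs] by simp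
  also have "\<dots> * ennreal (s ^ r) = ennreal (s ^ r * infsum d S)"
    using assms by (simp add: ennreal_mult' mult.commute infsum_nonneg)
  finally show ?thesis .
qed

lemma countable_irrep_labels: "countable (irrep_labels r)"
  unfolding irrep_labels_def by (intro countable_PiE) auto

definition large_labels :: "nat \<Rightarrow> real \<Rightarrow> (nat \<Rightarrow> real) \<Rightarrow> (nat \<Rightarrow> nat) set" where
  "large_labels r s t = {k \<in> irrep_labels r. \<forall>j\<in>{1..r}. t j \<le> s * real (k j)}"

text \<open>
  The cell that ends at the lattice point \<open>s k\<close> is used, since \<open>occupation\<close> is decreasing and its
  infimum on a cell is at the upper end.
\<close>

lemma riemann_sum_le:
  assumes "s > 0" "\<And>j. j \<in> {1..r} \<Longrightarrow> s < t j"
    and "(\<lambda>k. occupation r (\<lambda>j. s * real (k j))) summable_on large_labels r s t"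
  shows "ennreal (s ^ r * (\<Sum>\<^sub>\<infinity>k\<in>large_labels r s t. occupation r (\<lambda>j. s * real (k j))))
    \<le> corner_mass r (\<lambda>j. t j - s)"
proof -
  let ?S = "large_labels r s t" and ?d = "\<lambda>k. occupation r (\<lambda>j. s * real (k j))"
  let ?cell = "\<lambda>k. cell r s (\<lambda>j. s * (real (k j) - 1))"
  have d0: "0 \<le> ?d k" if "k \<in> ?S" for k
    using that assms(1) irrep_labelsD[of k r] by (intro occupation_nonneg) (auto simp: large_labels_def Suc_le_eq)
  have "countable ?S" by (rule countable_subset[OF _ countable_irrep_labels]) (auto simp: large_labels_def)
  then have "ennreal (s ^ r * infsum ?d ?S) =
      (\<integral>\<^sup>+y. (\<integral>\<^sup>+k. ennreal (?d k) * indicator (?cell k) y \<partial>count_space ?S) \<partial>lebesgue_product r)"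
    using d0 assms(1,3) by (intro nn_integral_step_function[symmetric]) auto
  also have "\<dots> \<le> corner_mass r (\<lambda>j. t j - s)"
    unfolding corner_mass_def
  proof (intro nn_integral_mono)
    fix y
    show "(\<integral>\<^sup>+k. ennreal (?d k) * indicator (?cell k) y \<partial>count_space ?S) \<le>
        ennreal (occupation r y) * indicator (corner r (\<lambda>j. t j - s)) y"
    proof (cases "\<exists>k0\<in>?S. y \<in> ?cell k0")
      case True
      then obtain k0 where k0: "k0 \<in> ?S" "y \<in> ?cell k0" by blast
      then have y: "s * (real (k0 j) - 1) \<le> y j" "y j < s * real (k0 j)" "t j \<le> s * real (k0 j)"
        if "j \<in> {1..r}" for j
        using that by (auto simp: cell_def PiE_iff large_labels_def algebra_simps)
      have lower: "t j - s \<le> y j" if "j \<in> {1..r}" for j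
      proof -
        have "s * (real (k0 j) - 1) = s * real (k0 j) - s" by (simp add: right_diff_distrib)
        then show ?thesis using y[OF that] by linarith
      qed
      have unique: "k = k0" if k: "k \<in> ?S" "y \<in> ?cell k" for k
      proof (rule PiE_ext)
        show "k \<in> {1..r} \<rightarrow>\<^sub>E {1..}" "k0 \<in> {1..r} \<rightarrow>\<^sub>E {1..}"
          using k(1) k0(1) by (auto simp: large_labels_def irrep_labels_def)
        fix j assume j: "j \<in> {1..r}"
        have "s * (real (k j) - 1) \<le> y j" "y j < s * real (k j)"
          using k(2) j by (auto simp: cell_def PiE_iff algebra_simps)
        then have "s * (real (k j) - 1) < s * real (k0 j)" "s * (real (k0 j) - 1) < s * real (k j)"
          using y[OF j] by linarith+
        then show "k j = k0 j" using assms(1) by simp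
      qed
      have "(\<integral>\<^sup>+k. ennreal (?d k) * indicator (?cell k) y \<partial>count_space ?S) =
          (\<integral>\<^sup>+k. ennreal (?d k0) * indicator {k0} k \<partial>count_space ?S)"
      proof (rule nn_integral_cong)
        fix k assume "k \<in> space (count_space ?S)"
        then show "ennreal (?d k) * indicator (?cell k) y = ennreal (?d k0) * indicator {k0} k"
          using unique[of k] k0(2) by (cases "k = k0") (auto simp: indicator_def)
      qed
      also have "\<dots> = ennreal (?d k0)"
        using k0(1) by (subst nn_integral_cmult_indicator) auto
      also have "\<dots> \<le> ennreal (occupation r y)"
      proof (intro ennreal_leI occupation_antimono)
        fix j assume j: "j \<in> {1..r}"
        show "0 < y j" "y j \<le> s * real (k0 j)"
          using y[OF j] lower[OF j] assms(2)[OF j] by linarith+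
      qed
      finally have "(\<integral>\<^sup>+k. ennreal (?d k) * indicator (?cell k) y \<partial>count_space ?S) \<le> ennreal (occupation r y)" .
      moreover have "y \<in> corner r (\<lambda>j. t j - s)"
        using k0(2) lower by (auto simp: corner_def cell_def PiE_iff)
      ultimately show ?thesis by simp
    next
      case False
      then have "(\<integral>\<^sup>+k. ennreal (?d k) * indicator (?cell k) y \<partial>count_space ?S) =
          (\<integral>\<^sup>+k. 0 \<partial>count_space ?S)"
        by (intro nn_integral_cong) auto
      then show ?thesis by simp
    qed
  qed
  finally show ?thesis .
qed

text \<open>
  The cell that starts at \<open>s k\<close> is used; these cells cover the corner shifted by one mesh width.
\<close>

lemma riemann_sum_ge:
  assumes "s > 0" "\<And>j. j \<in> {1..r} \<Longrightarrow> 0 < t j"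
    and "(\<lambda>k. occupation r (\<lambda>j. s * real (k j))) summable_on large_labels r s t"
  shows "corner_mass r (\<lambda>j. t j + s) \<le>
    ennreal (s ^ r * (\<Sum>\<^sub>\<infinity>k\<in>large_labels r s t. occupation r (\<lambda>j. s * real (k j))))"
proof -
  let ?S = "large_labels r s t" and ?d = "\<lambda>k. occupation r (\<lambda>j. s * real (k j))"
  let ?cell = "\<lambda>k. cell r s (\<lambda>j. s * real (k j))"
  have d0: "0 \<le> ?d k" if "k \<in> ?S" for k
    using that assms(1) irrep_labelsD[of k r] by (intro occupation_nonneg) (auto simp: large_labels_def Suc_le_eq)
  have "corner_mass r (\<lambda>j. t j + s) \<le>
      (\<integral>\<^sup>+y. (\<integral>\<^sup>+k. ennreal (?d k) * indicator (?cell k) y \<partial>count_space ?S) \<partial>lebesgue_product r)"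
    unfolding corner_mass_def
  proof (intro nn_integral_mono)
    fix y
    show "ennreal (occupation r y) * indicator (corner r (\<lambda>j. t j + s)) y \<le>
        (\<integral>\<^sup>+k. ennreal (?d k) * indicator (?cell k) y \<partial>count_space ?S)"
    proof (cases "y \<in> corner r (\<lambda>j. t j + s)")
      case True
      define k0 where "k0 = (\<lambda>j\<in>{1..r}. nat \<lfloor>y j / s\<rfloor>)"
      have k0: "t j \<le> s * real (k0 j)" "s * real (k0 j) \<le> y j" "y j < s * real (k0 j) + s"
        "1 \<le> k0 j" if j: "j \<in> {1..r}" for j
      proof -
        have ty: "t j + s \<le> y j" using corner_memD[OF True j] .
        have y0: "y j / s \<ge> 1" using ty assms(1) assms(2)[OF j] by (simp add: field_simps)
        have k: "real (k0 j) = of_int \<lfloor>y j / s\<rfloor>" using y0 j by (simp add: k0_def)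
        have "of_int \<lfloor>y j / s\<rfloor> \<le> y j / s" "y j / s < of_int \<lfloor>y j / s\<rfloor> + 1" by linarith+
        then have "s * of_int \<lfloor>y j / s\<rfloor> \<le> s * (y j / s)" "s * (y j / s) < s * (of_int \<lfloor>y j / s\<rfloor> + 1)"
          using assms(1) by (auto simp del: times_divide_eq_right)
        then show yy: "s * real (k0 j) \<le> y j" "y j < s * real (k0 j) + s"
          unfolding k using assms(1) by (auto simp: distrib_left)
        then show "t j \<le> s * real (k0 j)" using ty by linarith
        have "1 \<le> \<lfloor>y j / s\<rfloor>" using y0 by simp
        then show "1 \<le> k0 j" using j by (simp add: k0_def le_nat_iff)
      qed
      have k0S: "k0 \<in> ?S" using k0 by (auto simp: large_labels_def irrep_labels_def k0_def)
      have yc: "y \<in> ?cell k0" using k0 True by (auto simp: cell_def corner_def PiE_iff)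
      have "ennreal (occupation r y) \<le> ennreal (?d k0)"
        using k0 assms(1) by (intro ennreal_leI occupation_antimono) (auto simp: Suc_le_eq)
      also have "\<dots> = (\<integral>\<^sup>+k. ennreal (?d k0) * indicator {k0} k \<partial>count_space ?S)"
        using k0S by (subst nn_integral_cmult_indicator) auto
      also have "\<dots> \<le> (\<integral>\<^sup>+k. ennreal (?d k) * indicator (?cell k) y \<partial>count_space ?S)"
        using yc by (intro nn_integral_mono) (auto simp: indicator_def)
      finally show ?thesis using True by simp
    qed simp
  qed
  also have "\<dots> = ennreal (s ^ r * infsum ?d ?S)"
  proof -
    have "countable ?S" by (rule countable_subset[OF _ countable_irrep_labels]) (auto simp: large_labels_def)
    then show ?thesis using d0 assms(1,3) by (intro nn_integral_step_function) auto
  qed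
  finally show ?thesis .
qed

text \<open>
  Squeezed between two shifts of the corner by the mesh width, the error is uniform in \<open>t\<close> by the
  Lipschitz bound for \<open>limit_shape\<close>.
\<close>

lemma riemann_sum_limit_shape:
  assumes "r \<ge> 1" "\<eta> > 0" "0 < s" "s \<le> \<eta>" "\<And>j. j \<in> {1..r} \<Longrightarrow> 2 * \<eta> \<le> t j"
    and sm: "(\<lambda>k. occupation r (\<lambda>j. s * real (k j))) summable_on large_labels r s t"
  shows "\<bar>s ^ r * (\<Sum>\<^sub>\<infinity>k\<in>large_labels r s t. occupation r (\<lambda>j. s * real (k j))) - limit_shape r t\<bar>
    \<le> real r * (slab_const r \<eta> * s)"
proof -
  let ?R = "s ^ r * (\<Sum>\<^sub>\<infinity>k\<in>large_labels r s t. occupation r (\<lambda>j. s * real (k j)))"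
  let ?\<kappa> = "decay_rate r \<eta>"
  have \<kappa>: "?\<kappa> > 0" by (rule decay_rate_pos[OF assms(2)])
  (* Any T with this property serves: the shifts by s below are all covered by the first
     alternative of the Lipschitz bound. *)
  define T where "T = - ln (s * ?\<kappa>) / ?\<kappa>"
  have T: "exp (- ?\<kappa> * T) / ?\<kappa> \<le> s" using \<kappa> assms(3) by (simp add: T_def)
  have lo: "\<eta> \<le> t j - s" "\<eta> \<le> t j" "\<eta> \<le> t j + s" "s < t j" "0 < t j" if "j \<in> {1..r}" for j
    using assms(2-4) assms(5)[OF that] by linarith+
  have R0: "0 \<le> ?R"
    using assms(3) irrep_labelsD[of _ r]
    by (intro mult_nonneg_nonneg infsum_nonneg occupation_nonneg) (auto simp: large_labels_def Suc_le_eq)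
  have "ennreal ?R \<le> corner_mass r (\<lambda>j. t j - s)" using lo assms(3) sm by (intro riemann_sum_le)
  also have "\<dots> = ennreal (limit_shape r (\<lambda>j. t j - s))"
    using lo by (intro corner_mass_eq_limit_shape[OF assms(1,2)])
  finally have "?R \<le> limit_shape r (\<lambda>j. t j - s)"
    using limit_shape_nonneg[OF assms(1,2) lo(1)] by (subst (asm) ennreal_le_iff) auto
  also have "\<dots> \<le> limit_shape r t + real r * (slab_const r \<eta> * s)"
    using lo assms(3) by (intro limit_shape_diff_le[OF assms(1,2) _ _ T]) auto
  finally have up: "?R \<le> limit_shape r t + real r * (slab_const r \<eta> * s)" .
  have "limit_shape r t \<le> limit_shape r (\<lambda>j. t j + s) + real r * (slab_const r \<eta> * s)"
    using lo assms(3) by (intro limit_shape_diff_le[OF assms(1,2) _ _ T]) auto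
  moreover have "limit_shape r (\<lambda>j. t j + s) \<le> ?R"
  proof -
    have "ennreal (limit_shape r (\<lambda>j. t j + s)) = corner_mass r (\<lambda>j. t j + s)"
      using lo by (intro corner_mass_eq_limit_shape[OF assms(1,2), symmetric])
    also have "\<dots> \<le> ennreal ?R" using lo assms(3) sm by (intro riemann_sum_ge)
    finally show ?thesis using R0 by (subst (asm) ennreal_le_iff) auto
  qed
  ultimately show ?thesis using up by linarith
qed

section \<open>Convergence of the shape function\<close>

lemma irrep_weighted_parts:
  assumes "r \<ge> 2"
  shows "weighted_parts (irrep_labels r) (irrep_dim r) (\<lambda>j\<in>{1..r}. 1)
    (2 / (real r + 1)) (3 / (real r + 1)) (1 / 2 ^ r)"
proof
  show "(\<lambda>j\<in>{1..r}. 1) \<in> irrep_labels r" by (auto simp: irrep_labels_def)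
  show "irrep_dim r (\<lambda>j\<in>{1..r}. 1) = 1" by (rule irrep_dim_trivial)
qed (use assms irrep_dim_Ints irrep_dim_ge_1 witten_zeta_summable card_irrep_dim_le_ge in
    \<open>auto simp: divide_simps\<close>)

lemma sum_mset_eq_sum_count:
  fixes f :: "'a \<Rightarrow> real"
  assumes "finite A" "set_mset \<rho> \<subseteq> A"
  shows "(\<Sum>k\<in>#\<rho>. f k) = (\<Sum>k\<in>A. f k * real (count \<rho> k))"
  using assms(2)
proof (induction \<rho>)
  case (add x \<rho>)
  have "(\<Sum>k\<in>A. f k * real (count (add_mset x \<rho>) k)) = (\<Sum>k\<in>A. f k * real (count \<rho> k) + (if k = x then f x else 0))"
    by (intro sum.cong) (auto simp: algebra_simps)
  also have "\<dots> = (\<Sum>k\<in>A. f k * real (count \<rho> k)) + f x"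
    using assms(1) add.prems by (simp add: sum.distrib)
  finally show ?case using add by simp
qed simp

lemma shape_eq_size_filter:
  assumes "s > 0" "set_mset \<rho> \<subseteq> irrep_labels r"
  shows "shape r \<rho> (\<lambda>j\<in>{1..r}. t j / s) = size (filter_mset (\<lambda>k. k \<in> large_labels r s t) \<rho>)"
proof -
  have "{k. k \<in> set_mset \<rho> \<and> (\<forall>j\<in>{1..r}. (\<lambda>j\<in>{1..r}. t j / s) j \<le> real (k j))} =
      set_mset (filter_mset (\<lambda>k. k \<in> large_labels r s t) \<rho>)"
    using assms by (auto simp: large_labels_def pos_divide_le_eq mult.commute)
  then show ?thesis
    unfolding shape_def size_multiset_overloaded_eq by (intro sum.cong) auto
qed

lemma occupation_scale:
  "occupation r (\<lambda>j. s * real (k j)) = bose (s ^ num_roots r * irrep_dim r k)"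
  by (simp add: occupation_def dim_poly_scale irrep_dim_def)

text \<open>
  The scale of exponents for the parts is \<open>s ^ (- r)\<close>, the scale of the shape function.
\<close>

lemma scale_powr:
  assumes "s > 0"
  shows "(s ^ num_roots r) powr - (2 / (real r + 1)) = 1 / s ^ r"
proof -
  have "real (num_roots r) * - (2 / (real r + 1)) = - real r"
    using two_num_roots[of r] by (simp add: divide_simps)
  then have "(s ^ num_roots r) powr - (2 / (real r + 1)) = s powr - real r"
    unfolding powr_realpow[OF assms, symmetric] powr_powr by (simp only:)
  then show ?thesis using assms by (simp add: powr_minus_divide powr_realpow)
qed

lemma large_labels_exp_sum:
  assumes "r \<ge> 1" "\<eta> > 0" "s > 0" "\<And>j. j \<in> {1..r} \<Longrightarrow> \<eta> \<le> t j"
  shows "(\<Sum>\<^sub>\<infinity>k\<in>large_labels r s t. exp (- (s ^ num_roots r * irrep_dim r k) / 4))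
    \<le> (4 / decay_rate r \<eta>) ^ r * (1 / s ^ r)"
proof -
  let ?\<kappa> = "decay_rate r \<eta>"
  have \<kappa>: "?\<kappa> > 0" by (rule decay_rate_pos[OF assms(2)])
  define x where "x = ?\<kappa> * s / 4"
  have x: "x > 0" using \<kappa> assms by (simp add: x_def)
  let ?S = "large_labels r s t" and ?f = "\<lambda>k. exp (- (s ^ num_roots r * irrep_dim r k) / 4)"
  let ?g = "\<lambda>k :: nat \<Rightarrow> nat. \<Prod>j\<in>{1..r}. exp (- x) ^ k j"
  have geo: "((\<lambda>m. exp (- x) ^ m) has_sum bose x) {1..}"
  proof -
    have "(\<lambda>m. exp (- x) ^ Suc m) sums (exp (- x) * (1 / (1 - exp (- x))))"
      using x sums_mult[OF geometric_sums[of "exp (- x)"], of "exp (- x)"] by simp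
    then have "((\<lambda>m. exp (- x) ^ Suc m) has_sum bose x) UNIV"
      using x by (intro sums_nonneg_imp_has_sum) (auto simp: bose_altdef)
    also have "?this \<longleftrightarrow> ?thesis"
      by (rule has_sum_reindex_bij_witness[where i = "\<lambda>m. m - 1" and j = Suc]) auto
    finally show ?thesis .
  qed
  have "Infinite_Set_Sum.abs_summable_on (\<lambda>m. exp (- x) ^ m) {1..}"
    using has_sum_imp_summable[OF geo] by (simp flip: abs_summable_equivalent)
  then have abs: "Infinite_Set_Sum.abs_summable_on ?g ({1..r} \<rightarrow>\<^sub>E {1..})"
    by (intro abs_summable_on_prod_PiE) auto
  have g0: "?g k \<ge> 0" for k by (intro prod_nonneg) auto
  have "(\<lambda>k. norm (?g k)) summable_on irrep_labels r"
    using abs unfolding irrep_labels_def by (simp only: abs_summable_equivalent)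
  then have g_sum: "?g summable_on irrep_labels r"
    by (simp add: abs_prod)
  have "infsum ?g (irrep_labels r) = (\<Prod>j\<in>{1..r}. infsum (\<lambda>m. exp (- x) ^ m) {1..})"
    unfolding irrep_labels_def using has_sum_imp_summable[OF geo]
    by (intro infsum_prod_PiE_abs) auto
  also have "\<dots> = bose x ^ r" using infsumI[OF geo] by simp
  also have "\<dots> \<le> (1 / x) ^ r"
  proof (rule power_mono)
    show "bose x \<le> 1 / x"
    proof -
      have "x \<le> exp x - 1" using exp_ge_add_one_self[of x] by linarith
      then show ?thesis unfolding bose_def using x by (intro divide_left_mono mult_pos_pos) auto
    qed
  qed (use x bose_pos[of x] in auto)
  also have "\<dots> = (4 / ?\<kappa>) ^ r * (1 / s ^ r)"
    by (simp add: x_def power_divide power_mult_distrib field_simps)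
  finally have total: "infsum ?g (irrep_labels r) \<le> (4 / ?\<kappa>) ^ r * (1 / s ^ r)" .
  have le: "?f k \<le> ?g k" if "k \<in> ?S" for k
  proof -
    have y: "\<eta> \<le> s * real (k j)" if "j \<in> {1..r}" for j
      using \<open>k \<in> ?S\<close> assms(4)[OF that] that by (force simp: large_labels_def)
    have "?\<kappa> * (\<Sum>j=1..r. s * real (k j)) \<le> dim_poly r (\<lambda>j. s * real (k j))"
      using dim_poly_ge_sum[OF assms(1,2) y] by (simp add: decay_rate_def)
    then have "?f k \<le> exp (- ?\<kappa> * (\<Sum>j=1..r. s * real (k j)) / 4)"
      by (simp add: dim_poly_scale irrep_dim_def)
    also have "- ?\<kappa> * (\<Sum>j=1..r. s * real (k j)) / 4 = (\<Sum>j=1..r. real (k j) * - x)"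
      by (simp add: x_def sum_distrib_left sum_divide_distrib sum_negf mult_ac)
    also have "exp \<dots> = ?g k"
      unfolding exp_sum[OF finite_atLeastAtMost] by (simp only: exp_of_nat_mult)
    finally show ?thesis .
  qed
  have S: "?S \<subseteq> irrep_labels r" by (auto simp: large_labels_def)
  have g_sum_S: "?g summable_on ?S" using g_sum S by (rule summable_on_subset_banach)
  have "?f summable_on ?S"
    by (rule summable_on_comparison_test[OF g_sum_S]) (use le in auto)
  then have "infsum ?f ?S \<le> infsum ?g (irrep_labels r)"
    using g_sum S le g0 by (intro infsum_mono_neutral) auto
  with total show ?thesis by simp
qed

lemma parts_eq_reps:
  assumes "r \<ge> 2"
  shows "weighted_parts.parts (irrep_labels r) (irrep_dim r) n = reps r n"
proof -
  interpret weighted_parts "irrep_labels r" "irrep_dim r" "\<lambda>j\<in>{1..r}. 1"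
    "2 / (real r + 1)" "3 / (real r + 1)" "1 / 2 ^ r"
    by (rule irrep_weighted_parts[OF assms])
  have "weight \<rho> = rep_dim r \<rho>" for \<rho>
    unfolding weight_def rep_dim_def by (rule sum_mset_eq_sum_count) auto
  then show ?thesis by (simp add: parts_def reps_def)
qed

text \<open>
  Identifies the two definite descriptions: \<open>q_seq r n = exp (- \<theta>)\<close> for the unique \<open>\<theta>\<close> with
  \<open>mean \<theta> = n\<close>, and \<open>s_seq r n\<close> is the root of \<open>\<theta>\<close> of order \<open>num_roots r\<close>.
\<close>

lemma s_seq_properties:
  assumes "r \<ge> 2" "n \<ge> 1"
  shows "s_seq r n > 0"
    and "weighted_parts.mean (irrep_labels r) (irrep_dim r) (s_seq r n ^ num_roots r) = real n"
proof -
  interpret weighted_parts "irrep_labels r" "irrep_dim r" "\<lambda>j\<in>{1..r}. 1"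
    "2 / (real r + 1)" "3 / (real r + 1)" "1 / 2 ^ r"
    by (rule irrep_weighted_parts[OF assms(1)])
  obtain \<theta> where \<theta>: "\<theta> > 0" "mean \<theta> = real n"
    using mean_exists_unique[of "real n"] assms(2) by auto
  let ?f = "\<lambda>x k. irrep_dim r k * x powr irrep_dim r k / (1 - x powr irrep_dim r k)"
  have f_eq: "?f (exp (- t)) k = irrep_dim r k * bose (t * irrep_dim r k)" for t k
    by (simp add: bose_altdef exp_powr_real)
  have iff: "(?f (exp (- t)) has_sum real n) (irrep_labels r) \<longleftrightarrow> mean t = real n" if "t > 0" for t
  proof
    show "mean t = real n" if "(?f (exp (- t)) has_sum real n) (irrep_labels r)"
      using infsumI[OF that] by (simp add: f_eq mean_def)
    show "(?f (exp (- t)) has_sum real n) (irrep_labels r)" if "mean t = real n"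
      using has_sum_infsum[OF mean_summable[OF \<open>t > 0\<close>]] that by (simp add: f_eq mean_def)
  qed
  have "q_seq r n = exp (- \<theta>)"
    unfolding q_seq_def
  proof (rule the_equality)
    show "exp (- \<theta>) \<in> {0<..<1} \<and> (?f (exp (- \<theta>)) has_sum real n) (irrep_labels r)"
      using \<theta> iff[OF \<theta>(1)] by auto
    fix x assume x: "x \<in> {0<..<1} \<and> (?f x has_sum real n) (irrep_labels r)"
    define t where "t = - ln x"
    have t: "t > 0" "x = exp (- t)" using x by (auto simp: t_def)
    have "mean t = real n" using x iff[OF t(1)] unfolding t(2) by simp
    then have "t = \<theta>" using mean_exists_unique[of "real n"] \<theta> t(1) assms(2) by auto
    then show "x = exp (- \<theta>)" using t by simp
  qed
  moreover define s where "s = root (num_roots r) \<theta>"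
  have s: "s > 0" "s ^ num_roots r = \<theta>"
    using \<theta>(1) num_roots_pos[of r] assms(1) by (auto simp: s_def)
  ultimately have "s_seq r n = s"
    unfolding s_seq_def num_roots_def[symmetric]
  proof (intro the_equality)
    fix x assume "x > 0 \<and> q_seq r n = exp (- (x ^ num_roots r))"
    then have "x > 0" "x ^ num_roots r = s ^ num_roots r" using \<open>q_seq r n = exp (- \<theta>)\<close> s by auto
    then show "x = s" using s(1) num_roots_pos[of r] assms(1) by (intro power_eq_imp_eq_base[of x _ s]) auto
  qed auto
  then show "s_seq r n > 0" "mean (s_seq r n ^ num_roots r) = real n" using s \<theta> by auto
qed

lemma s_seq_tendsto:
  assumes "r \<ge> 2"
  shows "filterlim (\<lambda>n. s_seq r n ^ num_roots r) (at_right 0) sequentially"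
    and "s_seq r \<longlonglongrightarrow> 0"
proof -
  interpret weighted_parts "irrep_labels r" "irrep_dim r" "\<lambda>j\<in>{1..r}. 1"
    "2 / (real r + 1)" "3 / (real r + 1)" "1 / 2 ^ r"
    by (rule irrep_weighted_parts[OF assms])
  have ev_pos: "\<forall>\<^sub>F n in sequentially. s_seq r n > 0"
    using eventually_ge_at_top[of 1] by eventually_elim (rule s_seq_properties[OF assms])
  have small: "\<forall>\<^sub>F n in sequentially. s_seq r n ^ num_roots r < \<theta>0" if "\<theta>0 > 0" for \<theta>0
    using eventually_ge_at_top[of "nat \<lceil>mean \<theta>0\<rceil> + 1"]
  proof eventually_elim
    case (elim n)
    then have n: "n \<ge> 1" "mean \<theta>0 < real n" by linarith+
    show ?case
    proof (rule ccontr)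
      assume "\<not> ?case"
      then have "mean (s_seq r n ^ num_roots r) \<le> mean \<theta>0" using that by (intro mean_antimono) auto
      then show False using n s_seq_properties(2)[OF assms n(1)] by simp
    qed
  qed
  have "(\<lambda>n. s_seq r n ^ num_roots r) \<longlonglongrightarrow> 0"
  proof (rule order_tendstoI)
    fix a :: real assume "a < 0"
    from ev_pos show "\<forall>\<^sub>F n in sequentially. a < s_seq r n ^ num_roots r"
      by eventually_elim (use \<open>a < 0\<close> in \<open>auto intro: less_trans\<close>)
  qed (rule small)
  then show "filterlim (\<lambda>n. s_seq r n ^ num_roots r) (at_right 0) sequentially"
    unfolding filterlim_at using ev_pos by (auto elim: eventually_mono)
  show "s_seq r \<longlonglongrightarrow> 0"
  proof (rule order_tendstoI)
    fix a :: real assume "a < 0"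
    from ev_pos show "\<forall>\<^sub>F n in sequentially. a < s_seq r n"
      by eventually_elim (use \<open>a < 0\<close> in auto)
  next
    fix a :: real assume "a > 0"
    then have "\<forall>\<^sub>F n in sequentially. s_seq r n ^ num_roots r < a ^ num_roots r"
      by (intro small) simp
    then show "\<forall>\<^sub>F n in sequentially. s_seq r n < a"
      by eventually_elim (use \<open>a > 0\<close> in \<open>auto intro: power_less_imp_less_base\<close>)
  qed
qed

lemma reps_finite_nonempty:
  assumes "r \<ge> 2"
  shows "finite (reps r n)" "reps r n \<noteq> {}"
proof -
  interpret weighted_parts "irrep_labels r" "irrep_dim r" "\<lambda>j\<in>{1..r}. 1"
    "2 / (real r + 1)" "3 / (real r + 1)" "1 / 2 ^ r"
    by (rule irrep_weighted_parts[OF assms])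
  show "finite (reps r n)" using finite_parts[of n] by (simp add: parts_eq_reps[OF assms])
  have "replicate_mset n (\<lambda>j\<in>{1..r}. 1) \<in> parts n"
    using e_in a_e by (auto simp: parts_def weight_def)
  then show "reps r n \<noteq> {}" by (auto simp: parts_eq_reps[OF assms])
qed

definition scaled_shape :: "nat \<Rightarrow> nat \<Rightarrow> (nat \<Rightarrow> nat) multiset \<Rightarrow> (nat \<Rightarrow> real) \<Rightarrow> real" where
  "scaled_shape r n \<rho> t = s_seq r n ^ r * real (shape r \<rho> (\<lambda>j\<in>{1..r}. t j / s_seq r n))"

text \<open>
  The set \<open>S\<close> of \<open>statistic_concentration\<close> is the set of labels \<open>k\<close> with \<open>s k\<close> in the corner at \<open>t\<close>;
  half of \<open>\<epsilon>\<close> pays for the Riemann sum error.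
\<close>

lemma pointwise_concentration:
  assumes "r \<ge> 2" "\<eta> > 0" "\<epsilon> > 0" "\<And>j. j \<in> {1..r} \<Longrightarrow> \<eta> \<le> t j"
  shows "(\<lambda>n. real (card {\<rho> \<in> reps r n. \<epsilon> \<le> \<bar>scaled_shape r n \<rho> t - limit_shape r t\<bar>}) / real (card (reps r n)))
    \<longlonglongrightarrow> 0"
proof -
  interpret weighted_parts "irrep_labels r" "irrep_dim r" "\<lambda>j\<in>{1..r}. 1"
    "2 / (real r + 1)" "3 / (real r + 1)" "1 / 2 ^ r"
    by (rule irrep_weighted_parts[OF assms(1)])
  let ?\<alpha> = "2 / (real r + 1)" and ?T = "(4 / decay_rate r \<eta>) ^ r" and ?R = "num_roots r"
  have r1: "r \<ge> 1" using assms(1) by simp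
  have T: "?T > 0" using decay_rate_pos[OF assms(2)] by simp
  obtain \<kappa> where \<kappa>: "\<kappa> > 0" and conc: "\<forall>\<^sub>F \<theta> in at_right 0. \<forall>n S. mean \<theta> = real n \<longrightarrow> S \<subseteq> irrep_labels r \<longrightarrow>
      (\<forall>k\<in>S. \<eta> ^ ?R \<le> \<theta> * irrep_dim r k) \<longrightarrow>
      (\<Sum>\<^sub>\<infinity>k\<in>S. exp (- (\<theta> * irrep_dim r k) / 4)) \<le> ?T * \<theta> powr - ?\<alpha> \<longrightarrow>
      real (card {\<rho> \<in> parts n. \<epsilon> / 2 * \<theta> powr - ?\<alpha> \<le>
        \<bar>real (size (filter_mset (\<lambda>k. k \<in> S) \<rho>)) - (\<Sum>\<^sub>\<infinity>k\<in>S. bose (\<theta> * irrep_dim r k))\<bar>})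
      \<le> exp (- (\<kappa> * \<theta> powr - ?\<alpha>)) * real (card (parts n))"
    using statistic_concentration[of "\<eta> ^ ?R" ?T "\<epsilon> / 2"] assms(2,3) T by auto
  have ev1: "\<forall>\<^sub>F n in sequentially. 1 \<le> n" by (rule eventually_ge_at_top)
  define C where "C = real r * slab_const r (\<eta> / 2)"
  have C: "C > 0" using slab_const_pos[of "\<eta> / 2" r] assms by (simp add: C_def)
  have ev2: "\<forall>\<^sub>F n in sequentially. s_seq r n < min (\<eta> / 2) (\<epsilon> / (2 * C))"
    using s_seq_tendsto(2)[OF assms(1)] assms(2,3) C by (intro order_tendstoD(2)) auto
  have bound: "\<forall>\<^sub>F n in sequentially.
      real (card {\<rho> \<in> reps r n. \<epsilon> \<le> \<bar>scaled_shape r n \<rho> t - limit_shape r t\<bar>}) / real (card (reps r n))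
      \<le> exp (- (\<kappa> * (s_seq r n ^ ?R) powr - ?\<alpha>))"
    using ev1 ev2 filterlim_iff[THEN iffD1, OF s_seq_tendsto(1)[OF assms(1)], rule_format, OF conc]
  proof eventually_elim
    case (elim n)
    define s where "s = s_seq r n"
    have s: "s > 0" "mean (s ^ ?R) = real n" using s_seq_properties[OF assms(1) elim(1)] by (auto simp: s_def)
    have s_small: "s \<le> \<eta> / 2" "C * s \<le> \<epsilon> / 2" using elim(2) C by (auto simp: s_def field_simps)
    have N: "(s ^ ?R) powr - ?\<alpha> = 1 / s ^ r" by (rule scale_powr[OF s(1)])
    let ?S = "large_labels r s t"
    have S: "?S \<subseteq> irrep_labels r" by (auto simp: large_labels_def)
    have Sb: "\<eta> ^ ?R \<le> s ^ ?R * irrep_dim r k" if "k \<in> ?S" for k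
    proof -
      have "dim_poly r (\<lambda>_. \<eta>) \<le> dim_poly r (\<lambda>j. s * real (k j))"
        using that assms(2,4) by (intro dim_poly_mono) (force simp: large_labels_def)+
      then show ?thesis by (simp add: dim_poly_const dim_poly_scale irrep_dim_def)
    qed
    let ?\<mu> = "\<Sum>\<^sub>\<infinity>k\<in>?S. bose (s ^ ?R * irrep_dim r k)"
    have "(\<lambda>k. bose (s ^ ?R * irrep_dim r k)) summable_on irrep_labels r"
    proof (rule summable_on_comparison_test[OF mean_summable])
      show "0 < s ^ ?R" using s by simp
      fix k assume k: "k \<in> irrep_labels r"
      have "bose (s ^ ?R * irrep_dim r k) \<ge> 0"
        using s irrep_dim_ge_1[OF k] by (intro less_imp_le bose_pos mult_pos_pos) auto
      then show "bose (s ^ ?R * irrep_dim r k) \<ge> 0"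
        "bose (s ^ ?R * irrep_dim r k) \<le> irrep_dim r k * bose (s ^ ?R * irrep_dim r k)"
        using irrep_dim_ge_1[OF k] mult_right_mono[of 1 "irrep_dim r k" "bose (s ^ ?R * irrep_dim r k)"] by auto
    qed
    then have sm: "(\<lambda>k. bose (s ^ ?R * irrep_dim r k)) summable_on ?S"
      using S by (rule summable_on_subset_banach)
    have \<mu>: "\<bar>s ^ r * ?\<mu> - limit_shape r t\<bar> \<le> \<epsilon> / 2"
    proof -
      have "\<bar>s ^ r * ?\<mu> - limit_shape r t\<bar> \<le> C * s"
        using riemann_sum_limit_shape[OF r1, of "\<eta> / 2" s t] sm s s_small(1) assms(2,4)
        by (simp add: occupation_scale C_def mult.assoc)
      with s_small show ?thesis by simp
    qed
    let ?bad = "{\<rho> \<in> reps r n. \<epsilon> \<le> \<bar>scaled_shape r n \<rho> t - limit_shape r t\<bar>}"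
    let ?dev = "{\<rho> \<in> parts n. \<epsilon> / 2 * (s ^ ?R) powr - ?\<alpha> \<le>
        \<bar>real (size (filter_mset (\<lambda>k. k \<in> ?S) \<rho>)) - ?\<mu>\<bar>}"
    have "?bad \<subseteq> ?dev"
    proof
      fix \<rho> assume \<rho>: "\<rho> \<in> ?bad"
      let ?\<phi> = "real (size (filter_mset (\<lambda>k. k \<in> ?S) \<rho>))"
      have labels: "set_mset \<rho> \<subseteq> irrep_labels r" using \<rho> by (auto simp: reps_def)
      have "scaled_shape r n \<rho> t = s ^ r * ?\<phi>"
        unfolding scaled_shape_def s_def[symmetric] shape_eq_size_filter[OF s(1) labels] ..
      then have "\<epsilon> \<le> \<bar>s ^ r * ?\<phi> - limit_shape r t\<bar>" using \<rho> by simp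
      with \<mu> have "\<epsilon> / 2 \<le> \<bar>s ^ r * ?\<phi> - s ^ r * ?\<mu>\<bar>" by linarith
      also have "\<dots> = s ^ r * \<bar>?\<phi> - ?\<mu>\<bar>" using s by (simp add: abs_mult flip: right_diff_distrib)
      finally have "\<epsilon> / 2 * (1 / s ^ r) \<le> \<bar>?\<phi> - ?\<mu>\<bar>" using s by (simp add: field_simps)
      then show "\<rho> \<in> ?dev" using \<rho> unfolding N parts_eq_reps[OF assms(1)] by simp
    qed
    then have "card ?bad \<le> card ?dev" using finite_parts by (intro card_mono) auto
    also have "real (card ?dev) \<le> exp (- (\<kappa> * (s ^ ?R) powr - ?\<alpha>)) * real (card (parts n))"
    proof -
      have "(\<Sum>\<^sub>\<infinity>k\<in>?S. exp (- (s ^ ?R * irrep_dim r k) / 4)) \<le> ?T * (s ^ ?R) powr - ?\<alpha>"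
        unfolding N by (rule large_labels_exp_sum[OF r1 assms(2) s(1) assms(4)])
      then show ?thesis using elim(3) s(2) S Sb unfolding s_def by blast
    qed
    finally show ?case
      using reps_finite_nonempty[OF assms(1), of n]
      unfolding s_def parts_eq_reps[OF assms(1)] by (simp add: divide_simps card_gt_0_iff)
  qed
  have "((\<lambda>\<theta>. exp (- (\<kappa> * \<theta> powr - ?\<alpha>))) \<longlongrightarrow> 0) (at_right 0)"
    using \<kappa> alpha_pos by real_asymp
  then have lim: "(\<lambda>n. exp (- (\<kappa> * (s_seq r n ^ ?R) powr - ?\<alpha>))) \<longlonglongrightarrow> 0"
    by (rule filterlim_compose[OF _ s_seq_tendsto(1)[OF assms(1)]])
  show ?thesis
    by (rule tendsto_sandwich[OF _ bound tendsto_const lim]) auto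
qed

lemma shape_antimono:
  assumes "\<And>j. j \<in> {1..r} \<Longrightarrow> t j \<le> t' j"
  shows "shape r \<rho> t' \<le> shape r \<rho> t"
  unfolding shape_def
proof (rule sum_mono2)
  show "{k. k \<in> set_mset \<rho> \<and> (\<forall>j\<in>{1..r}. t' j \<le> real (k j))} \<subseteq>
      {k. k \<in> set_mset \<rho> \<and> (\<forall>j\<in>{1..r}. t j \<le> real (k j))}"
    using assms by (blast intro: order_trans)
qed auto

lemma scaled_shape_antimono:
  assumes "s_seq r n > 0" "\<And>j. j \<in> {1..r} \<Longrightarrow> t j \<le> t' j"
  shows "scaled_shape r n \<rho> t' \<le> scaled_shape r n \<rho> t"
  unfolding scaled_shape_def using assms
  by (intro mult_left_mono of_nat_mono shape_antimono) (auto intro: divide_right_mono)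

text \<open>
  Every point above \<open>\<eta>\<close> has a grid point below it where \<open>limit_shape\<close> is almost the same. It also has one
  above it, unless some coordinate is so large that \<open>limit_shape\<close> is itself small, in which case the
  lower estimate for \<open>F\<close> is trivial.
\<close>

lemma grid_controls_sup:
  assumes "r \<ge> 1" "\<eta> > 0" "\<epsilon> > 0"
  obtains G where "finite G" "\<forall>t\<in>G. \<forall>j\<in>{1..r}. \<eta> \<le> t j"
    "\<forall>F t. (\<forall>t t'. (\<forall>j\<in>{1..r}. t j \<le> t' j) \<longrightarrow> F t' \<le> F t) \<longrightarrow> (\<forall>t. 0 \<le> F t) \<longrightarrow>
      (\<forall>g\<in>G. \<bar>F g - limit_shape r g\<bar> < \<epsilon> / 2) \<longrightarrow>
      (\<forall>j\<in>{1..r}. \<eta> \<le> t j) \<longrightarrow> \<bar>F t - limit_shape r t\<bar> \<le> \<epsilon>"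
proof -
  let ?\<kappa> = "decay_rate r \<eta>" and ?C = "slab_const r \<eta>"
  have pos: "?\<kappa> > 0" "?C > 0" using decay_rate_pos slab_const_pos assms(2) by auto
  (* The mesh h of the grid is chosen so that r slabs weigh at most \<epsilon> / 2, and beyond T a whole
     tail weighs no more than a slab of width h. *)
  define h where "h = \<epsilon> / (2 * real r * ?C)"
  have h: "h > 0" "real r * (?C * h) = \<epsilon> / 2" using assms pos by (auto simp: h_def)
  define T where "T = - ln (h * ?\<kappa>) / ?\<kappa>"
  have T: "exp (- ?\<kappa> * T) / ?\<kappa> \<le> h" using pos h by (simp add: T_def)
  define M where "M = nat \<lceil>(T - \<eta>) / h\<rceil>"
  have M: "T \<le> \<eta> + h * real M"
  proof -
    have "(T - \<eta>) / h \<le> real M" unfolding M_def by linarith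
    then show ?thesis using h by (simp add: field_simps)
  qed
  define G where "G = ({1..r} \<rightarrow>\<^sub>E (\<lambda>i. \<eta> + h * real i) ` {..M})"
  show thesis
  proof (rule that[of G])
    show "finite G" unfolding G_def by (intro finite_PiE) auto
    show "\<forall>t\<in>G. \<forall>j\<in>{1..r}. \<eta> \<le> t j"
    proof (intro ballI)
      fix t j assume "t \<in> G" "j \<in> {1..r}"
      then have "t j \<in> (\<lambda>i. \<eta> + h * real i) ` {..M}"
        unfolding G_def by (rule PiE_mem)
      then show "\<eta> \<le> t j" using h(1) by auto
    qed
  next
    show "\<forall>F t. (\<forall>t t'. (\<forall>j\<in>{1..r}. t j \<le> t' j) \<longrightarrow> F t' \<le> F t) \<longrightarrow> (\<forall>t. 0 \<le> F t) \<longrightarrow>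
        (\<forall>g\<in>G. \<bar>F g - limit_shape r g\<bar> < \<epsilon> / 2) \<longrightarrow>
        (\<forall>j\<in>{1..r}. \<eta> \<le> t j) \<longrightarrow> \<bar>F t - limit_shape r t\<bar> \<le> \<epsilon>"
    proof (intro allI impI)
      fix F :: "(nat \<Rightarrow> real) \<Rightarrow> real" and t :: "nat \<Rightarrow> real"
      assume "\<forall>t t'. (\<forall>j\<in>{1..r}. t j \<le> t' j) \<longrightarrow> F t' \<le> F t" "\<forall>t. 0 \<le> F t"
        "\<forall>g\<in>G. \<bar>F g - limit_shape r g\<bar> < \<epsilon> / 2" "\<forall>j\<in>{1..r}. \<eta> \<le> t j"
      note mono = this(1)[rule_format] and F0 = this(2)[rule_format]
        and close = this(3)[rule_format] and t = this(4)[rule_format]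
      define i where "i j = nat \<lfloor>(t j - \<eta>) / h\<rfloor>" for j
      have i: "\<eta> + h * real (i j) \<le> t j" "t j < \<eta> + h * (real (i j) + 1)" if "j \<in> {1..r}" for j
      proof -
        have "0 \<le> (t j - \<eta>) / h" using t[OF that] h by simp
        then have "real (i j) \<le> (t j - \<eta>) / h" "(t j - \<eta>) / h < real (i j) + 1"
          unfolding i_def by linarith+
        then show "\<eta> + h * real (i j) \<le> t j" "t j < \<eta> + h * (real (i j) + 1)"
          using h by (auto simp: field_simps)
      qed
      define lo where "lo = (\<lambda>j\<in>{1..r}. \<eta> + h * real (min (i j) M))"
      have lo: "lo \<in> G" by (auto simp: lo_def G_def)
      have lo_le: "lo j \<le> t j" "\<eta> \<le> lo j" if "j \<in> {1..r}" for j
      proof -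
        have "h * real (min (i j) M) \<le> h * real (i j)" using h by (intro mult_left_mono) auto
        then show "lo j \<le> t j" using i(1)[OF that] that by (simp add: lo_def)
        show "\<eta> \<le> lo j" using that h by (simp add: lo_def)
      qed
      have near: "t j - lo j \<le> h \<or> T \<le> lo j" if "j \<in> {1..r}" for j
        using i[OF that] M that by (cases "i j \<le> M") (auto simp: lo_def distrib_left)
      have "F t \<le> F lo" using lo_le by (intro mono)
      also have "F lo \<le> limit_shape r lo + \<epsilon> / 2" using close[OF lo] by linarith
      also have "limit_shape r lo \<le> limit_shape r t + real r * (?C * h)"
        using lo_le near by (intro limit_shape_diff_le[OF assms(1,2) _ _ T]) auto
      finally have upper: "F t \<le> limit_shape r t + \<epsilon>" using h by simp
      have lower: "limit_shape r t \<le> F t + \<epsilon>"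
      proof (cases "\<exists>j\<in>{1..r}. T \<le> t j")
        case True
        then obtain j where "j \<in> {1..r}" "T \<le> t j" by blast
        then have "limit_shape r t \<le> ?C * h" using t by (intro limit_shape_tail_le[OF assms(1,2) _ _ _ T]) auto
        also have "\<dots> \<le> real r * (?C * h)" using assms(1) pos h(1) by simp
        finally show ?thesis using h F0[of t] assms(3) by simp
      next
        case False
        define hi where "hi = (\<lambda>j\<in>{1..r}. \<eta> + h * real (Suc (i j)))"
        have iM: "Suc (i j) \<le> M" if "j \<in> {1..r}" for j
        proof -
          have "h * real (i j) < h * real M" using i(1)[OF that] M False that by force
          then show ?thesis using h by simp
        qed
        have hi: "hi \<in> G" using iM by (auto simp: hi_def G_def simp del: of_nat_Suc)
        have hi_ge: "t j \<le> hi j" "hi j - t j \<le> h" if "j \<in> {1..r}" for j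
          using i[OF that] that by (auto simp: hi_def algebra_simps)
        have "limit_shape r t \<le> limit_shape r hi + real r * (?C * h)"
          using hi_ge t by (intro limit_shape_diff_le[OF assms(1,2) _ _ T]) auto
        also have "limit_shape r hi \<le> F hi + \<epsilon> / 2" using close[OF hi] by linarith
        also have "F hi \<le> F t" using hi_ge by (intro mono)
        finally show ?thesis using h by simp
      qed
      from upper lower show "\<bar>F t - limit_shape r t\<bar> \<le> \<epsilon>" by linarith
    qed
  qed
qed

theorem theorem7p2:
  fixes r :: nat and \<epsilon> \<eta> :: real
  assumes "r \<ge> 2" and "\<epsilon> > 0" and "\<eta> > 0"
  shows "(\<lambda>n. measure (rep_measure r n)
           {\<rho> \<in> space (rep_measure r n).
              (SUP t \<in> {1..r} \<rightarrow>\<^sub>E {\<eta>..}.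
                 ereal \<bar>s_seq r n ^ r * real (shape r \<rho> (\<lambda>j\<in>{1..r}. t j / s_seq r n)) - limit_shape r t\<bar>)
              \<le> ereal \<epsilon>})
         \<longlonglongrightarrow> 1"
proof -
  let ?good = "\<lambda>n. {\<rho> \<in> reps r n. \<forall>t\<in>{1..r} \<rightarrow>\<^sub>E {\<eta>..}. \<bar>scaled_shape r n \<rho> t - limit_shape r t\<bar> \<le> \<epsilon>}"
  let ?P = "\<lambda>n A. real (card A) / real (card (reps r n))"
  have r1: "r \<ge> 1" using assms(1) by simp
  obtain G where G: "finite G" "\<forall>t\<in>G. \<forall>j\<in>{1..r}. \<eta> \<le> t j"
    and sup: "\<forall>F t. (\<forall>t t'. (\<forall>j\<in>{1..r}. t j \<le> t' j) \<longrightarrow> F t' \<le> F t) \<longrightarrow> (\<forall>t. 0 \<le> F t) \<longrightarrow>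
      (\<forall>g\<in>G. \<bar>F g - limit_shape r g\<bar> < \<epsilon> / 2) \<longrightarrow>
      (\<forall>j\<in>{1..r}. \<eta> \<le> t j) \<longrightarrow> \<bar>F t - limit_shape r t\<bar> \<le> \<epsilon>"
    by (rule grid_controls_sup[OF r1 assms(3,2)])
  let ?bad = "\<lambda>n g. {\<rho> \<in> reps r n. \<epsilon> / 2 \<le> \<bar>scaled_shape r n \<rho> g - limit_shape r g\<bar>}"
  have lim: "(\<lambda>n. 1 - (\<Sum>g\<in>G. ?P n (?bad n g))) \<longlonglongrightarrow> 1 - (\<Sum>g\<in>G. 0)"
    by (intro tendsto_diff tendsto_const tendsto_sum pointwise_concentration[OF assms(1,3)])
      (use assms G(2) in auto)
  have lower: "1 - (\<Sum>g\<in>G. ?P n (?bad n g)) \<le> ?P n (?good n)" if n: "n \<ge> 1" for n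
  proof -
    have fin: "finite (reps r n)" and card0: "real (card (reps r n)) > 0"
      using reps_finite_nonempty[OF assms(1), of n] by (auto simp: card_gt_0_iff)
    have s: "s_seq r n > 0" by (rule s_seq_properties[OF assms(1) n])
    have "reps r n \<subseteq> ?good n \<union> (\<Union>g\<in>G. ?bad n g)"
    proof
      fix \<rho> assume \<rho>: "\<rho> \<in> reps r n"
      show "\<rho> \<in> ?good n \<union> (\<Union>g\<in>G. ?bad n g)"
      proof (cases "\<rho> \<in> (\<Union>g\<in>G. ?bad n g)")
        case False
        then have "\<bar>scaled_shape r n \<rho> g - limit_shape r g\<bar> < \<epsilon> / 2" if "g \<in> G" for g
          using that \<rho> by force
        moreover have "0 \<le> scaled_shape r n \<rho> t" for t using s by (simp add: scaled_shape_def)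
        ultimately have "\<bar>scaled_shape r n \<rho> t - limit_shape r t\<bar> \<le> \<epsilon>" if "t \<in> {1..r} \<rightarrow>\<^sub>E {\<eta>..}" for t
          using that by (intro sup[rule_format] scaled_shape_antimono[OF s]) (auto simp: PiE_iff)
        then show ?thesis using \<rho> by auto
      qed simp
    qed
    then have "card (reps r n) \<le> card (?good n \<union> (\<Union>g\<in>G. ?bad n g))"
      using fin G(1) by (intro card_mono) auto
    also have "\<dots> \<le> card (?good n) + card (\<Union>g\<in>G. ?bad n g)" by (rule card_Un_le)
    also have "card (\<Union>g\<in>G. ?bad n g) \<le> (\<Sum>g\<in>G. card (?bad n g))" by (rule card_UN_le[OF G(1)])
    finally have "real (card (reps r n)) \<le> real (card (?good n)) + (\<Sum>g\<in>G. real (card (?bad n g)))"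
      by (simp flip: of_nat_sum of_nat_add)
    then have "1 \<le> (real (card (?good n)) + (\<Sum>g\<in>G. real (card (?bad n g)))) / real (card (reps r n))"
      using card0 by simp
    then show ?thesis by (simp add: add_divide_distrib sum_divide_distrib)
  qed
  have upper: "?P n (?good n) \<le> 1" for n
    using reps_finite_nonempty[OF assms(1), of n]
    by (auto intro!: divide_le_eq_1_pos[THEN iffD2] card_mono simp: card_gt_0_iff)
  have "(\<lambda>n. ?P n (?good n)) \<longlonglongrightarrow> 1"
  proof (rule tendsto_sandwich)
    show "\<forall>\<^sub>F n in sequentially. 1 - (\<Sum>g\<in>G. ?P n (?bad n g)) \<le> ?P n (?good n)"
      using eventually_ge_at_top[of 1] by eventually_elim (rule lower)
    show "(\<lambda>n. 1 - (\<Sum>g\<in>G. ?P n (?bad n g))) \<longlonglongrightarrow> 1" using lim by simp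
  qed (use upper in auto)
  moreover have "measure (rep_measure r n) {\<rho> \<in> space (rep_measure r n).
      (SUP t \<in> {1..r} \<rightarrow>\<^sub>E {\<eta>..}.
         ereal \<bar>s_seq r n ^ r * real (shape r \<rho> (\<lambda>j\<in>{1..r}. t j / s_seq r n)) - limit_shape r t\<bar>)
      \<le> ereal \<epsilon>} = ?P n (?good n)" for n
    unfolding rep_measure_def space_uniform_count_measure SUP_le_iff ereal_less_eq scaled_shape_def
    using reps_finite_nonempty(1)[OF assms(1)] by (intro measure_uniform_count_measure) auto
  ultimately show ?thesis by simp
qed

end
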